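(* Each of the polytopes $\nabla_{\mathrm{II.c}}^{(4)}$, $\nabla_{\mathrm{I.d}}^{(4)}$, $\nabla_{\mathrm{II.f}}^{(4)}$, $\nabla_{\mathrm{III.d}}^{(4)}$, $\nabla_{\mathrm{I.a}}^{(4)}$ and each prime compressed $3$-dimensional flow polytope (i.e. $\nabla_{\mathrm{I.a}}^{(3)}$, $\nabla_{\mathrm{II.c}}^{(3)}$, $\nabla_{\mathrm{I.b}}^{(3)}$, up to equivalence) has a pulling triangulation whose minimal non-faces have two elements. The polytope $\nabla_{\mathrm{V.b}}^{(4)}$ has a pulling triangulation whose minimal non-faces have three elements. More concretely, $\nabla_{\mathrm{I.a}}^{(3)}$ and $\nabla_{\mathrm{II.c}}^{(4)}$ are unimodular simplices of dimension $3$ and $4$, respectively, whereas: (i) pulling at $v_0$ yields the triangulation of $\nabla_{\mathrm{II.c}}^{(3)}$ with maximal cells $\langle0,2,3,4\rangle,\langle0,1,3,4\rangle$ and one minimal non-face $\{v_1,v_2\}$; (ii) pulling at $v_0$ yields the triangulation of $\nabla_{\mathrm{I.b}}^{(3)}$ with maximal cells $\langle0,1,2,5\rangle,\langle0,3,4,5\rangle,\langle0,1,3,5\rangle,\langle0,2,4,5\rangle$ and minimal non-faces $\{v_1,v_4\},\{v_2,v_3\}$; (iii) pulling at $v_2$ yields the triangulation of $\nabla_{\mathrm{I.d}}^{(4)}$ with maximal cells $\langle0,1,2,3,5\rangle,\langle0,1,2,4,5\rangle$ and one minimal non-face $\{v_3,v_4\}$; (iv) pulling at $v_2$ and then at $v_3$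 yields the triangulation of $\nabla_{\mathrm{II.f}}^{(4)}$ with maximal cells $\langle0,1,2,3,5\rangle,\langle0,2,3,5,6\rangle,\langle0,2,3,4,6\rangle$ and minimal non-faces $\{v_1,v_4\},\{v_1,v_6\},\{v_4,v_5\}$; (v) pulling at $v_3$, $v_0$ and then at $v_4$ yields the triangulation of $\nabla_{\mathrm{III.d}}^{(4)}$ with maximal cells $\langle0,1,2,3,5\rangle,\langle0,3,5,6,7\rangle,\langle0,1,3,5,7\rangle,\langle1,2,3,4,5\rangle,\langle1,3,4,5,7\rangle$ and minimal non-faces $\{v_0,v_4\},\{v_1,v_6\},\{v_2,v_6\},\{v_2,v_7\},\{v_4,v_6\}$; (vi) pulling at $v_4$, $v_6$ and then at $v_5$ yields the triangulation of $\nabla_{\mathrm{I.a}}^{(4)}$ with maximal cells $\langle0,4,5,6,7\rangle,\langle0,4,6,7,8\rangle,\langle0,1,2,4,6\rangle,\langle0,1,4,5,6\rangle,\langle0,1,3,4,5\rangle,\langle0,3,4,5,7\rangle$ and minimal non-faces $\{v_1,v_7\},\{v_1,v_8\},\{v_2,v_3\},\{v_2,v_5\},\{v_2,v_7\},\{v_2,v_8\},\{v_3,v_6\},\{v_3,v_8\},\{v_5,v_8\}$; (vii) pulling at $v_0$ yields the triangulation of $\nabla_{\mathrm{V.b}}^{(4)}$ with maximal cells $\langle0,2,3,4,5\rangle,\langle0,1,2,3,5\rangle,\langle0,1,2,4,5\rangle$ and one minimal non-face $\{v_1,v_3,v_4\}$.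
   Context: Lattice polytopes are considered up to equivalence: $\nabla\subset\mathbb{R}^d$ and $\nabla'\subset\mathbb{R}^{d'}$ are equivalent if there is an affine linear isomorphism of their affine spans mapping $\mathrm{AffSpan}(\nabla)\cap\mathbb{Z}^d$ onto $\mathrm{AffSpan}(\nabla')\cap\mathbb{Z}^{d'}$ and $\nabla$ onto $\nabla'$. A lattice polytope is prime if it is positive dimensional and not equivalent to a product of strictly smaller dimensional lattice polytopes; it is compressed if for each facet it lies between the hyperplane spanned by that facet and a neighbouring parallel lattice hyperplane. A flow polytope is a lattice polytope equivalent to $\{x\in\mathbb{R}^{Q_1}\mid x\ge0,\ \forall v\in Q_0:\ \sum_{a^+=v}x(a)-\sum_{a^-=v}x(a)=\theta(v)\}$ for an acyclic finite directed graph $Q$ (vertices $Q_0$, arrows $Q_1$, multiple arrows allowed, $a^-$ tail and $a^+$ head of $a$) and $\theta\in\mathbb{Z}^{Q_0}$. Up to equivalence the prime compressed $3$-dimensional flow polytopes are the three polytopes listed first below. Polytopes in $\mathbb{R}^3$ (coordinates $x,y,z$) with their lattice points: - $\nabla_{\mathrm{I.a}}^{(3)}$: $x,y,z\ge0$, $x+y+z\le1$; $v_0=000$, $v_1=100$, $v_2=010$, $v_3=001$ (writing points as coordinate strings). - $\nabla_{\mathrm{II.c}}^{(3)}$: $x,y,z\ge0$, $y+z\le1$, $x+y\le1$; $v_0=000$, $v_1=001$, $v_2=100$, $v_3=101$, $v_4=010$. - $\nabla_{\mathrm{I.b}}^{(3)}$: $0\le x,y,z\le1$, $0\le x+y-z\le1$;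 $v_0=000$, $v_1=100$, $v_2=101$, $v_3=010$, $v_4=011$, $v_5=111$. Polytopes in $\mathbb{R}^4$ (coordinates $x,y,z,w$) with their lattice points: - $\nabla_{\mathrm{II.c}}^{(4)}$: $x,y,z,w\ge0$, $x+y+z+w\le1$; $v_0=0000$, $v_1=1000$, $v_2=0100$, $v_3=0010$, $v_4=0001$. - $\nabla_{\mathrm{I.d}}^{(4)}$: $x,y,z,w\ge0$, $z\le x+y$, $x+y+w\le1$; $v_0=0000$, $v_1=0001$, $v_2=1000$, $v_3=1010$, $v_4=0100$, $v_5=0110$. - $\nabla_{\mathrm{II.f}}^{(4)}$: $x,y,z,w\ge0$, $w\le x+y+z\le1$; $v_0=0000$, $v_1=1000$, $v_2=1001$, $v_3=0100$, $v_4=0101$, $v_5=0010$, $v_6=0011$. - $\nabla_{\mathrm{III.d}}^{(4)}$: $x,y,z,w\ge0$, $z\le x+y\le1$, $x+y+w\le1+z$; $v_0=0000$, $v_1=0001$, $v_2=1000$, $v_3=1010$, $v_4=1011$, $v_5=0100$, $v_6=0110$, $v_7=0111$. - $\nabla_{\mathrm{I.a}}^{(4)}$: $x,y,z,w\ge0$, $x+y\le1$, $z\le x+y$, $w\le x+y$; $v_0=0000$, $v_1=1000$, $v_2=1010$, $v_3=1001$, $v_4=1011$, $v_5=0100$, $v_6=0110$, $v_7=0101$, $v_8=0111$. - $\nabla_{\mathrm{V.b}}^{(4)}$ (the $4$-dimensional Birkhoff polytope): $x,y,z,w\ge0$, $x\le z+w\le1$, $z\le x+y\le1$, $y+w\le1$;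 $v_0=0000$, $v_1=0001$, $v_2=1001$, $v_3=1010$, $v_4=0100$, $v_5=0110$. Notation: $\langle i_1,\dots,i_k\rangle$ is the convex hull of $\{v_{i_1},\dots,v_{i_k}\}$. Pulling a subdivision at a lattice point $v$ replaces every cell $C$ containing $v$ by the cells $\mathrm{Conv}(\{v\}\cup F)$, $F$ ranging over the faces of $C$ not containing $v$, and keeps the cells not containing $v$. One starts from the trivial subdivision of the polytope; a pulling triangulation is a triangulation obtained by successive pullings. A non-face of a triangulation is a set of lattice points of the polytope contained in no face of the triangulation; it is a minimal non-face if all its proper subsets are contained in some face. "Minimal non-faces have $k$ elements" means that every minimal non-face has exactly $k$ elements (vacuously true when there are none). *)

theory Defs
  imports "HOL-Analysis.Analysis"
begin

section \<open>Lattice polytopes\<close>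

definition int_lattice :: "(real^'n) set" where
  "int_lattice = {x. \<forall>i. x $ i \<in> \<int>}"

definition lattice_points :: "(real^'n) set \<Rightarrow> (real^'n) set" where
  "lattice_points P = P \<inter> int_lattice"

definition lattice_polytope :: "(real^'n) set \<Rightarrow> bool" where
  "lattice_polytope P \<longleftrightarrow> (\<exists>S. finite S \<and> S \<subseteq> int_lattice \<and> P = convex hull S)"

definition lattice_equiv :: "(real^'n) set \<Rightarrow> (real^'m) set \<Rightarrow> bool" where
  "lattice_equiv P P' \<longleftrightarrow> (\<exists>f.
     bij_betw f (affine hull P) (affine hull P') \<and>
     (\<forall>x\<in>affine hull P. \<forall>y\<in>affine hull P. \<forall>s t. s + t = 1 \<longrightarrow>
        f (s *\<^sub>R x + t *\<^sub>R y) = s *\<^sub>R f x + t *\<^sub>R f y) \<and>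
     f ` lattice_points (affine hull P) = lattice_points (affine hull P') \<and>
     f ` P = P')"

text \<open>The product of two polytopes, living in the Euclidean space indexed by the
  disjoint union of the two coordinate sets.\<close>

definition poly_prod :: "(real^'n) set \<Rightarrow> (real^'m) set \<Rightarrow> (real^('n + 'm)) set" where
  "poly_prod P P' = {x. (\<chi> i. x $ Inl i) \<in> P \<and> (\<chi> j. x $ Inr j) \<in> P'}"

text \<open>The factors are taken in the ambient space of \<^term>\<open>P\<close>. This loses nothing: the lattice
  points in the affine span of a \<open>k\<close>-dimensional lattice polytope form an affine copy of the
  standard lattice of rank \<open>k\<close>, so a factor of dimension \<open>k < aff_dim P \<le> CARD('n)\<close> from an
  arbitrary Euclidean space is equivalent to a lattice polytope in \<open>real^'n\<close>.\<close>

definition prime_polytope :: "(real^'n) set \<Rightarrow> bool" where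
  "prime_polytope P \<longleftrightarrow> lattice_polytope P \<and> aff_dim P > 0 \<and>
     \<not> (\<exists>(P1 :: (real^'n) set) (P2 :: (real^'n) set).
          lattice_polytope P1 \<and> lattice_polytope P2 \<and>
          aff_dim P1 < aff_dim P \<and> aff_dim P2 < aff_dim P \<and>
          lattice_equiv P (poly_prod P1 P2))"

text \<open>Hyperplanes are taken inside the affine span of \<^term>\<open>P\<close>. The hyperplane spanned by the
  facet is the level set at height \<^term>\<open>b\<close>; the level set at height \<^term>\<open>c\<close> is a parallel
  hyperplane that is spanned by lattice points, and it is a neighbour of the former one because no
  lattice point of the affine span lies strictly between the two.\<close>

definition compressed :: "(real^'n) set \<Rightarrow> bool" where
  "compressed P \<longleftrightarrow> lattice_polytope P \<and>
     (\<forall>F. F facet_of P \<longrightarrow> (\<exists>a b c.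
        affine hull F = affine hull P \<inter> {x. a \<bullet> x = b} \<and>
        affine hull P \<inter> {x. a \<bullet> x = c} \<noteq> {} \<and>
        affine hull (lattice_points (affine hull P \<inter> {x. a \<bullet> x = c}))
          = affine hull P \<inter> {x. a \<bullet> x = c} \<and>
        b < c \<and>
        \<not> (\<exists>x\<in>lattice_points (affine hull P). b < a \<bullet> x \<and> a \<bullet> x < c) \<and>
        P \<subseteq> {x. b \<le> a \<bullet> x \<and> a \<bullet> x \<le> c}))"

definition unimodular_simplex :: "nat \<Rightarrow> (real^'n) set \<Rightarrow> bool" where
  "unimodular_simplex d P \<longleftrightarrow> (\<exists>V. finite V \<and> V \<subseteq> int_lattice \<and>
     \<not> affine_dependent V \<and> card V = d + 1 \<and> P = convex hull V \<and>
     (\<forall>x\<in>lattice_points (affine hull V). \<exists>k :: real^'n \<Rightarrow> int.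
        sum k V = 1 \<and> x = (\<Sum>v\<in>V. of_int (k v) *\<^sub>R v)))"


section \<open>Flow polytopes\<close>

text \<open>A quiver has the arrows \<^typ>\<open>'a\<close> and the vertices \<^typ>\<open>'v\<close>; arrow \<^term>\<open>e\<close> runs from
  \<open>src e\<close> to \<open>tgt e\<close>. Any finite quiver with at least one arrow arises in this
  way up to isomorphism.\<close>

definition flow_set :: "('a \<Rightarrow> 'v) \<Rightarrow> ('a \<Rightarrow> 'v) \<Rightarrow> ('v \<Rightarrow> int) \<Rightarrow> (real^'a::finite) set" where
  "flow_set src tgt \<theta> = {x. (\<forall>e. 0 \<le> x $ e) \<and>
     (\<forall>v. (\<Sum>e | tgt e = v. x $ e) - (\<Sum>e | src e = v. x $ e) = of_int (\<theta> v))}"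

definition flow_polytope :: "'a::finite itself \<Rightarrow> 'v::finite itself \<Rightarrow> (real^'n) set \<Rightarrow> bool" where
  "flow_polytope _ _ P \<longleftrightarrow> lattice_polytope P \<and>
     (\<exists>(src :: 'a \<Rightarrow> 'v) tgt \<theta>. acyclic (range (\<lambda>e. (src e, tgt e))) \<and>
        lattice_equiv P (flow_set src tgt \<theta>))"


section \<open>Pulling triangulations\<close>

text \<open>Subdivisions are sets of cells closed under taking faces. As for \<^const>\<open>face_of\<close> and
  \<^const>\<open>simplicial_complex\<close>, the empty set counts as a face; it is the \<^term>\<open>F\<close> that produces the
  cell \<^term>\<open>{v}\<close> when pulling at \<^term>\<open>v\<close>.\<close>

definition trivial_subdivision :: "(real^'n) set \<Rightarrow> (real^'n) set set" where
  "trivial_subdivision P = {F. F face_of P}"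

definition pull :: "real^'n \<Rightarrow> (real^'n) set set \<Rightarrow> (real^'n) set set" where
  "pull v S = {C \<in> S. v \<notin> C} \<union>
     {convex hull (insert v F) | F C. C \<in> S \<and> v \<in> C \<and> F face_of C \<and> v \<notin> F}"

definition triangulates :: "(real^'n) set set \<Rightarrow> (real^'n) set \<Rightarrow> bool" where
  "triangulates T P \<longleftrightarrow> simplicial_complex T \<and> (\<forall>C\<in>T. lattice_polytope C) \<and> \<Union>T = P"

text \<open>The list is read from the left: its first point is pulled first.\<close>

definition pulls_to :: "(real^'n) set \<Rightarrow> (real^'n) list \<Rightarrow> (real^'n) set set \<Rightarrow> bool" where
  "pulls_to P vs T \<longleftrightarrow> set vs \<subseteq> lattice_points P \<and>
     T = fold pull vs (trivial_subdivision P) \<and> triangulates T P"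

definition pulling_triangulation :: "(real^'n) set \<Rightarrow> (real^'n) set set \<Rightarrow> bool" where
  "pulling_triangulation P T \<longleftrightarrow> (\<exists>vs. pulls_to P vs T)"

definition maximal_cells :: "(real^'n) set set \<Rightarrow> (real^'n) set set" where
  "maximal_cells T = {C \<in> T. \<not> (\<exists>D\<in>T. C \<subset> D)}"

definition non_face :: "(real^'n) set \<Rightarrow> (real^'n) set set \<Rightarrow> (real^'n) set \<Rightarrow> bool" where
  "non_face P T N \<longleftrightarrow> N \<subseteq> lattice_points P \<and> \<not> (\<exists>C\<in>T. N \<subseteq> C)"

definition minimal_non_face :: "(real^'n) set \<Rightarrow> (real^'n) set set \<Rightarrow> (real^'n) set \<Rightarrow> bool" where
  "minimal_non_face P T N \<longleftrightarrow> non_face P T N \<and> (\<forall>M. M \<subset> N \<longrightarrow> (\<exists>C\<in>T. M \<subseteq> C))"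

definition has_pulling_triangulation_mnf :: "nat \<Rightarrow> (real^'n) set \<Rightarrow> bool" where
  "has_pulling_triangulation_mnf k P \<longleftrightarrow>
     (\<exists>T. pulling_triangulation P T \<and> (\<forall>N. minimal_non_face P T N \<longrightarrow> card N = k))"

text \<open>Given the list \<^term>\<open>v\<close> of lattice points of \<^term>\<open>P\<close>: pulling successively at the points with
  indices \<^term>\<open>js\<close> yields a triangulation whose maximal cells are the convex hulls of the index sets
  in \<^term>\<open>Cs\<close> and whose minimal non-faces are the point sets with index sets in \<^term>\<open>Ns\<close>.\<close>

definition pulling_yields ::
  "(real^'n) set \<Rightarrow> (real^'n) list \<Rightarrow> nat list \<Rightarrow> nat set set \<Rightarrow> nat set set \<Rightarrow> bool" where
  "pulling_yields P v js Cs Ns \<longleftrightarrow> (\<exists>T. pulls_to P (map ((!) v) js) T \<and>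
     maximal_cells T = (\<lambda>I. convex hull ((!) v ` I)) ` Cs \<and>
     {N. minimal_non_face P T N} = (\<lambda>I. (!) v ` I) ` Ns)"


section \<open>The polytopes\<close>

definition poly_Ia3 :: "(real^3) set" where
  "poly_Ia3 = {p. 0 \<le> p$1 \<and> 0 \<le> p$2 \<and> 0 \<le> p$3 \<and> p$1 + p$2 + p$3 \<le> 1}"

definition poly_IIc3 :: "(real^3) set" where
  "poly_IIc3 = {p. 0 \<le> p$1 \<and> 0 \<le> p$2 \<and> 0 \<le> p$3 \<and> p$2 + p$3 \<le> 1 \<and> p$1 + p$2 \<le> 1}"

definition verts_IIc3 :: "(real^3) list" where
  "verts_IIc3 = [vector [0,0,0], vector [0,0,1], vector [1,0,0], vector [1,0,1], vector [0,1,0]]"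

definition poly_Ib3 :: "(real^3) set" where
  "poly_Ib3 = {p. 0 \<le> p$1 \<and> p$1 \<le> 1 \<and> 0 \<le> p$2 \<and> p$2 \<le> 1 \<and> 0 \<le> p$3 \<and> p$3 \<le> 1 \<and>
     0 \<le> p$1 + p$2 - p$3 \<and> p$1 + p$2 - p$3 \<le> 1}"

definition verts_Ib3 :: "(real^3) list" where
  "verts_Ib3 = [vector [0,0,0], vector [1,0,0], vector [1,0,1], vector [0,1,0], vector [0,1,1],
     vector [1,1,1]]"

definition poly_IIc4 :: "(real^4) set" where
  "poly_IIc4 = {p. 0 \<le> p$1 \<and> 0 \<le> p$2 \<and> 0 \<le> p$3 \<and> 0 \<le> p$4 \<and> p$1 + p$2 + p$3 + p$4 \<le> 1}"

definition poly_Id4 :: "(real^4) set" where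
  "poly_Id4 = {p. 0 \<le> p$1 \<and> 0 \<le> p$2 \<and> 0 \<le> p$3 \<and> 0 \<le> p$4 \<and>
     p$3 \<le> p$1 + p$2 \<and> p$1 + p$2 + p$4 \<le> 1}"

definition verts_Id4 :: "(real^4) list" where
  "verts_Id4 = [vector [0,0,0,0], vector [0,0,0,1], vector [1,0,0,0], vector [1,0,1,0],
     vector [0,1,0,0], vector [0,1,1,0]]"

definition poly_IIf4 :: "(real^4) set" where
  "poly_IIf4 = {p. 0 \<le> p$1 \<and> 0 \<le> p$2 \<and> 0 \<le> p$3 \<and> 0 \<le> p$4 \<and>
     p$4 \<le> p$1 + p$2 + p$3 \<and> p$1 + p$2 + p$3 \<le> 1}"

definition verts_IIf4 :: "(real^4) list" where
  "verts_IIf4 = [vector [0,0,0,0], vector [1,0,0,0], vector [1,0,0,1], vector [0,1,0,0],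
     vector [0,1,0,1], vector [0,0,1,0], vector [0,0,1,1]]"

definition poly_IIId4 :: "(real^4) set" where
  "poly_IIId4 = {p. 0 \<le> p$1 \<and> 0 \<le> p$2 \<and> 0 \<le> p$3 \<and> 0 \<le> p$4 \<and>
     p$3 \<le> p$1 + p$2 \<and> p$1 + p$2 \<le> 1 \<and> p$1 + p$2 + p$4 \<le> 1 + p$3}"

definition verts_IIId4 :: "(real^4) list" where
  "verts_IIId4 = [vector [0,0,0,0], vector [0,0,0,1], vector [1,0,0,0], vector [1,0,1,0],
     vector [1,0,1,1], vector [0,1,0,0], vector [0,1,1,0], vector [0,1,1,1]]"

definition poly_Ia4 :: "(real^4) set" where
  "poly_Ia4 = {p. 0 \<le> p$1 \<and> 0 \<le> p$2 \<and> 0 \<le> p$3 \<and> 0 \<le> p$4 \<and>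
     p$1 + p$2 \<le> 1 \<and> p$3 \<le> p$1 + p$2 \<and> p$4 \<le> p$1 + p$2}"

definition verts_Ia4 :: "(real^4) list" where
  "verts_Ia4 = [vector [0,0,0,0], vector [1,0,0,0], vector [1,0,1,0], vector [1,0,0,1],
     vector [1,0,1,1], vector [0,1,0,0], vector [0,1,1,0], vector [0,1,0,1], vector [0,1,1,1]]"

definition poly_Vb4 :: "(real^4) set" where
  "poly_Vb4 = {p. 0 \<le> p$1 \<and> 0 \<le> p$2 \<and> 0 \<le> p$3 \<and> 0 \<le> p$4 \<and>
     p$1 \<le> p$3 + p$4 \<and> p$3 + p$4 \<le> 1 \<and> p$3 \<le> p$1 + p$2 \<and> p$1 + p$2 \<le> 1 \<and> p$2 + p$4 \<le> 1}"

definition verts_Vb4 :: "(real^4) list" where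
  "verts_Vb4 = [vector [0,0,0,0], vector [0,0,0,1], vector [1,0,0,1], vector [1,0,1,0],
     vector [0,1,0,0], vector [0,1,1,0]]"

end

theory Submission
  imports Defs
begin

text \<open>A cell that arises from a polytope \<open>P\<close> by pullings is the convex hull of some vertices of \<open>P\<close>. If
\<open>F\<close> is a face of a cell \<open>C\<close> and \<open>v\<close> is a point of \<open>C\<close> outside \<open>F\<close>, then \<open>v\<close> does not lie in the
affine span of \<open>F\<close>, so the faces of the new cell \<open>convex hull (insert v F)\<close> are the faces of \<open>F\<close> and
the pyramids over them with apex \<open>v\<close>. From this it follows that pulling turns polytopal complexes
into polytopal complexes (\<open>polytopal_complex_pull\<close>). When all lattice points of \<open>P\<close> are vertices, a
cell can be identified with the set of indices of its vertices, and pulling becomes the operation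
\<open>cpull\<close> on families of index sets (\<open>pull_cells\<close>). Its starting point, the face lattice of \<open>P\<close>,
consists of the empty set and the intersections of the sets of vertices on the given bounding
hyperplanes (\<open>faces_from_incidences\<close>). So the result of a sequence of pullings depends on the vertex-hyperplane
incidences only, and it can be computed.

If the computed family of index sets is closed under subsets, then its cells are simplices: by
Radon's theorem, affinely dependent vertices would give two faces on disjoint vertex sets that
meet (\<open>independent_if_all_faces\<close>). Maximal cells and minimal non-faces can then be read off from the
index sets (\<open>pulling_yields_if_index_pulling\<close>). For each concrete polytope two things are left: the
convex hull of the listed points is the set given by the inequalities, because barycentric
coordinates show that the claimed maximal cells cover that set, and a finite computation on bit
lists (\<open>pulling_check\<close>).

For an arbitrary compressed polytope \<open>P\<close> of dimension 3, a flag of faces provides three facets whose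
normalised linear functionals are affine coordinates on the span of \<open>P\<close> and take only the values 0
and 1 at the lattice points (\<open>compressed_coordinates\<close>). In these coordinates \<open>P\<close> is the convex hull
of a set of vertices of the unit cube. Every facet functional of \<open>P\<close> takes at most one further value
at the lattice points (\<open>compressed_two_level\<close>), and up to affine bijections this leaves a
tetrahedron, a square pyramid, an octahedron, a triangular prism and a cube
(\<open>two_level_01_classification\<close>). Each of these five has a pulling triangulation whose minimal
non-faces are pairs, and this property is preserved by affine injections that match the lattice
points (\<open>pullable_image\<close>). The same transport along affine injections settles the polytopes that are
lattice equivalent to a listed one. The unimodular simplices are the standard simplices, spanned by
the origin and the standard basis (\<open>unimodular_standard_simplex\<close>).\<close>

section \<open>Pulling a polytopal complex\<close>

definition polytopal_complex :: "(real^'n) set set \<Rightarrow> bool" where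
  "polytopal_complex S \<longleftrightarrow> (\<forall>C\<in>S. polytope C) \<and> (\<forall>C\<in>S. \<forall>F. F face_of C \<longrightarrow> F \<in> S) \<and>
     (\<forall>C\<in>S. \<forall>D\<in>S. (C \<inter> D) face_of C)"

lemma polytopal_complexD:
  assumes "polytopal_complex S" "C \<in> S"
  shows "polytope C" "convex C" "F face_of C \<Longrightarrow> F \<in> S"
    "D \<in> S \<Longrightarrow> (C \<inter> D) face_of C" "D \<in> S \<Longrightarrow> (C \<inter> D) face_of D"
proof -
  show "polytope C" "convex C" "F face_of C \<Longrightarrow> F \<in> S" "D \<in> S \<Longrightarrow> (C \<inter> D) face_of C"
    using assms unfolding polytopal_complex_def by (auto simp: polytope_imp_convex)
  show "D \<in> S \<Longrightarrow> (C \<inter> D) face_of D"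
    using assms unfolding polytopal_complex_def by (subst Int_commute) blast
qed

lemma polytopal_complex_trivial_subdivision:
  assumes "polytope P"
  shows "polytopal_complex (trivial_subdivision P)"
  unfolding polytopal_complex_def trivial_subdivision_def
  by (auto intro: face_of_polytope_polytope[OF assms] face_of_trans
      face_of_subset[OF face_of_Int] dest: face_of_imp_subset)

lemma apex_notin_affine_hull:
  fixes C :: "'a::euclidean_space set"
  assumes "F face_of C" "convex C" "v \<in> C" "v \<notin> F"
  shows "v \<notin> affine hull F"
  using face_of_imp_eq_affine_Int[OF assms(2,1)] assms(3,4) by blast

text \<open>The finite set in \<open>face_of_convex_hull_insert_eq\<close> is replaced by the polytope that it spans.\<close>

lemma face_of_pyramid:
  fixes F :: "'a::euclidean_space set"
  assumes "polytope F" "v \<notin> affine hull F"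
  shows "G face_of convex hull (insert v F) \<longleftrightarrow>
    G face_of F \<or> (\<exists>H. H face_of F \<and> G = convex hull (insert v H))"
proof -
  obtain S where S: "finite S" "F = convex hull S"
    using assms(1) by (auto simp: polytope_def)
  then have "v \<notin> affine hull S"
    using assms(2) by (simp add: affine_hull_convex_hull)
  moreover have "convex hull (insert v F) = convex hull (insert v S)"
    unfolding S(2) by (metis hull_insert)
  ultimately show ?thesis
    using face_of_convex_hull_insert_eq[OF S(1), of v G] S(2) by simp
qed

lemma pyramid_cases:
  assumes "x \<in> convex hull (insert v F)" "convex F"
  obtains "x = v" | f where "f \<in> F" "x \<in> closed_segment v f"
proof (cases "F = {}")
  case False
  then have "x \<in> (\<Union>f\<in>F. closed_segment v f)"
    using assms convex_hull_insert_segments[of v F] by (simp add: hull_same)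
  then show ?thesis using that by blast
qed (use assms that in auto)

lemma pyramid_subset:
  assumes "F face_of C" "convex C" "v \<in> C"
  shows "convex hull (insert v F) \<subseteq> C"
  using assms face_of_imp_subset by (intro hull_minimal) auto

text \<open>A point of the pyramid outside its base lies in the relative interior of a segment from the apex
\<open>v\<close> to the base. If the point belonged to the face \<open>G\<close>, so would \<open>v\<close>.\<close>

lemma face_Int_pyramid:
  assumes G: "G face_of D" and v: "v \<in> D" "v \<notin> G" and F: "F \<subseteq> D" "convex F"
  shows "G \<inter> convex hull (insert v F) = G \<inter> F"
proof
  show "G \<inter> convex hull (insert v F) \<subseteq> G \<inter> F"
  proof
    fix x assume x: "x \<in> G \<inter> convex hull (insert v F)"
    then have "x \<noteq> v" using v by auto
    then obtain f where f: "f \<in> F" "x \<in> closed_segment v f"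
      using x F pyramid_cases[of x v F] by blast
    have "x = f"
    proof (rule ccontr)
      assume "x \<noteq> f"
      then have "x \<in> open_segment v f" using f \<open>x \<noteq> v\<close> by (simp add: open_segment_def)
      then show False using face_ofD[OF G] x v f F by blast
    qed
    then show "x \<in> G \<inter> F" using x f by simp
  qed
qed (auto intro: hull_inc)

lemma same_ray:
  fixes v :: "'a::real_vector"
  assumes "x \<in> closed_segment v f" "x \<in> closed_segment v f'" "x \<noteq> v"
  shows "f' \<in> closed_segment v f \<or> f \<in> closed_segment v f'"
proof -
  obtain s t where s: "0 \<le> s" "s \<le> 1" "x = (1 - s) *\<^sub>R v + s *\<^sub>R f"
    and t: "0 \<le> t" "t \<le> 1" "x = (1 - t) *\<^sub>R v + t *\<^sub>R f'"
    using assms(1,2) unfolding in_segment by blast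
  have "x - v = s *\<^sub>R (f - v)" by (simp add: s(3) algebra_simps)
  moreover have "x - v = t *\<^sub>R (f' - v)" by (simp add: t(3) algebra_simps)
  ultimately have st: "s *\<^sub>R (f - v) = t *\<^sub>R (f' - v)" by simp
  then have pos: "0 < s" "0 < t" using assms(3) s t by (auto simp: order_less_le)
  have *: "b \<in> closed_segment v a"
    if "0 < p" "p \<le> q" "p *\<^sub>R (a - v) = q *\<^sub>R (b - v)" for a b :: 'a and p q :: real
  proof -
    have "b - v = (1 / q) *\<^sub>R (q *\<^sub>R (b - v))" using that by simp
    also have "\<dots> = (p / q) *\<^sub>R (a - v)" by (simp flip: that(3))
    finally have "b - v = (p / q) *\<^sub>R (a - v)" .
    then have "b = (1 - p / q) *\<^sub>R v + (p / q) *\<^sub>R a"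
      by (simp add: algebra_simps)
    then show ?thesis using that unfolding in_segment by (intro exI[of _ "p / q"]) auto
  qed
  show ?thesis
    using *[of s t f f'] *[of t s f' f] st pos by (cases "s \<le> t") auto
qed

text \<open>A common point of the two pyramids lies on a segment from \<open>v\<close> to a point of \<open>F\<close> and on a segment
from \<open>v\<close> to a point of \<open>F'\<close>. The two base points lie on the same ray and belong to both cells, since
the intersection of the cells is a face of each. Were they different, the nearer one would be an
interior point of a segment from \<open>v\<close> to the other, and its face would contain \<open>v\<close>.\<close>

lemma pyramid_Int_pyramid:
  assumes E: "(C \<inter> D) face_of C" "(C \<inter> D) face_of D" and v: "v \<in> C" "v \<in> D"
    and F: "F face_of C" "v \<notin> F" and F': "F' face_of D" "v \<notin> F'"
    and conv: "convex C" "convex D"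
  shows "convex hull (insert v F) \<inter> convex hull (insert v F') = convex hull (insert v (F \<inter> F'))"
proof
  show "convex hull (insert v F) \<inter> convex hull (insert v F') \<subseteq> convex hull (insert v (F \<inter> F'))"
  proof
    fix x assume x: "x \<in> convex hull (insert v F) \<inter> convex hull (insert v F')"
    show "x \<in> convex hull (insert v (F \<inter> F'))"
    proof (cases "x = v")
      case False
      obtain f where f: "f \<in> F" "x \<in> closed_segment v f"
        using x False pyramid_cases[of x v F] face_of_imp_convex[OF F(1)] by blast
      obtain f' where f': "f' \<in> F'" "x \<in> closed_segment v f'"
        using x False pyramid_cases[of x v F'] face_of_imp_convex[OF F'(1)] by blast
      have xCD: "x \<in> C \<inter> D"
        using x pyramid_subset[OF F(1) conv(1) v(1)] pyramid_subset[OF F'(1) conv(2) v(2)] by blast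
      have "f \<in> C \<inter> D"
        using face_ofD[OF E(1), of x v f] xCD f v face_of_imp_subset[OF F(1)] False
        by (cases "x = f") (auto simp: open_segment_def)
      have "f' \<in> C \<inter> D"
        using face_ofD[OF E(2), of x v f'] xCD f' v face_of_imp_subset[OF F'(1)] False
        by (cases "x = f'") (auto simp: open_segment_def)
      have "f = f'"
      proof (rule ccontr)
        assume "f \<noteq> f'"
        moreover have "f \<noteq> v" "f' \<noteq> v" using f f' F F' by auto
        ultimately have "f' \<in> open_segment v f \<or> f \<in> open_segment v f'"
          using same_ray[OF f(2) f'(2) False] by (auto simp: open_segment_def)
        then show False
          using face_ofD[OF F(1), of f v f'] face_ofD[OF F'(1), of f' v f] f(1) f'(1) v F(2) F'(2)
            \<open>f \<in> C \<inter> D\<close> \<open>f' \<in> C \<inter> D\<close> by auto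
      qed
      then have "closed_segment v f \<subseteq> convex hull (insert v (F \<inter> F'))"
        using f(1) f'(1) by (intro closed_segment_subset) (auto intro: hull_inc)
      then show ?thesis using f(2) by blast
    qed (simp add: hull_inc)
  qed
  show "convex hull (insert v (F \<inter> F')) \<subseteq> convex hull (insert v F) \<inter> convex hull (insert v F')"
    by (intro Int_greatest hull_mono) auto
qed

lemma pull_cases:
  assumes "C \<in> pull v S"
  obtains "C \<in> S" "v \<notin> C" | F C0 where "C0 \<in> S" "v \<in> C0" "F face_of C0" "v \<notin> F"
    "C = convex hull (insert v F)"
  using assms unfolding pull_def by blast

text \<open>Two cells of the pulled family meet in a common face: for two old cells this is the hypothesis,
for an old cell and a pyramid it is \<open>face_Int_pyramid\<close>, and two pyramids meet in the pyramid over the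
intersection of their bases.\<close>

lemma polytopal_complex_pull:
  assumes S: "polytopal_complex S"
  shows "polytopal_complex (pull v S)"
proof -
  note SD = polytopal_complexD[OF S]
  have pyr: "H face_of convex hull (insert v F) \<longleftrightarrow> H face_of F \<or> (\<exists>G. G face_of F \<and> H = convex hull (insert v G))"
    if "C \<in> S" "v \<in> C" "F face_of C" "v \<notin> F" for C F H
    using that SD(1,2)[of C] by (intro face_of_pyramid apex_notin_affine_hull) (auto intro: face_of_polytope_polytope)
  have mixed: "(C \<inter> D) face_of C \<and> (C \<inter> D) face_of D"
    if C: "C \<in> S" "v \<notin> C" and D: "D0 \<in> S" "v \<in> D0" "F face_of D0" "v \<notin> F" "D = convex hull (insert v F)"
    for C D D0 F
  proof -
    have "C \<inter> D = (C \<inter> D0) \<inter> convex hull (insert v F)"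
      using pyramid_subset[OF D(3) SD(2)[OF D(1)] D(2)] D(5) by blast
    also have "\<dots> = (C \<inter> D0) \<inter> F"
      using C D face_of_imp_subset[OF D(3)] face_of_imp_convex[OF D(3)]
      by (intro face_Int_pyramid[OF SD(5)[OF C(1) D(1)]]) auto
    finally have eq: "C \<inter> D = (C \<inter> D0) \<inter> F" .
    have f0: "((C \<inter> D0) \<inter> F) face_of D0"
      by (rule face_of_Int[OF SD(5)[OF C(1) D(1)] D(3)])
    have 1: "((C \<inter> D0) \<inter> F) face_of (C \<inter> D0)" and 2: "((C \<inter> D0) \<inter> F) face_of F"
      by (rule face_of_subset[OF f0]; use face_of_imp_subset[OF D(3)] in blast)+
    have "((C \<inter> D0) \<inter> F) face_of C"
      by (rule face_of_trans[OF 1 SD(4)[OF C(1) D(1)]])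
    moreover have "((C \<inter> D0) \<inter> F) face_of convex hull (insert v F)"
      unfolding pyr[OF D(1-4)] using 2 by (rule disjI1)
    ultimately show ?thesis unfolding eq[symmetric] D(5) by (rule conjI)
  qed
  have "polytope C" if "C \<in> pull v S" for C
    using that
  proof (cases rule: pull_cases)
    case (2 F C0)
    then obtain X where X: "finite X" "F = convex hull X"
      using face_of_polytope_polytope[OF SD(1)[OF 2(1)] 2(3)] by (auto simp: polytope_def)
    then have "C = convex hull (insert v X)" "finite (insert v X)"
      using X 2(5) hull_insert[of convex v X] by auto
    then show ?thesis unfolding polytope_def by blast
  qed (use SD in auto)
  moreover have face_in: "H \<in> pull v S" if C: "C \<in> pull v S" and H: "H face_of C" for C H
    using C
  proof (cases rule: pull_cases)
    case 1
    then show ?thesis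
      using H SD(3) face_of_imp_subset[OF H] unfolding pull_def by auto
  next
    case (2 F C0)
    then consider "H face_of F" | G where "G face_of F" "H = convex hull (insert v G)"
      using H pyr[OF 2(1-4)] by blast
    then show ?thesis
    proof cases
      case 1
      then have "H \<in> S" "v \<notin> H"
        using SD(3)[OF 2(1) face_of_trans[OF 1 2(3)]] face_of_imp_subset[OF 1] 2(4) by blast+
      then show ?thesis unfolding pull_def by blast
    next
      case (2 G)
      then show ?thesis
        using \<open>C0 \<in> S\<close> \<open>v \<in> C0\<close> \<open>v \<notin> F\<close> face_of_trans[OF 2(1) \<open>F face_of C0\<close>] face_of_imp_subset[OF 2(1)]
        unfolding pull_def by blast
    qed
  qed
  moreover have "(C \<inter> D) face_of C" if C: "C \<in> pull v S" and D: "D \<in> pull v S" for C D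
    using C
  proof (cases rule: pull_cases)
    case C1: 1
    show ?thesis using D
    proof (cases rule: pull_cases)
      case 1
      then show ?thesis using C1 SD(4) by blast
    next
      case 2
      then show ?thesis using mixed[OF C1] by blast
    qed
  next
    case C2: (2 F C0)
    show ?thesis using D
    proof (cases rule: pull_cases)
      case 1
      then show ?thesis using mixed[OF 1 C2] by (simp add: Int_commute)
    next
      case D2: (2 F' D0)
      have faces: "(C0 \<inter> D0) face_of C0" "(C0 \<inter> D0) face_of D0"
        using SD(4,5)[OF C2(1) D2(1)] by auto
      have conv: "convex C0" "convex D0" using SD(2) C2 D2 by auto
      have eq: "C \<inter> D = convex hull (insert v (F \<inter> F'))"
        unfolding C2(5) D2(5)
        by (rule pyramid_Int_pyramid[OF faces C2(2) D2(2) C2(3,4) D2(3,4) conv])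
      have F: "(F \<inter> D0) face_of (C0 \<inter> D0)" "(C0 \<inter> F') face_of (C0 \<inter> D0)"
        using face_of_slice[OF C2(3) conv(2)] face_of_slice[OF D2(3) conv(1)]
        by (simp_all add: Int_commute)
      have "(F \<inter> D0) \<inter> (C0 \<inter> F') = F \<inter> F'"
        using face_of_imp_subset[OF C2(3)] face_of_imp_subset[OF D2(3)] by blast
      then have "(F \<inter> F') face_of (C0 \<inter> D0)"
        using face_of_Int[OF F] by simp
      then have "(F \<inter> F') face_of C0" using faces(1) by (rule face_of_trans)
      then have "(F \<inter> F') face_of F"
        by (rule face_of_subset) (use face_of_imp_subset[OF C2(3)] in auto)
      then show ?thesis
        unfolding eq unfolding C2(5) pyr[OF C2(1-4)] by (intro disjI2 exI conjI) auto
    qed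
  qed
  ultimately show ?thesis
    unfolding polytopal_complex_def by (intro conjI ballI allI impI)
qed

section \<open>Pulling index sets\<close>

abbreviation cell :: "(real^'n) list \<Rightarrow> nat set \<Rightarrow> (real^'n) set" where
  "cell v I \<equiv> convex hull ((!) v ` I)"

text \<open>Besides being extreme, the listed points must be pairwise distinct, so that indices may stand for
points.\<close>

definition convex_position :: "(real^'n) list \<Rightarrow> bool" where
  "convex_position v \<longleftrightarrow> distinct v \<and> (\<forall>x\<in>set v. x extreme_point_of (convex hull set v))"

lemma image_nth_lessThan: "(!) v ` {..<length v} = set v"
  by (auto simp: set_conv_nth)

lemma nth_image_subset: "I \<subseteq> {..<length v} \<Longrightarrow> (!) v ` I \<subseteq> set v"
  by auto

lemma vertex_in_cell_iff:
  assumes v: "convex_position v" and i: "i < length v" and I: "I \<subseteq> {..<length v}"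
  shows "v ! i \<in> cell v I \<longleftrightarrow> i \<in> I"
proof
  assume *: "v ! i \<in> cell v I"
  have "v ! i extreme_point_of (convex hull set v)"
    using v i by (simp add: convex_position_def)
  moreover have "cell v I \<subseteq> convex hull set v"
    by (rule hull_mono) (use I in auto)
  ultimately have "v ! i extreme_point_of cell v I"
    using * unfolding extreme_point_of_def by blast
  then have "v ! i \<in> (!) v ` I" by (rule extreme_point_of_convex_hull)
  then obtain j where j: "j \<in> I" "v ! i = v ! j" by blast
  moreover have "i = j"
    using v i I j nth_eq_iff_index_eq[of v i j] by (auto simp: convex_position_def)
  ultimately show "i \<in> I" by simp
qed (auto intro: hull_inc)

lemma cell_subset_iff:
  assumes "convex_position v" "I \<subseteq> {..<length v}" "J \<subseteq> {..<length v}"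
  shows "cell v I \<subseteq> cell v J \<longleftrightarrow> I \<subseteq> J"
proof
  assume *: "cell v I \<subseteq> cell v J"
  show "I \<subseteq> J"
  proof
    fix i assume "i \<in> I"
    then have "v ! i \<in> cell v J" using * by (auto intro: hull_inc)
    then show "i \<in> J" using vertex_in_cell_iff[OF assms(1) _ assms(3)] \<open>i \<in> I\<close> assms(2) by auto
  qed
qed (intro hull_mono image_mono)

text \<open>In a polytopal complex the faces of a cell are the cells contained in it. The base \<open>J\<close> of a new
pyramid with apex \<open>w\<close> is therefore a member without \<open>w\<close> that is contained in a member \<open>I\<close> with \<open>w\<close>.\<close>

definition cpull :: "nat \<Rightarrow> nat set set \<Rightarrow> nat set set" where
  "cpull w D = Set.filter (\<lambda>I. w \<notin> I) D \<union>
     insert w ` Set.filter (\<lambda>J. w \<notin> J \<and> (\<exists>I\<in>D. insert w J \<subseteq> I)) D"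

lemma cpull_subset_Pow: "D \<subseteq> Pow U \<Longrightarrow> w \<in> U \<Longrightarrow> cpull w D \<subseteq> Pow U"
  unfolding cpull_def by auto

lemma face_of_cell_iff:
  assumes v: "convex_position v" and D: "D \<subseteq> Pow {..<length v}"
    and cx: "polytopal_complex (cell v ` D)" and I: "I \<in> D"
  shows "F face_of cell v I \<longleftrightarrow> (\<exists>J\<in>D. J \<subseteq> I \<and> F = cell v J)"
proof
  assume F: "F face_of cell v I"
  then obtain J where J: "J \<in> D" "F = cell v J"
    using polytopal_complexD(3)[OF cx imageI[OF I]] by blast
  then have "J \<subseteq> I"
    using face_of_imp_subset[OF F] cell_subset_iff[OF v] D I by blast
  with J show "\<exists>J\<in>D. J \<subseteq> I \<and> F = cell v J" by blast
next
  assume "\<exists>J\<in>D. J \<subseteq> I \<and> F = cell v J"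
  then obtain J where J: "J \<in> D" "J \<subseteq> I" "F = cell v J" by blast
  have "cell v J \<subseteq> cell v I" by (intro hull_mono image_mono J(2))
  then have "cell v I \<inter> cell v J = F" using J(3) by blast
  then show "F face_of cell v I"
    using polytopal_complexD(4)[OF cx imageI[OF I] imageI[OF J(1)]] by simp
qed

lemma pull_cells:
  assumes v: "convex_position v" and D: "D \<subseteq> Pow {..<length v}"
    and cx: "polytopal_complex (cell v ` D)" and w: "w < length v"
  shows "pull (v ! w) (cell v ` D) = cell v ` cpull w D"
proof -
  have mem: "v ! w \<in> cell v I \<longleftrightarrow> w \<in> I" if "I \<in> D" for I
    using vertex_in_cell_iff[OF v w] D that by blast
  have pyr: "convex hull (insert (v ! w) (cell v J)) = cell v (insert w J)" for J
    using hull_insert[of convex "v ! w" "(!) v ` J"] by simp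
  have "{C \<in> cell v ` D. v ! w \<notin> C} = cell v ` Set.filter (\<lambda>I. w \<notin> I) D"
    using mem by auto
  moreover have "{convex hull (insert (v ! w) F) | F C. C \<in> cell v ` D \<and> v ! w \<in> C \<and> F face_of C \<and> v ! w \<notin> F}
     = cell v ` insert w ` Set.filter (\<lambda>J. w \<notin> J \<and> (\<exists>I\<in>D. insert w J \<subseteq> I)) D" (is "?L = ?R")
  proof (intro equalityI subsetI)
    fix X assume "X \<in> ?L"
    then obtain F I where I: "I \<in> D" "v ! w \<in> cell v I" "F face_of cell v I" "v ! w \<notin> F"
      and X: "X = convex hull (insert (v ! w) F)" by auto
    then obtain J where J: "J \<in> D" "J \<subseteq> I" "F = cell v J"
      using face_of_cell_iff[OF v D cx] by blast
    have "X = cell v (insert w J)" unfolding X J(3) by (rule pyr)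
    moreover have "w \<notin> J" "insert w J \<subseteq> I" using I J mem by auto
    then have "insert w J \<in> insert w ` Set.filter (\<lambda>J. w \<notin> J \<and> (\<exists>I\<in>D. insert w J \<subseteq> I)) D"
      using I(1) J(1) by auto
    ultimately show "X \<in> ?R" by blast
  next
    fix X assume "X \<in> ?R"
    then obtain J I where J: "J \<in> D" "w \<notin> J" "I \<in> D" "insert w J \<subseteq> I" "X = cell v (insert w J)"
      by auto
    moreover have "cell v J face_of cell v I"
      using face_of_cell_iff[OF v D cx J(3)] J by blast
    moreover have "v ! w \<in> cell v I" "v ! w \<notin> cell v J" using J mem by auto
    ultimately show "X \<in> ?L"
      using pyr[of J] by (intro CollectI exI[of _ "cell v J"] exI[of _ "cell v I"] conjI imageI) simp_all
  qed
  ultimately show ?thesis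
    unfolding pull_def cpull_def by (simp only: image_Un)
qed

lemma fold_pull_cells:
  assumes v: "convex_position v" and "set js \<subseteq> {..<length v}"
    and "D \<subseteq> Pow {..<length v}" and "polytopal_complex (cell v ` D)"
  shows "fold pull (map ((!) v) js) (cell v ` D) = cell v ` fold cpull js D \<and>
    polytopal_complex (cell v ` fold cpull js D) \<and> fold cpull js D \<subseteq> Pow {..<length v}"
  using assms(2-4)
proof (induction js arbitrary: D)
  case (Cons w js)
  then have w: "w < length v" by simp
  have eq: "pull (v ! w) (cell v ` D) = cell v ` cpull w D"
    by (rule pull_cells[OF v Cons.prems(2,3) w])
  have "polytopal_complex (cell v ` cpull w D)"
    unfolding eq[symmetric] by (rule polytopal_complex_pull[OF Cons.prems(3)])
  moreover have "cpull w D \<subseteq> Pow {..<length v}"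
    using cpull_subset_Pow[OF Cons.prems(2)] w by simp
  ultimately show ?case
    using Cons.IH[of "cpull w D"] Cons.prems(1) eq by simp
qed simp

text \<open>Radon's theorem splits affinely dependent points into two parts whose hulls meet. Both hulls are
cells, so their intersection is a cell; its vertices would belong to both parts.\<close>

lemma independent_if_all_faces:
  assumes v: "convex_position v" and D: "D \<subseteq> Pow {..<length v}"
    and cx: "polytopal_complex (cell v ` D)" and I: "Pow I \<subseteq> D"
  shows "\<not> affine_dependent ((!) v ` I)"
proof
  assume "affine_dependent ((!) v ` I)"
  then obtain M N where MN: "M \<subseteq> (!) v ` I" "N \<subseteq> (!) v ` I" "M \<inter> N = {}"
    and ne: "convex hull M \<inter> convex hull N \<noteq> {}" by (rule Radon)
  obtain J where J: "J \<subseteq> I" "M = (!) v ` J" using MN(1) by (auto simp: subset_image_iff)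
  obtain K where K: "K \<subseteq> I" "N = (!) v ` K" using MN(2) by (auto simp: subset_image_iff)
  have JD: "J \<in> D" and KD: "K \<in> D" using I J K by auto
  obtain L where L: "L \<in> D" "L \<subseteq> J" "cell v J \<inter> cell v K = cell v L"
    using polytopal_complexD(4)[OF cx imageI[OF JD] imageI[OF KD]] face_of_cell_iff[OF v D cx JD] by blast
  have "cell v L \<subseteq> cell v K" using L(3) by blast
  then have "L \<subseteq> K" using cell_subset_iff[OF v] L(1) KD D by blast
  then have "L = {}" using L(2) MN(3) J K by blast
  then show False using ne L J K by simp
qed

lemma simplicial_complex_cells:
  assumes v: "convex_position v" and D: "D \<subseteq> Pow {..<length v}"
    and cx: "polytopal_complex (cell v ` D)" and down: "\<And>I. I \<in> D \<Longrightarrow> Pow I \<subseteq> D"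
  shows "simplicial_complex (cell v ` D)"
proof -
  have "finite D" using D by (rule finite_subset) simp
  moreover have "\<exists>n. n simplex C" if C: "C \<in> cell v ` D" for C
  proof -
    obtain I where I: "I \<in> D" "C = cell v I" using C by blast
    have "\<not> affine_dependent ((!) v ` I)"
      using independent_if_all_faces[OF v D cx down[OF I(1)]] .
    then show ?thesis
      unfolding I(2) simplex_def
      by (intro exI[of _ "int (card ((!) v ` I)) - 1"] exI[of _ "(!) v ` I"]) simp
  qed
  ultimately show ?thesis
    unfolding simplicial_complex_def
    by (intro conjI ballI allI impI finite_imageI)
      (auto intro: polytopal_complexD(3)[OF cx] polytopal_complexD(4)[OF cx])
qed

section \<open>Face lattices from incidences\<close>

text \<open>The members are the empty set and all intersections of \<open>U\<close> with some, possibly none, of the listed sets (see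
\<open>facial_iff\<close>). The recursion makes this family computable.\<close>

primrec facial :: "nat set list \<Rightarrow> nat set \<Rightarrow> nat set set" where
  "facial [] U = {U, {}}"
| "facial (Z # Zs) U = facial Zs U \<union> (\<inter>) Z ` facial Zs U"

lemma facial_iff: "I \<in> facial Zs U \<longleftrightarrow> I = {} \<or> (\<exists>A\<subseteq>set Zs. I = U \<inter> \<Inter>A)"
proof (induction Zs arbitrary: I)
  case (Cons Z Zs)
  have "I \<in> facial (Z # Zs) U \<longleftrightarrow> I \<in> facial Zs U \<or> (\<exists>J\<in>facial Zs U. I = Z \<inter> J)"
    by auto
  also have "\<dots> \<longleftrightarrow> I = {} \<or> (\<exists>A\<subseteq>set Zs. I = U \<inter> \<Inter>A) \<or> (\<exists>A\<subseteq>set Zs. I = Z \<inter> (U \<inter> \<Inter>A))"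
    unfolding Cons.IH Bex_def by (metis Int_empty_right)
  also have "(\<exists>A\<subseteq>set Zs. I = Z \<inter> (U \<inter> \<Inter>A)) \<longleftrightarrow> (\<exists>A\<subseteq>set Zs. I = U \<inter> \<Inter>(insert Z A))"
    by (simp add: Int_left_commute)
  also have "I = {} \<or> (\<exists>A\<subseteq>set Zs. I = U \<inter> \<Inter>A) \<or> (\<exists>A\<subseteq>set Zs. I = U \<inter> \<Inter>(insert Z A))
     \<longleftrightarrow> I = {} \<or> (\<exists>A\<in>Pow (set (Z # Zs)). I = U \<inter> \<Inter>A)"
    unfolding list.set Pow_insert bex_Un by auto
  finally show ?case by auto
qed (auto simp: subset_singleton_iff)

lemma facial_subset_Pow: "facial Zs U \<subseteq> Pow U"
  by (auto simp: facial_iff)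

text \<open>A face cut out by supporting hyperplanes is spanned by the listed points that it contains, because
every face of the convex hull of a finite set is the hull of a subset.\<close>

lemma tight_face:
  fixes v :: "(real^'n) list" and hs :: "((real^'n) \<times> real) set"
  assumes P: "P = convex hull set v" and le: "\<And>a b x. (a, b) \<in> hs \<Longrightarrow> x \<in> P \<Longrightarrow> a \<bullet> x \<le> b"
  defines "K \<equiv> {x \<in> P. \<forall>(a, b)\<in>hs. a \<bullet> x = b}"
  shows "K face_of P" "K = cell v {i. i < length v \<and> (\<forall>(a, b)\<in>hs. a \<bullet> v ! i = b)}"
proof -
  have "convex P" unfolding P by (rule convex_convex_hull)
  have half: "P \<inter> {x. a \<bullet> x = b} face_of P" if "(a, b) \<in> hs" for a b
    by (rule face_of_Int_supporting_hyperplane_le[OF \<open>convex P\<close> le[OF that]])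
  show face: "K face_of P"
  proof (cases "hs = {}")
    case False
    then have "K = (\<Inter>(a, b)\<in>hs. P \<inter> {x. a \<bullet> x = b})" unfolding K_def by auto
    also have "\<dots> face_of P" using False half by (intro face_of_Inter) auto
    finally show ?thesis .
  qed (simp add: K_def face_of_refl \<open>convex P\<close>)
  have "compact (set v)" by (simp add: finite_imp_compact)
  then obtain S where S: "S \<subseteq> set v" "K = convex hull S"
    using face_of_convex_hull_subset face unfolding P by blast
  then have "S \<subseteq> K" by (simp add: hull_subset)
  show "K = cell v {i. i < length v \<and> (\<forall>(a, b)\<in>hs. a \<bullet> v ! i = b)}" (is "_ = cell v ?I")
  proof
    have "S \<subseteq> (!) v ` ?I"
    proof
      fix s assume "s \<in> S"
      then obtain i where "i < length v" "s = v ! i" using S(1) by (metis in_set_conv_nth subsetD)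
      then show "s \<in> (!) v ` ?I" using \<open>s \<in> S\<close> \<open>S \<subseteq> K\<close> by (auto simp: K_def)
    qed
    then show "K \<subseteq> cell v ?I" unfolding S(2) by (rule hull_mono)
    have "(!) v ` ?I \<subseteq> K" unfolding K_def P by (auto intro: hull_inc)
    then show "cell v ?I \<subseteq> K"
      using face_of_imp_convex[OF face] by (rule hull_minimal)
  qed
qed

text \<open>Take \<open>A\<close> to be the inequalities that are equalities at a relative interior point \<open>x\<close> of the face.
Every point \<open>y\<close> of the face satisfies them with equality, since the segment from \<open>y\<close> can be prolonged
beyond \<open>x\<close> inside the face. Conversely, if \<open>y\<close> is a point of \<open>P\<close> with these equalities, then the
segment from \<open>y\<close> to \<open>x\<close> can be prolonged beyond \<open>x\<close> inside \<open>P\<close>, as all other inequalities are strict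
at \<open>x\<close>; hence \<open>y\<close> lies in the face through \<open>x\<close>.\<close>

lemma face_eq_tight_face:
  fixes hs :: "((real^'n) \<times> real) list"
  assumes P: "P = {x. \<forall>(a, b)\<in>set hs. a \<bullet> x \<le> b}" and F: "F face_of P" "F \<noteq> {}"
  obtains A where "A \<subseteq> set hs" "F = {x \<in> P. \<forall>(a, b)\<in>A. a \<bullet> x = b}"
proof -
  have convF: "convex F" using F(1) by (rule face_of_imp_convex)
  then obtain x where x: "x \<in> rel_interior F" using F(2) rel_interior_eq_empty by blast
  then have xF: "x \<in> F" using rel_interior_subset by blast
  have FP: "F \<subseteq> P" using F(1) by (rule face_of_imp_subset)
  define A where "A = {h \<in> set hs. fst h \<bullet> x = snd h}"
  have "F = {y \<in> P. \<forall>(a, b)\<in>A. a \<bullet> y = b}"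
  proof (intro equalityI subsetI CollectI conjI)
    fix y assume y: "y \<in> F"
    then obtain e where e: "e > 1" "(1 - e) *\<^sub>R y + e *\<^sub>R x \<in> F"
      using convex_rel_interior_iff[OF convF F(2)] x by blast
    show "y \<in> P" using y FP by blast
    show "\<forall>(a, b)\<in>A. a \<bullet> y = b"
    proof clarify
      fix a b assume "(a, b) \<in> A"
      then have ab: "(a, b) \<in> set hs" "a \<bullet> x = b" by (auto simp: A_def)
      have "a \<bullet> y \<le> b" "a \<bullet> ((1 - e) *\<^sub>R y + e *\<^sub>R x) \<le> b"
        using ab(1) e(2) y FP unfolding P by blast+
      then have "(e - 1) * b \<le> (e - 1) * (a \<bullet> y)"
        by (simp add: inner_add_right ab(2) algebra_simps)
      then show "a \<bullet> y = b" using e(1) \<open>a \<bullet> y \<le> b\<close> by simp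
    qed
  next
    fix y assume "y \<in> {y \<in> P. \<forall>(a, b)\<in>A. a \<bullet> y = b}"
    then have y: "y \<in> P" "\<And>a b. (a, b) \<in> A \<Longrightarrow> a \<bullet> y = b" by auto
    show "y \<in> F"
    proof (cases "y = x")
      case False
      have "\<forall>\<^sub>F e in at_right 0. \<forall>h\<in>set hs. fst h \<bullet> (x + e *\<^sub>R (x - y)) \<le> snd h"
      proof (rule eventually_ball_finite, simp, rule ballI)
        fix h assume h: "h \<in> set hs"
        have "x \<in> P" using xF FP by blast
        then have "fst h \<bullet> x \<le> snd h" using h unfolding P by auto
        show "\<forall>\<^sub>F e in at_right 0. fst h \<bullet> (x + e *\<^sub>R (x - y)) \<le> snd h"
        proof (cases "fst h \<bullet> x = snd h")
          case True
          then have "fst h \<bullet> y = snd h" using y(2)[of "fst h" "snd h"] h by (auto simp: A_def)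
          then show ?thesis using True by (simp add: inner_add_right inner_diff_right)
        next
          case False
          have "((\<lambda>e. fst h \<bullet> (x + e *\<^sub>R (x - y))) \<longlongrightarrow> fst h \<bullet> (x + 0 *\<^sub>R (x - y))) (at_right 0)"
            by (intro tendsto_intros)
          then have "\<forall>\<^sub>F e in at_right 0. fst h \<bullet> (x + e *\<^sub>R (x - y)) < snd h"
            by (rule order_tendstoD) (use False \<open>fst h \<bullet> x \<le> snd h\<close> in simp)
          then show ?thesis by (rule eventually_mono) simp
        qed
      qed
      moreover have "\<forall>\<^sub>F e::real in at_right 0. e > 0"
        by (simp add: eventually_at_right_less)
      ultimately have "\<forall>\<^sub>F e in at_right 0. e > 0 \<and> (\<forall>h\<in>set hs. fst h \<bullet> (x + e *\<^sub>R (x - y)) \<le> snd h)"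
        by (simp add: eventually_conj)
      then obtain e where e: "e > 0" "\<And>h. h \<in> set hs \<Longrightarrow> fst h \<bullet> (x + e *\<^sub>R (x - y)) \<le> snd h"
        using eventually_happens'[OF trivial_limit_at_right_real] by blast
      \<comment> \<open>the segment from \<open>y\<close> to \<open>x\<close>, prolonged beyond \<open>x\<close>\<close>
      define z where "z = x + e *\<^sub>R (x - y)"
      have z: "z \<in> P" unfolding P z_def using e(2) by auto
      have "x = (1 - 1 / (1 + e)) *\<^sub>R y + (1 / (1 + e)) *\<^sub>R z"
      proof -
        have "(1 + e) *\<^sub>R ((1 - 1 / (1 + e)) *\<^sub>R y + (1 / (1 + e)) *\<^sub>R z)
            = ((1 + e) - 1) *\<^sub>R y + z"
          using e(1) by (simp add: scaleR_add_right right_diff_distrib)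
        also have "\<dots> = (1 + e) *\<^sub>R x" unfolding z_def by (simp add: algebra_simps)
        finally show ?thesis using e(1) by simp
      qed
      moreover have "y \<noteq> z"
      proof
        assume "y = z"
        then have "(1 + e) *\<^sub>R (x - y) = 0" unfolding z_def by (simp add: algebra_simps)
        then show False using False e(1) by simp
      qed
      ultimately have "x \<in> open_segment y z"
        unfolding in_segment using e(1) by (auto intro!: exI[of _ "1 / (1 + e)"])
      then show ?thesis using face_ofD[OF F(1) _ y(1) z xF] by blast
    qed (use xF in simp)
  qed
  moreover have "A \<subseteq> set hs" by (auto simp: A_def)
  ultimately show ?thesis using that by blast
qed

lemma faces_from_incidences:
  fixes v :: "(real^'n) list" and hs :: "((real^'n) \<times> real) list"
  assumes H: "P = {x. \<forall>(a, b)\<in>set hs. a \<bullet> x \<le> b}" and V: "P = convex hull set v"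
    and Zs: "set Zs = (\<lambda>(a, b). {i. i < length v \<and> a \<bullet> v ! i = b}) ` set hs"
  shows "{F. F face_of P} = cell v ` facial Zs {..<length v}"
proof -
  define Z where "Z = (\<lambda>(a :: real^'n, b). {i. i < length v \<and> a \<bullet> v ! i = b})"
  have tight: "{x \<in> P. \<forall>(a, b)\<in>A. a \<bullet> x = b} face_of P \<and>
      {x \<in> P. \<forall>(a, b)\<in>A. a \<bullet> x = b} = cell v ({..<length v} \<inter> \<Inter>(Z ` A))" if "A \<subseteq> set hs" for A
  proof -
    have le: "a \<bullet> x \<le> b" if "(a, b) \<in> A" "x \<in> P" for a b x
      using that \<open>A \<subseteq> set hs\<close> unfolding H by blast
    have "{i. i < length v \<and> (\<forall>(a, b)\<in>A. a \<bullet> v ! i = b)} = {..<length v} \<inter> \<Inter>(Z ` A)"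
      unfolding Z_def by auto
    then show ?thesis using tight_face[OF V le, of A] by simp
  qed
  have Zs': "set Zs = Z ` set hs" using Zs unfolding Z_def .
  show ?thesis
  proof (intro equalityI subsetI)
    fix F assume "F \<in> {F. F face_of P}"
    then have F: "F face_of P" by simp
    show "F \<in> cell v ` facial Zs {..<length v}"
    proof (cases "F = {}")
      case True
      then show ?thesis by (intro image_eqI[of _ _ "{}"]) (auto simp: facial_iff)
    next
      case False
      then obtain A where A: "A \<subseteq> set hs" "F = {x \<in> P. \<forall>(a, b)\<in>A. a \<bullet> x = b}"
        using face_eq_tight_face[OF H F] by blast
      then have "F = cell v ({..<length v} \<inter> \<Inter>(Z ` A))" using tight by simp
      moreover have "{..<length v} \<inter> \<Inter>(Z ` A) \<in> facial Zs {..<length v}"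
        unfolding facial_iff Zs' using A(1) by (intro disjI2 exI[of _ "Z ` A"]) auto
      ultimately show ?thesis by blast
    qed
  next
    fix F assume "F \<in> cell v ` facial Zs {..<length v}"
    then obtain I where I: "I \<in> facial Zs {..<length v}" "F = cell v I" by blast
    then consider "I = {}" | B where "B \<subseteq> Z ` set hs" "I = {..<length v} \<inter> \<Inter>B"
      unfolding facial_iff Zs' by blast
    then show "F \<in> {F. F face_of P}"
    proof cases
      case (2 B)
      then obtain A where "A \<subseteq> set hs" "B = Z ` A" by (auto simp: subset_image_iff)
      then show ?thesis using tight[of A] I 2 by (metis mem_Collect_eq)
    qed (use I in simp)
  qed
qed

section \<open>Maximal cells and minimal non-faces of a pulling\<close>

text \<open>This collects what has to be known about a polytope in order to compute its pullings. The list \<open>v\<close>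
enumerates the lattice points, \<open>Zs\<close> the sets of indices on the bounding hyperplanes, and \<open>Cs\<close> the
intended maximal cells.\<close>

definition pulling_model :: "(real^'n) set \<Rightarrow> (real^'n) list \<Rightarrow> nat set list \<Rightarrow> nat set set \<Rightarrow> bool" where
  "pulling_model P v Zs Cs \<longleftrightarrow> lattice_points P = set v \<and> distinct v \<and> P = convex hull set v \<and>
     {F. F face_of P} = cell v ` facial Zs {..<length v} \<and>
     \<Union>Cs \<subseteq> {..<length v} \<and> P \<subseteq> (\<Union>I\<in>Cs. cell v I)"

text \<open>The last two clauses say that \<open>Ns\<close> consists of the minimal index sets contained in no member of
\<open>Cs\<close>: each member is a minimal non-face, and every non-face contains a member.\<close>

definition index_pulling ::
  "nat set list \<Rightarrow> nat \<Rightarrow> nat list \<Rightarrow> nat set set \<Rightarrow> nat set set \<Rightarrow> bool" where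
  "index_pulling Zs m js Cs Ns \<longleftrightarrow> (let U = set [0..<m]; D = facial Zs U in
     (\<forall>i\<in>U. {i} \<in> D) \<and> set js \<subseteq> U \<and> fold cpull js D = \<Union>(Pow ` Cs) \<and>
     (\<forall>C\<in>Cs. \<forall>C'\<in>Cs. C \<subseteq> C' \<longrightarrow> C = C') \<and>
     (\<forall>N\<in>Ns. N \<subseteq> U \<and> \<not> (\<exists>C\<in>Cs. N \<subseteq> C) \<and> (\<forall>i\<in>N. \<exists>C\<in>Cs. N - {i} \<subseteq> C)) \<and>
     (\<forall>K\<in>Pow U. (\<exists>C\<in>Cs. K \<subseteq> C) \<or> (\<exists>N\<in>Ns. N \<subseteq> K)))"

lemma pulling_modelD:
  assumes "pulling_model P v Zs Cs"
  shows "lattice_points P = set v" "distinct v" "P = convex hull set v"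
    "{F. F face_of P} = cell v ` facial Zs {..<length v}"
    "\<Union>Cs \<subseteq> {..<length v}" "P \<subseteq> (\<Union>I\<in>Cs. cell v I)"
proof -
  note M = assms[unfolded pulling_model_def]
  show "lattice_points P = set v" using M by (elim conjE)
  show "distinct v" using M by (elim conjE)
  show "P = convex hull set v" using M by (elim conjE)
  show "{F. F face_of P} = cell v ` facial Zs {..<length v}" using M by (elim conjE)
  show "\<Union>Cs \<subseteq> {..<length v}" using M by (elim conjE)
  show "P \<subseteq> (\<Union>I\<in>Cs. cell v I)" using M by (elim conjE)
qed

text \<open>A listed point whose singleton is one of the facial index sets is a face by itself, that is, a
vertex.\<close>

lemma convex_position_if_model:
  assumes "pulling_model P v Zs Cs" and "\<And>i. i < length v \<Longrightarrow> {i} \<in> facial Zs {..<length v}"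
  shows "convex_position v"
  unfolding convex_position_def
proof (intro conjI ballI)
  fix x assume "x \<in> set v"
  then obtain i where i: "i < length v" "x = v ! i" by (auto simp: in_set_conv_nth)
  have "cell v {i} face_of P"
    using pulling_modelD(4)[OF assms(1)] assms(2)[OF i(1)] by blast
  then show "x extreme_point_of convex hull set v"
    using i assms(1) by (simp add: pulling_model_def face_of_singleton)
qed (use assms in \<open>simp add: pulling_model_def\<close>)

theorem pulling_yields_if_index_pulling:
  fixes v :: "(real^'n) list"
  assumes M: "pulling_model P v Zs Cs" and ix: "index_pulling Zs (length v) js Cs Ns"
  shows "pulling_yields P v js Cs Ns"
proof -
  define U where "U = {..<length v}"
  define D where "D = \<Union>(Pow ` Cs)"
  define T where "T = cell v ` D"
  have U: "set [0..<length v] = U" unfolding U_def by auto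
  note ix' = ix[unfolded index_pulling_def Let_def U]
  note check = conjunct1[OF ix'] conjunct2[OF ix', THEN conjunct1]
    conjunct2[OF ix', THEN conjunct2, THEN conjunct1]
    conjunct2[OF ix', THEN conjunct2, THEN conjunct2, THEN conjunct1]
    conjunct2[OF ix', THEN conjunct2, THEN conjunct2, THEN conjunct2, THEN conjunct1]
    conjunct2[OF ix', THEN conjunct2, THEN conjunct2, THEN conjunct2, THEN conjunct2]
  have sing: "{i} \<in> facial Zs U" if "i < length v" for i
    using check(1) that by (simp add: U_def)
  have js: "set js \<subseteq> {..<length v}" using check(2) by (simp add: U_def)
  have fold: "fold cpull js (facial Zs U) = D" using check(3) by (simp add: D_def)
  have anti: "C = C'" if "C \<in> Cs" "C' \<in> Cs" "C \<subseteq> C'" for C C'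
    using check(4) that by simp
  have Ns: "N \<subseteq> U" "N \<notin> D" "\<And>i. i \<in> N \<Longrightarrow> N - {i} \<in> D" if "N \<in> Ns" for N
    using bspec[OF check(5) that] by (auto simp: D_def)
  have total: "K \<in> D \<or> (\<exists>N\<in>Ns. N \<subseteq> K)" if "K \<subseteq> U" for K
    using bspec[OF check(6), of K] that by (auto simp: D_def)
  have P: "P = convex hull set v" "lattice_points P = set v" "P \<subseteq> (\<Union>I\<in>Cs. cell v I)"
    and faces: "trivial_subdivision P = cell v ` facial Zs U"
    using M unfolding pulling_model_def trivial_subdivision_def U_def by auto
  have pos: "convex_position v"
    using convex_position_if_model[OF M] sing unfolding U_def .
  then have inj: "inj_on ((!) v) U"
    unfolding convex_position_def U_def by (simp add: inj_on_nth)
  have "polytope P" unfolding P(1) by (intro polytope_convex_hull) simp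
  then have "polytopal_complex (trivial_subdivision P)"
    by (rule polytopal_complex_trivial_subdivision)
  then have base: "polytopal_complex (cell v ` facial Zs {..<length v})"
    by (simp add: faces U_def)
  note pulled = fold_pull_cells[OF pos js facial_subset_Pow base, folded U_def, unfolded fold,
      folded T_def faces]
  have T_eq: "fold pull (map ((!) v) js) (trivial_subdivision P) = T"
    and cx: "polytopal_complex T" and DU: "D \<subseteq> Pow U"
    by (rule conjunct1[OF pulled] conjunct1[OF conjunct2[OF pulled]] conjunct2[OF conjunct2[OF pulled]])+
  have sub: "cell v I \<subseteq> cell v J \<longleftrightarrow> I \<subseteq> J" if "I \<in> D" "J \<in> D" for I J
    using cell_subset_iff[OF pos] DU that unfolding U_def by blast
  have CsD: "Cs \<subseteq> D" unfolding D_def by auto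
  have down: "Pow I \<subseteq> D" if "I \<in> D" for I using that unfolding D_def by blast
  have "simplicial_complex T"
    unfolding T_def using DU cx
    by (intro simplicial_complex_cells[OF pos _ _ down]) (simp_all add: U_def T_def)
  moreover have "lattice_polytope C" if C: "C \<in> T" for C
  proof -
    obtain I where I: "I \<in> D" "C = cell v I" using C unfolding T_def by blast
    then have "I \<subseteq> U" using DU by blast
    then have "(!) v ` I \<subseteq> lattice_points P" "finite I"
      unfolding P(2) U_def by (auto intro: finite_subset)
    then show ?thesis
      unfolding lattice_polytope_def I(2) lattice_points_def by blast
  qed
  moreover have "\<Union>T = P"
  proof
    have "cell v I \<subseteq> P" if "I \<in> D" for I
      unfolding P(1) using DU that by (intro hull_mono nth_image_subset) (auto simp: U_def)
    then show "\<Union>T \<subseteq> P" unfolding T_def by blast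
    show "P \<subseteq> \<Union>T" using P(3) CsD unfolding T_def by blast
  qed
  ultimately have "triangulates T P" unfolding triangulates_def by blast
  moreover have "set (map ((!) v) js) \<subseteq> lattice_points P"
    unfolding P(2) using js by auto
  ultimately have "pulls_to P (map ((!) v) js) T"
    unfolding pulls_to_def using T_eq by simp
  moreover have "maximal_cells T = cell v ` Cs"
  proof (intro equalityI subsetI)
    fix X assume "X \<in> maximal_cells T"
    then obtain I where I: "I \<in> D" "X = cell v I" "\<And>J. J \<in> D \<Longrightarrow> \<not> X \<subset> cell v J"
      unfolding maximal_cells_def T_def by blast
    then obtain C where C: "C \<in> Cs" "I \<subseteq> C" unfolding D_def by blast
    then have "cell v I \<subseteq> cell v C" by (intro hull_mono image_mono)
    then have "X = cell v C" using I C CsD by blast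
    then show "X \<in> cell v ` Cs" using C by blast
  next
    fix X assume "X \<in> cell v ` Cs"
    then obtain C where C: "C \<in> Cs" "X = cell v C" by blast
    have "\<not> cell v C \<subset> cell v J" if J: "J \<in> D" for J
    proof
      assume "cell v C \<subset> cell v J"
      then have "C \<subset> J" using sub[of C J] sub[of J C] C CsD J by blast
      moreover obtain C' where "C' \<in> Cs" "J \<subseteq> C'" using J unfolding D_def by blast
      ultimately show False using anti[OF C(1), of C'] by blast
    qed
    then show "X \<in> maximal_cells T"
      using C CsD unfolding maximal_cells_def T_def by blast
  qed
  moreover have "{N. minimal_non_face P T N} = (\<lambda>I. (!) v ` I) ` Ns"
  proof -
    have in_cell: "(\<exists>C\<in>T. (!) v ` K \<subseteq> C) \<longleftrightarrow> K \<in> D" if K: "K \<subseteq> U" for K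
    proof
      assume "\<exists>C\<in>T. (!) v ` K \<subseteq> C"
      then obtain I where I: "I \<in> D" "(!) v ` K \<subseteq> cell v I" unfolding T_def by blast
      have "K \<subseteq> I"
      proof
        fix k assume "k \<in> K"
        then show "k \<in> I"
          using vertex_in_cell_iff[OF pos, of k I] I K DU unfolding U_def by blast
      qed
      then show "K \<in> D" using I(1) unfolding D_def by blast
    next
      assume "K \<in> D"
      then show "\<exists>C\<in>T. (!) v ` K \<subseteq> C" unfolding T_def by (blast intro: hull_subset[THEN subsetD])
    qed
    have vU: "(!) v ` U = set v" unfolding U_def by (rule image_nth_lessThan)
    show ?thesis
    proof (intro equalityI subsetI)
      fix N assume "N \<in> {N. minimal_non_face P T N}"
      then have N: "N \<subseteq> set v" "\<not> (\<exists>C\<in>T. N \<subseteq> C)" "\<And>M. M \<subset> N \<Longrightarrow> \<exists>C\<in>T. M \<subseteq> C"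
        unfolding minimal_non_face_def non_face_def P(2) by auto
      then obtain K where K: "K \<subseteq> U" "N = (!) v ` K" unfolding vU[symmetric] by (auto simp: subset_image_iff)
      then have "K \<notin> D" using in_cell N(2) by blast
      then obtain N' where N': "N' \<in> Ns" "N' \<subseteq> K" using total K by blast
      have "N' = K"
      proof (rule ccontr)
        assume "N' \<noteq> K"
        then have "(!) v ` N' \<subset> N"
          using N'(2) K inj inj_on_image_eq_iff[OF inj, of N' K] by blast
        then have "N' \<in> D" using N(3) in_cell[of N'] N'(2) K by blast
        then show False using Ns(2) N' by blast
      qed
      then show "N \<in> (\<lambda>I. (!) v ` I) ` Ns" using N' K by blast
    next
      fix N assume "N \<in> (\<lambda>I. (!) v ` I) ` Ns"
      then obtain K where K: "K \<in> Ns" "N = (!) v ` K" by blast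
      have KU: "K \<subseteq> U" using Ns(1)[OF K(1)] .
      have "\<exists>C\<in>T. M \<subseteq> C" if M: "M \<subset> N" for M
      proof -
        obtain L where L: "L \<subseteq> K" "M = (!) v ` L" using M K by (auto simp: subset_image_iff psubset_eq)
        then obtain i where i: "i \<in> K" "L \<subseteq> K - {i}" using M K by blast
        then have "L \<in> D" using Ns(3)[OF K(1) i(1)] unfolding D_def by blast
        then show ?thesis using in_cell[of L] L KU by blast
      qed
      moreover have "\<not> (\<exists>C\<in>T. N \<subseteq> C)"
        using in_cell[OF KU] Ns(2)[OF K(1)] K(2) by simp
      moreover have "N \<subseteq> lattice_points P"
        unfolding P(2) K(2) vU[symmetric] using KU by blast
      ultimately show "N \<in> {N. minimal_non_face P T N}"
        unfolding minimal_non_face_def non_face_def by blast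
    qed
  qed
  ultimately show ?thesis unfolding pulling_yields_def by blast
qed

text \<open>Sizes of index sets are sizes of point sets, because the listed points are distinct.\<close>

lemma has_pulling_triangulation_mnf_if_pulling_yields:
  assumes "pulling_yields P v js Cs Ns" "distinct v"
    and "\<And>N. N \<in> Ns \<Longrightarrow> N \<subseteq> {..<length v} \<and> card N = k"
  shows "has_pulling_triangulation_mnf k P"
proof -
  obtain T where T: "pulls_to P (map ((!) v) js) T" "{N. minimal_non_face P T N} = (\<lambda>I. (!) v ` I) ` Ns"
    using assms(1) unfolding pulling_yields_def by (elim exE conjE) (rule that)
  have "card N = k" if "minimal_non_face P T N" for N
  proof -
    have "N \<in> (\<lambda>I. (!) v ` I) ` Ns" using that by (simp flip: T(2))
    then obtain I where I: "I \<in> Ns" "N = (!) v ` I" by blast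
    moreover have "inj_on ((!) v) I"
      by (rule inj_on_nth[OF assms(2)]) (use assms(3)[OF I(1)] in auto)
    ultimately show ?thesis using assms(3)[of I] card_image[of "(!) v" I] by simp
  qed
  then show ?thesis
    using T(1) unfolding has_pulling_triangulation_mnf_def pulling_triangulation_def
    by (intro exI conjI allI impI)
qed

section \<open>Computing with bit lists\<close>

text \<open>A subset of \<open>{..<m}\<close> is represented by its characteristic bit list of length \<open>m\<close>. Comparing two such
lists needs few rewriting steps, whereas comparing finite sets of natural numbers needs many.\<close>

definition elems :: "bool list \<Rightarrow> nat set" where
  "elems bs = {i. i < length bs \<and> bs ! i}"

definition bits :: "nat \<Rightarrow> nat list \<Rightarrow> bool list" where
  "bits m xs = map (\<lambda>i. i \<in> set xs) [0..<m]"

abbreviation bits_le :: "bool list \<Rightarrow> bool list \<Rightarrow> bool" (infix "\<preceq>" 50) where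
  "xs \<preceq> ys \<equiv> list_all2 (\<longrightarrow>) xs ys"

text \<open>These are the bit lists of all subsets of the represented set (see \<open>set_subs\<close>).\<close>

primrec subs :: "bool list \<Rightarrow> bool list list" where
  "subs [] = [[]]"
| "subs (b # bs) = map ((#) False) (subs bs) @ (if b then map ((#) True) (subs bs) else [])"

primrec facial_bits :: "nat \<Rightarrow> bool list list \<Rightarrow> bool list list" where
  "facial_bits m [] = [replicate m True, replicate m False]"
| "facial_bits m (Z # Zs) =
     (let D = facial_bits m Zs in remdups (D @ map (map2 (\<and>) Z) D))"

definition cpull_bits :: "nat \<Rightarrow> bool list list \<Rightarrow> bool list list" where
  "cpull_bits w D = filter (\<lambda>I. \<not> I ! w) D @
     map (\<lambda>J. J[w := True]) (filter (\<lambda>J. \<not> J ! w \<and> list_ex ((\<preceq>) (J[w := True])) D) D)"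

text \<open>The clauses correspond to those of \<open>index_pulling\<close>; the third and the fourth one together compare
the pulled family with the set of all subsets of members of \<open>Cs\<close>.\<close>

definition pulling_check ::
  "nat list list \<Rightarrow> nat \<Rightarrow> nat list \<Rightarrow> nat list list \<Rightarrow> nat list list \<Rightarrow> bool" where
  "pulling_check Zs m js Cs Ns \<longleftrightarrow>
     (let D = facial_bits m (map (bits m) Zs); T = fold cpull_bits js D;
        Cb = map (bits m) Cs; Nb = map (bits m) Ns in
      list_all (\<lambda>i. bits m [i] \<in> set D) [0..<m] \<and>
      list_all (\<lambda>i. i < m) (js @ concat Cs @ concat Ns) \<and>
      list_all (\<lambda>I. list_ex ((\<preceq>) I) Cb) T \<and>
      list_all (\<lambda>C. list_all (\<lambda>I. I \<in> set T) (subs C)) Cb \<and>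
      list_all (\<lambda>C. list_all (\<lambda>C'. C \<preceq> C' \<longrightarrow> C = C') Cb) Cb \<and>
      list_all (\<lambda>N. \<not> list_ex ((\<preceq>) N) Cb \<and>
        list_all (\<lambda>i. N ! i \<longrightarrow> list_ex ((\<preceq>) (N[i := False])) Cb) [0..<m]) Nb \<and>
      list_all (\<lambda>K. list_ex ((\<preceq>) K) Cb \<or> list_ex (\<lambda>N. N \<preceq> K) Nb) (subs (replicate m True)))"

lemma elems_bits: "elems (bits m xs) = set xs \<inter> {..<m}"
  by (auto simp: elems_def bits_def)

lemma length_bits [simp]: "length (bits m xs) = m"
  by (simp add: bits_def)

lemma subset_bits_iff: "length xs = length ys \<Longrightarrow> xs \<preceq> ys \<longleftrightarrow> elems xs \<subseteq> elems ys"
  by (auto simp: elems_def list_all2_conv_all_nth)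

lemma set_subs: "set (subs bs) = {xs. xs \<preceq> bs}"
proof (induction bs)
  case (Cons b bs)
  show ?case by (auto simp: Cons.IH list_all2_Cons2)
qed auto

text \<open>Bit lists of length \<open>m\<close> only represent the part of an incidence set below \<open>m\<close>, which is enough.\<close>

lemma facial_Int: "facial (map (\<lambda>Z. Z \<inter> U) Zs) U = facial Zs U"
proof (induction Zs)
  case (Cons Z Zs)
  have "(\<inter>) (Z \<inter> U) ` facial Zs U = (\<inter>) Z ` facial Zs U"
    using facial_subset_Pow[of Zs U] by (intro image_cong refl) blast
  then show ?case by (simp add: Cons.IH)
qed simp

lemma elems_facial_bits:
  assumes "\<forall>Z\<in>set Zs. length Z = m"
  shows "elems ` set (facial_bits m Zs) = facial (map elems Zs) {..<m} \<and>
    (\<forall>I\<in>set (facial_bits m Zs). length I = m)"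
  using assms
proof (induction Zs)
  case Nil
  have "elems (replicate m True) = {..<m}" "elems (replicate m False) = {}"
    by (auto simp: elems_def)
  then show ?case by simp
next
  case (Cons Z Zs)
  have "elems (map2 (\<and>) Z I) = elems Z \<inter> elems I" if "length I = m" for I
    using that Cons.prems by (auto simp: elems_def)
  then have "elems ` map2 (\<and>) Z ` set (facial_bits m Zs) = (\<inter>) (elems Z) ` elems ` set (facial_bits m Zs)"
    unfolding image_image using Cons by (intro image_cong) auto
  then show ?case using Cons by (auto simp: Let_def image_Un)
qed

lemma elems_cpull_bits:
  assumes D: "\<forall>I\<in>set D. length I = m" and w: "w < m"
  shows "elems ` set (cpull_bits w D) = cpull w (elems ` set D) \<and>
    (\<forall>I\<in>set (cpull_bits w D). length I = m)"
proof -
  have mem: "w \<in> elems I \<longleftrightarrow> I ! w" if "I \<in> set D" for I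
    using D w that by (simp add: elems_def)
  have ins: "elems (J[w := True]) = insert w (elems J)" if "J \<in> set D" for J
    using D w that by (auto simp: elems_def nth_list_update)
  have le: "J[w := True] \<preceq> I \<longleftrightarrow> insert w (elems J) \<subseteq> elems I" if "J \<in> set D" "I \<in> set D" for I J
    using ins[OF that(1)] D that by (simp add: subset_bits_iff)
  define X where "X = {J \<in> set D. w \<notin> elems J \<and> (\<exists>I\<in>set D. insert w (elems J) \<subseteq> elems I)}"
  have X: "{J \<in> set D. \<not> J ! w \<and> list_ex ((\<preceq>) (J[w := True])) D} = X"
    unfolding X_def list_ex_iff by (rule Collect_cong) (use mem le in \<open>metis (full_types)\<close>)
  have N: "{I \<in> set D. \<not> I ! w} = {I \<in> set D. w \<notin> elems I}"
    using mem by blast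
  have set: "set (cpull_bits w D) = {I \<in> set D. w \<notin> elems I} \<union> (\<lambda>J. J[w := True]) ` X"
    unfolding cpull_bits_def set_append set_map set_filter X N by (rule refl)
  have "elems ` (\<lambda>J. J[w := True]) ` X = insert w ` elems ` X"
    unfolding image_image by (rule image_cong) (use ins in \<open>simp_all add: X_def\<close>)
  moreover have "elems ` X = Set.filter (\<lambda>J. w \<notin> J \<and> (\<exists>I\<in>elems ` set D. insert w J \<subseteq> I)) (elems ` set D)"
    unfolding X_def by auto
  moreover have "elems ` {I \<in> set D. w \<notin> elems I} = Set.filter (\<lambda>I. w \<notin> I) (elems ` set D)"
    by auto
  ultimately have "elems ` set (cpull_bits w D) = cpull w (elems ` set D)"
    unfolding set image_Un cpull_def by simp
  moreover have "\<forall>I\<in>set (cpull_bits w D). length I = m"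
    unfolding set X_def using D by auto
  ultimately show ?thesis by (rule conjI)
qed

lemma elems_fold_cpull_bits:
  assumes "\<forall>I\<in>set D. length I = m" "\<forall>j\<in>set js. j < m"
  shows "elems ` set (fold cpull_bits js D) = fold cpull js (elems ` set D) \<and>
    (\<forall>I\<in>set (fold cpull_bits js D). length I = m)"
  using assms
proof (induction js arbitrary: D)
  case (Cons w js)
  have "elems ` set (cpull_bits w D) = cpull w (elems ` set D)"
    "\<forall>I\<in>set (cpull_bits w D). length I = m"
    using elems_cpull_bits[OF Cons.prems(1), of w] Cons.prems(2) by simp_all
  then show ?case using Cons.IH[of "cpull_bits w D"] Cons.prems(2) by simp
qed simp

lemma index_pulling_if_check:
  assumes "pulling_check Zs m js Cs Ns"
  shows "index_pulling (map set Zs) m js (set ` set Cs) (set ` set Ns)"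
proof -
  define D where "D = facial_bits m (map (bits m) Zs)"
  define T where "T = fold cpull_bits js D"
  have check: "\<forall>i<m. bits m [i] \<in> set D" "\<forall>j\<in>set js. j < m"
    "\<forall>C\<in>set Cs. set C \<subseteq> {..<m}" "\<forall>N\<in>set Ns. set N \<subseteq> {..<m}"
    "\<forall>I\<in>set T. \<exists>C\<in>set Cs. I \<preceq> bits m C"
    "\<forall>C\<in>set Cs. \<forall>I. I \<preceq> bits m C \<longrightarrow> I \<in> set T"
    "\<forall>C\<in>set Cs. \<forall>C'\<in>set Cs. bits m C \<preceq> bits m C' \<longrightarrow> bits m C = bits m C'"
    "\<forall>N\<in>set Ns. \<not> (\<exists>C\<in>set Cs. bits m N \<preceq> bits m C)"
    "\<forall>N\<in>set Ns. \<forall>i<m. bits m N ! i \<longrightarrow> (\<exists>C\<in>set Cs. (bits m N)[i := False] \<preceq> bits m C)"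
    "\<forall>K. K \<preceq> replicate m True \<longrightarrow> (\<exists>C\<in>set Cs. K \<preceq> bits m C) \<or> (\<exists>N\<in>set Ns. bits m N \<preceq> K)"
    using assms unfolding pulling_check_def Let_def D_def[symmetric] T_def[symmetric]
    by (auto simp: list_all_iff list_ex_iff set_subs)
  have el: "elems (bits m xs) = set xs" if "set xs \<subseteq> {..<m}" for xs
    using that by (auto simp: elems_bits)
  have D: "elems ` set D = facial (map set Zs) {..<m}" "\<forall>I\<in>set D. length I = m"
    using elems_facial_bits[of "map (bits m) Zs" m] facial_Int[of "{..<m}" "map set Zs"]
    unfolding D_def by (simp_all add: elems_bits comp_def)
  have T: "elems ` set T = fold cpull js (facial (map set Zs) {..<m})" "\<forall>I\<in>set T. length I = m"
    using elems_fold_cpull_bits[OF D(2) check(2)] unfolding T_def D(1) by simp_all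
  have ex_bits: "\<exists>bs. length bs = m \<and> elems bs = I" if "I \<subseteq> {..<m}" for I
    using that by (intro exI[of _ "map (\<lambda>i. i \<in> I) [0..<m]"]) (auto simp: elems_def)
  have le: "I \<preceq> bits m C \<longleftrightarrow> elems I \<subseteq> set C" if "length I = m" "set C \<subseteq> {..<m}" for I C
    using that by (simp add: subset_bits_iff el)
  have U: "set [0..<m] = {..<m}" by auto
  have face_iff: "fold cpull js (facial (map set Zs) {..<m}) = \<Union>(Pow ` set ` set Cs)"
    unfolding T(1)[symmetric]
  proof (intro equalityI subsetI)
    fix X assume "X \<in> elems ` set T"
    then obtain I where I: "I \<in> set T" "X = elems I" by blast
    then obtain C where "C \<in> set Cs" "I \<preceq> bits m C" using check(5) by blast
    then show "X \<in> \<Union>(Pow ` set ` set Cs)" using le[of I C] I T(2) check(3) by auto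
  next
    fix X assume "X \<in> \<Union>(Pow ` set ` set Cs)"
    then obtain C where C: "C \<in> set Cs" "X \<subseteq> set C" by blast
    then have C': "set C \<subseteq> {..<m}" using check(3) by blast
    then obtain I where I: "length I = m" "elems I = X" using ex_bits[of X] C(2) by blast
    then have "I \<preceq> bits m C" using le[OF I(1) C'] C(2) by simp
    then show "X \<in> elems ` set T" using check(6) C(1) I(2) by blast
  qed
  show ?thesis
    unfolding index_pulling_def Let_def U
  proof (intro conjI ballI impI face_iff)
    fix i assume "i \<in> {..<m}"
    then have "elems (bits m [i]) = {i}" "bits m [i] \<in> set D" using check(1) el[of "[i]"] by auto
    then show "{i} \<in> facial (map set Zs) {..<m}" unfolding D(1)[symmetric] by force
  next
    show "set js \<subseteq> {..<m}" using check(2) by auto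
  next
    fix A B assume "A \<in> set ` set Cs" "B \<in> set ` set Cs" and AB: "A \<subseteq> B"
    then obtain C C' where C: "C \<in> set Cs" "A = set C" "C' \<in> set Cs" "B = set C'" by blast
    then have sub: "set C \<subseteq> {..<m}" "set C' \<subseteq> {..<m}" using check(3) by auto
    then have "bits m C \<preceq> bits m C'" using le[of "bits m C" C'] AB C el by simp
    then have "bits m C = bits m C'" using check(7) C by blast
    then show "A = B" using el[OF sub(1)] el[OF sub(2)] C by simp
  next
    fix N assume "N \<in> set ` set Ns"
    then obtain xs where xs: "xs \<in> set Ns" "N = set xs" by blast
    then have sub: "set xs \<subseteq> {..<m}" using check(4) by blast
    then show "N \<subseteq> {..<m}" using xs by simp
    show "\<not> (\<exists>C\<in>set ` set Cs. N \<subseteq> C)"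
      using check(8) xs le[of "bits m xs"] el[OF sub] check(3) by auto
    fix i assume "i \<in> N"
    then have i: "i < m" "bits m xs ! i" using sub xs by (auto simp: bits_def)
    then obtain C where C: "C \<in> set Cs" "(bits m xs)[i := False] \<preceq> bits m C" using check(9) xs(1) by blast
    have "elems ((bits m xs)[i := False]) = N - {i}"
      using el[OF sub] xs(2) i(1) by (auto simp: elems_def nth_list_update split: if_splits)
    then show "\<exists>C\<in>set ` set Cs. N - {i} \<subseteq> C"
      using C le[of "(bits m xs)[i := False]" C] check(3) by auto
  next
    fix K assume "K \<in> Pow {..<m}"
    then obtain bs where bs: "length bs = m" "elems bs = K" using ex_bits[of K] by auto
    then have "bs \<preceq> replicate m True" by (simp add: list_all2_conv_all_nth)
    then consider C where "C \<in> set Cs" "bs \<preceq> bits m C" | xs where "xs \<in> set Ns" "bits m xs \<preceq> bs"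
      using check(10) by blast
    then show "(\<exists>C\<in>set ` set Cs. K \<subseteq> C) \<or> (\<exists>N\<in>set ` set Ns. N \<subseteq> K)"
    proof cases
      case 1
      then show ?thesis using le[OF bs(1), of C] bs(2) check(3) by auto
    next
      case 2
      then have "set xs \<subseteq> K" using el[of xs] check(4) bs subset_bits_iff[of "bits m xs" bs] by simp
      then show ?thesis using 2 by blast
    qed
  qed
qed

lemma pulling_yields_if_check:
  assumes "pulling_model P v (map set Zs) (set ` set Cs)" "pulling_check Zs (length v) js Cs Ns"
  shows "pulling_yields P v js (set ` set Cs) (set ` set Ns)"
  by (rule pulling_yields_if_index_pulling[OF assms(1) index_pulling_if_check[OF assms(2)]])

section \<open>Polytopes given by inequalities and vertices\<close>

lemma vector_4:
  fixes a b c d :: "'a::zero"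
  shows "(vector [a, b, c, d] :: 'a^4) $ 1 = a" "(vector [a, b, c, d] :: 'a^4) $ 2 = b"
    "(vector [a, b, c, d] :: 'a^4) $ 3 = c" "(vector [a, b, c, d] :: 'a^4) $ 4 = d"
  by (simp_all add: vector_def)

lemmas vector_simps = vec_eq_iff forall_3 forall_4 inner_vec_def sum_3 sum_4 vector_3 vector_4

text \<open>This is the form in which barycentric coordinates are used below, with all sums written as sums
over lists.\<close>

lemma in_cellI:
  assumes "js \<in> set Cs" "length ws = length js" "\<forall>w\<in>set ws. 0 \<le> w" "sum_list ws = 1"
    and x: "x = sum_list (map2 (\<lambda>w j. w *\<^sub>R v ! j) ws js)"
  shows "x \<in> (\<Union>js\<in>set Cs. cell v (set js))"
proof -
  have "x = (\<Sum>k<length js. ws ! k *\<^sub>R v ! (js ! k))"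
    unfolding x by (simp add: sum_list_sum_nth assms(2) atLeast0LessThan)
  also have "\<dots> \<in> cell v (set js)"
  proof (rule convex_sum)
    show "sum ((!) ws) {..<length js} = 1"
      using assms(2,4) by (simp add: sum_list_sum_nth atLeast0LessThan)
  qed (use assms(2,3) in \<open>auto intro!: hull_inc\<close>)
  finally show ?thesis using assms(1) by blast
qed

text \<open>A polytope inside the unit cube has only 0/1 lattice points, so finitely many points have to be
compared with the list \<open>v\<close>. Since the cells in \<open>Cs\<close> cover \<open>P\<close>, the listed points span \<open>P\<close>.\<close>

lemma pulling_modelI:
  fixes v :: "(real^'n) list" and hs :: "((real^'n) \<times> real) list"
  assumes H: "P = {x. \<forall>(a, b)\<in>set hs. a \<bullet> x \<le> b}"
    and Zs: "Zs = map (\<lambda>(a, b). filter (\<lambda>i. a \<bullet> v ! i = b) [0..<length v]) hs"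
    and v: "distinct v" "\<forall>x\<in>set v. x \<in> P \<and> (\<forall>i. x $ i \<in> \<int>)"
    and box: "\<forall>x\<in>P. \<forall>i. 0 \<le> x $ i \<and> x $ i \<le> 1"
    and all: "\<forall>x\<in>P. (\<forall>i. x $ i = 0 \<or> x $ i = 1) \<longrightarrow> x \<in> set v"
    and Cs: "\<forall>js\<in>set Cs. \<forall>j\<in>set js. j < length v"
    and cover: "P \<subseteq> (\<Union>js\<in>set Cs. cell v (set js))"
  shows "pulling_model P v (map set Zs) (set ` set Cs)"
proof -
  have "lattice_points P = set v"
  proof
    show "lattice_points P \<subseteq> set v"
    proof
      fix x assume "x \<in> lattice_points P"
      then have x: "x \<in> P" "\<And>i. x $ i \<in> \<int>" by (auto simp: lattice_points_def int_lattice_def)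
      have "x $ i = 0 \<or> x $ i = 1" for i
      proof -
        obtain k where k: "x $ i = of_int k" using x(2)[of i] by (auto elim: Ints_cases)
        have "0 \<le> x $ i" "x $ i \<le> 1" using box x(1) by auto
        then have "0 \<le> k" "k \<le> 1" unfolding k by simp_all
        then have "k = 0 \<or> k = 1" by linarith
        then show ?thesis unfolding k by auto
      qed
      then show "x \<in> set v" using all x(1) by blast
    qed
  qed (use v in \<open>auto simp: lattice_points_def int_lattice_def\<close>)
  moreover have "P = convex hull set v"
  proof
    have "cell v (set js) \<subseteq> convex hull set v" if "js \<in> set Cs" for js
      using Cs that by (intro hull_mono nth_image_subset) auto
    then show "P \<subseteq> convex hull set v" using cover by blast
    have "P = (\<Inter>(a, b)\<in>set hs. {x. a \<bullet> x \<le> b})" unfolding H by auto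
    also have "convex \<dots>" by (intro convex_INT) (auto intro: convex_halfspace_le)
    finally show "convex hull set v \<subseteq> P" using v(2) by (intro hull_minimal) auto
  qed
  moreover have "set (map set Zs) = (\<lambda>(a, b). {i. i < length v \<and> a \<bullet> v ! i = b}) ` set hs"
    unfolding Zs by (auto simp: image_iff)
  moreover have "\<Union>(set ` set Cs) \<subseteq> {..<length v}" using Cs by auto
  moreover have "P \<subseteq> (\<Union>I\<in>set ` set Cs. cell v I)" using cover by simp
  ultimately show ?thesis
    unfolding pulling_model_def using faces_from_incidences[OF H] v(1) by simp
qed

section \<open>The polytopes\<close>

text \<open>In each of the following models the numbers \<open>ws\<close> are the barycentric coordinates of \<open>x\<close> with
  respect to one maximal cell. The case distinction lists, for each maximal cell, only those
  coordinates that take negative values somewhere on the polytope; all others are nonnegative by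
  the inequalities of the polytope, and the cases are exhaustive because the cells cover the
  polytope. The prism and the cube are needed for the classification of compressed
  three-dimensional polytopes below.\<close>


definition verts_Ia3 :: "(real^3) list" where
  "verts_Ia3 = [vector [0, 0, 0], vector [1, 0, 0], vector [0, 1, 0], vector [0, 0, 1]]"

lemma pulling_model_Ia3:
  "pulling_model poly_Ia3 verts_Ia3
    (map set [[0, 2, 3], [0, 1, 3], [0, 1, 2], [1, 2, 3]])
    (set ` set [[0, 1, 2, 3]])"
  (is "pulling_model _ _ _ (_ ` set ?Cs)")
proof (rule pulling_modelI[where hs = "[(vector [-1, 0, 0], 0),
      (vector [0, -1, 0], 0),
      (vector [0, 0, -1], 0),
      (vector [1, 1, 1], 1)]"])
  show "poly_Ia3 \<subseteq> (\<Union>js\<in>set ?Cs. cell verts_Ia3 (set js))"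
  proof
    fix x assume "x \<in> poly_Ia3"
    then have x: "0 \<le> x$1" "0 \<le> x$2" "0 \<le> x$3" "0 \<le> 1 - x$1 - x$2 - x$3"
      by (simp_all add: poly_Ia3_def)
    show "x \<in> (\<Union>js\<in>set ?Cs. cell verts_Ia3 (set js))"
      using x by (intro in_cellI[where ws = "[1 - x$1 - x$2 - x$3, x$1, x$2, x$3]"
        and js = "[0, 1, 2, 3]"])
        (simp_all add: verts_Ia3_def vector_simps)
  qed
qed (((auto simp: poly_Ia3_def vector_simps)[1],
    (simp add: verts_Ia3_def vector_simps upt_conv_Cons eval_nat_numeral),
    (simp add: verts_Ia3_def vector_simps),
    (simp add: poly_Ia3_def verts_Ia3_def vector_simps),
    (auto simp: poly_Ia3_def vector_simps)[1],
    (clarsimp simp: poly_Ia3_def verts_Ia3_def vector_simps, (elim disjE; simp)),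
    (simp add: verts_Ia3_def)))

lemma pulling_check_Ia3:
  "pulling_check [[0, 2, 3], [0, 1, 3], [0, 1, 2], [1, 2, 3]] (length verts_Ia3) []
    [[0, 1, 2, 3]]
    []"
  unfolding verts_Ia3_def by code_simp

definition verts_IIc4 :: "(real^4) list" where
  "verts_IIc4 = [vector [0, 0, 0, 0], vector [1, 0, 0, 0], vector [0, 1, 0, 0], vector [0, 0, 1, 0],
     vector [0, 0, 0, 1]]"

lemma pulling_model_IIc4:
  "pulling_model poly_IIc4 verts_IIc4
    (map set [[0, 2, 3, 4], [0, 1, 3, 4], [0, 1, 2, 4], [0, 1, 2, 3], [1, 2, 3, 4]])
    (set ` set [[0, 1, 2, 3, 4]])"
  (is "pulling_model _ _ _ (_ ` set ?Cs)")
proof (rule pulling_modelI[where hs = "[(vector [-1, 0, 0, 0], 0),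
      (vector [0, -1, 0, 0], 0),
      (vector [0, 0, -1, 0], 0),
      (vector [0, 0, 0, -1], 0),
      (vector [1, 1, 1, 1], 1)]"])
  show "poly_IIc4 \<subseteq> (\<Union>js\<in>set ?Cs. cell verts_IIc4 (set js))"
  proof
    fix x assume "x \<in> poly_IIc4"
    then have x: "0 \<le> x$1" "0 \<le> x$2" "0 \<le> x$3" "0 \<le> x$4"
      "0 \<le> 1 - x$1 - x$2 - x$3 - x$4"
      by (simp_all add: poly_IIc4_def)
    show "x \<in> (\<Union>js\<in>set ?Cs. cell verts_IIc4 (set js))"
      using x by (intro in_cellI[where ws = "[1 - x$1 - x$2 - x$3 - x$4, x$1, x$2, x$3, x$4]"
        and js = "[0, 1, 2, 3, 4]"])
        (simp_all add: verts_IIc4_def vector_simps)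
  qed
qed (((auto simp: poly_IIc4_def vector_simps)[1],
    (simp add: verts_IIc4_def vector_simps upt_conv_Cons eval_nat_numeral),
    (simp add: verts_IIc4_def vector_simps),
    (simp add: poly_IIc4_def verts_IIc4_def vector_simps),
    (auto simp: poly_IIc4_def vector_simps)[1],
    (clarsimp simp: poly_IIc4_def verts_IIc4_def vector_simps, (elim disjE; simp)),
    (simp add: verts_IIc4_def)))

lemma pulling_check_IIc4:
  "pulling_check [[0, 2, 3, 4], [0, 1, 3, 4], [0, 1, 2, 4], [0, 1, 2, 3], [1, 2, 3, 4]] (length verts_IIc4) []
    [[0, 1, 2, 3, 4]]
    []"
  unfolding verts_IIc4_def by code_simp

lemma pulling_model_IIc3:
  "pulling_model poly_IIc3 verts_IIc3
    (map set [[0, 1, 4], [0, 1, 2, 3], [0, 2, 4], [1, 3, 4], [2, 3, 4]])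
    (set ` set [[0, 2, 3, 4], [0, 1, 3, 4]])"
  (is "pulling_model _ _ _ (_ ` set ?Cs)")
proof (rule pulling_modelI[where hs = "[(vector [-1, 0, 0], 0),
      (vector [0, -1, 0], 0),
      (vector [0, 0, -1], 0),
      (vector [0, 1, 1], 1),
      (vector [1, 1, 0], 1)]"])
  show "poly_IIc3 \<subseteq> (\<Union>js\<in>set ?Cs. cell verts_IIc3 (set js))"
  proof
    fix x assume "x \<in> poly_IIc3"
    then have x: "0 \<le> x$1" "0 \<le> x$2" "0 \<le> x$3" "0 \<le> 1 - x$2 - x$3"
      "0 \<le> 1 - x$1 - x$2"
      by (simp_all add: poly_IIc3_def)
    consider (1) "0 \<le> x$1 - x$3"
      | (2) "0 \<le> - x$1 + x$3"
      using x by linarith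
    then show "x \<in> (\<Union>js\<in>set ?Cs. cell verts_IIc3 (set js))"
    proof cases
      case 1
      then show ?thesis
        using x by (intro in_cellI[where ws = "[1 - x$1 - x$2, x$1 - x$3, x$3, x$2]"
          and js = "[0, 2, 3, 4]"])
          (simp_all add: verts_IIc3_def vector_simps)
    next
      case 2
      then show ?thesis
        using x by (intro in_cellI[where ws = "[1 - x$2 - x$3, - x$1 + x$3, x$1, x$2]"
          and js = "[0, 1, 3, 4]"])
          (simp_all add: verts_IIc3_def vector_simps)
    qed
  qed
qed (((auto simp: poly_IIc3_def vector_simps)[1],
    (simp add: verts_IIc3_def vector_simps upt_conv_Cons eval_nat_numeral),
    (simp add: verts_IIc3_def vector_simps),
    (simp add: poly_IIc3_def verts_IIc3_def vector_simps),
    (auto simp: poly_IIc3_def vector_simps)[1],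
    (clarsimp simp: poly_IIc3_def verts_IIc3_def vector_simps, (elim disjE; simp)),
    (simp add: verts_IIc3_def)))

lemma pulling_check_IIc3:
  "pulling_check [[0, 1, 4], [0, 1, 2, 3], [0, 2, 4], [1, 3, 4], [2, 3, 4]] (length verts_IIc3) [0]
    [[0, 2, 3, 4], [0, 1, 3, 4]]
    [[1, 2]]"
  unfolding verts_IIc3_def by code_simp

lemma pulling_model_Ib3:
  "pulling_model poly_Ib3 verts_Ib3
    (map set [[0, 3, 4], [1, 2, 5], [0, 1, 2], [3, 4, 5], [0, 1, 3], [2, 4, 5], [0, 2, 4],
       [1, 3, 5]])
    (set ` set [[0, 1, 2, 5], [0, 3, 4, 5], [0, 1, 3, 5], [0, 2, 4, 5]])"
  (is "pulling_model _ _ _ (_ ` set ?Cs)")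
proof (rule pulling_modelI[where hs = "[(vector [-1, 0, 0], 0),
      (vector [1, 0, 0], 1),
      (vector [0, -1, 0], 0),
      (vector [0, 1, 0], 1),
      (vector [0, 0, -1], 0),
      (vector [0, 0, 1], 1),
      (vector [-1, -1, 1], 0),
      (vector [1, 1, -1], 1)]"])
  show "poly_Ib3 \<subseteq> (\<Union>js\<in>set ?Cs. cell verts_Ib3 (set js))"
  proof
    fix x assume "x \<in> poly_Ib3"
    then have x: "0 \<le> x$1" "0 \<le> 1 - x$1" "0 \<le> x$2" "0 \<le> 1 - x$2" "0 \<le> x$3"
      "0 \<le> 1 - x$3" "0 \<le> x$1 + x$2 - x$3" "0 \<le> 1 - x$1 - x$2 + x$3"
      by (simp_all add: poly_Ib3_def)
    consider (1) "0 \<le> x$1 - x$3" "0 \<le> - x$2 + x$3"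
      | (2) "0 \<le> x$2 - x$3" "0 \<le> - x$1 + x$3"
      | (3) "0 \<le> x$1 - x$3" "0 \<le> x$2 - x$3"
      | (4) "0 \<le> - x$2 + x$3" "0 \<le> - x$1 + x$3"
      using x by linarith
    then show "x \<in> (\<Union>js\<in>set ?Cs. cell verts_Ib3 (set js))"
    proof cases
      case 1
      then show ?thesis
        using x by (intro in_cellI[where ws = "[1 - x$1, x$1 - x$3, - x$2 + x$3, x$2]"
          and js = "[0, 1, 2, 5]"])
          (simp_all add: verts_Ib3_def vector_simps)
    next
      case 2
      then show ?thesis
        using x by (intro in_cellI[where ws = "[1 - x$2, x$2 - x$3, - x$1 + x$3, x$1]"
          and js = "[0, 3, 4, 5]"])
          (simp_all add: verts_Ib3_def vector_simps)
    next
      case 3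
      then show ?thesis
        using x by (intro in_cellI[where ws = "[1 - x$1 - x$2 + x$3, x$1 - x$3, x$2 - x$3, x$3]"
          and js = "[0, 1, 3, 5]"])
          (simp_all add: verts_Ib3_def vector_simps)
    next
      case 4
      then show ?thesis
        using x by (intro in_cellI[where ws = "[1 - x$3, - x$2 + x$3, - x$1 + x$3, x$1 + x$2 - x$3]"
          and js = "[0, 2, 4, 5]"])
          (simp_all add: verts_Ib3_def vector_simps)
    qed
  qed
qed (((auto simp: poly_Ib3_def vector_simps)[1],
    (simp add: verts_Ib3_def vector_simps upt_conv_Cons eval_nat_numeral),
    (simp add: verts_Ib3_def vector_simps),
    (simp add: poly_Ib3_def verts_Ib3_def vector_simps),
    (auto simp: poly_Ib3_def vector_simps)[1],
    (clarsimp simp: poly_Ib3_def verts_Ib3_def vector_simps, (elim disjE; simp)),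
    (simp add: verts_Ib3_def)))

lemma pulling_check_Ib3:
  "pulling_check [[0, 3, 4], [1, 2, 5], [0, 1, 2], [3, 4, 5], [0, 1, 3], [2, 4, 5], [0, 2, 4],
       [1, 3, 5]] (length verts_Ib3) [0]
    [[0, 1, 2, 5], [0, 3, 4, 5], [0, 1, 3, 5], [0, 2, 4, 5]]
    [[1, 4], [2, 3]]"
  unfolding verts_Ib3_def by code_simp

lemma pulling_model_Id4:
  "pulling_model poly_Id4 verts_Id4
    (map set [[0, 1, 4, 5], [0, 1, 2, 3], [0, 1, 2, 4], [0, 2, 3, 4, 5], [0, 1, 3, 5],
       [1, 2, 3, 4, 5]])
    (set ` set [[0, 1, 2, 3, 5], [0, 1, 2, 4, 5]])"
  (is "pulling_model _ _ _ (_ ` set ?Cs)")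
proof (rule pulling_modelI[where hs = "[(vector [-1, 0, 0, 0], 0),
      (vector [0, -1, 0, 0], 0),
      (vector [0, 0, -1, 0], 0),
      (vector [0, 0, 0, -1], 0),
      (vector [-1, -1, 1, 0], 0),
      (vector [1, 1, 0, 1], 1)]"])
  show "poly_Id4 \<subseteq> (\<Union>js\<in>set ?Cs. cell verts_Id4 (set js))"
  proof
    fix x assume "x \<in> poly_Id4"
    then have x: "0 \<le> x$1" "0 \<le> x$2" "0 \<le> x$3" "0 \<le> x$4"
      "0 \<le> x$1 + x$2 - x$3" "0 \<le> 1 - x$1 - x$2 - x$4"
      by (simp_all add: poly_Id4_def)
    consider (1) "0 \<le> - x$2 + x$3"
      | (2) "0 \<le> x$2 - x$3"
      using x by linarith
    then show "x \<in> (\<Union>js\<in>set ?Cs. cell verts_Id4 (set js))"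
    proof cases
      case 1
      then show ?thesis
        using x by (intro in_cellI[where ws = "[1 - x$1 - x$2 - x$4, x$4, x$1 + x$2 - x$3, - x$2 + x$3,
            x$2]"
          and js = "[0, 1, 2, 3, 5]"])
          (simp_all add: verts_Id4_def vector_simps)
    next
      case 2
      then show ?thesis
        using x by (intro in_cellI[where ws = "[1 - x$1 - x$2 - x$4, x$4, x$1, x$2 - x$3, x$3]"
          and js = "[0, 1, 2, 4, 5]"])
          (simp_all add: verts_Id4_def vector_simps)
    qed
  qed
qed (((auto simp: poly_Id4_def vector_simps)[1],
    (simp add: verts_Id4_def vector_simps upt_conv_Cons eval_nat_numeral),
    (simp add: verts_Id4_def vector_simps),
    (simp add: poly_Id4_def verts_Id4_def vector_simps),
    (auto simp: poly_Id4_def vector_simps)[1],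
    (clarsimp simp: poly_Id4_def verts_Id4_def vector_simps, (elim disjE; simp)),
    (simp add: verts_Id4_def)))

lemma pulling_check_Id4:
  "pulling_check [[0, 1, 4, 5], [0, 1, 2, 3], [0, 1, 2, 4], [0, 2, 3, 4, 5], [0, 1, 3, 5],
       [1, 2, 3, 4, 5]] (length verts_Id4) [2]
    [[0, 1, 2, 3, 5], [0, 1, 2, 4, 5]]
    [[3, 4]]"
  unfolding verts_Id4_def by code_simp

lemma pulling_model_IIf4:
  "pulling_model poly_IIf4 verts_IIf4
    (map set [[0, 3, 4, 5, 6], [0, 1, 2, 5, 6], [0, 1, 2, 3, 4], [0, 1, 3, 5], [0, 2, 4, 6],
       [1, 2, 3, 4, 5, 6]])
    (set ` set [[0, 1, 2, 3, 5], [0, 2, 3, 5, 6], [0, 2, 3, 4, 6]])"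
  (is "pulling_model _ _ _ (_ ` set ?Cs)")
proof (rule pulling_modelI[where hs = "[(vector [-1, 0, 0, 0], 0),
      (vector [0, -1, 0, 0], 0),
      (vector [0, 0, -1, 0], 0),
      (vector [0, 0, 0, -1], 0),
      (vector [-1, -1, -1, 1], 0),
      (vector [1, 1, 1, 0], 1)]"])
  show "poly_IIf4 \<subseteq> (\<Union>js\<in>set ?Cs. cell verts_IIf4 (set js))"
  proof
    fix x assume "x \<in> poly_IIf4"
    then have x: "0 \<le> x$1" "0 \<le> x$2" "0 \<le> x$3" "0 \<le> x$4"
      "0 \<le> x$1 + x$2 + x$3 - x$4" "0 \<le> 1 - x$1 - x$2 - x$3"
      by (simp_all add: poly_IIf4_def)
    consider (1) "0 \<le> x$1 - x$4"
      | (2) "0 \<le> x$1 + x$3 - x$4" "0 \<le> - x$1 + x$4"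
      | (3) "0 \<le> - x$1 - x$3 + x$4"
      using x by linarith
    then show "x \<in> (\<Union>js\<in>set ?Cs. cell verts_IIf4 (set js))"
    proof cases
      case 1
      then show ?thesis
        using x by (intro in_cellI[where ws = "[1 - x$1 - x$2 - x$3, x$1 - x$4, x$4, x$2, x$3]"
          and js = "[0, 1, 2, 3, 5]"])
          (simp_all add: verts_IIf4_def vector_simps)
    next
      case 2
      then show ?thesis
        using x by (intro in_cellI[where ws = "[1 - x$1 - x$2 - x$3, x$1, x$2, x$1 + x$3 - x$4,
            - x$1 + x$4]"
          and js = "[0, 2, 3, 5, 6]"])
          (simp_all add: verts_IIf4_def vector_simps)
    next
      case 3
      then show ?thesis
        using x by (intro in_cellI[where ws = "[1 - x$1 - x$2 - x$3, x$1, x$1 + x$2 + x$3 - x$4,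
            - x$1 - x$3 + x$4, x$3]"
          and js = "[0, 2, 3, 4, 6]"])
          (simp_all add: verts_IIf4_def vector_simps)
    qed
  qed
qed (((auto simp: poly_IIf4_def vector_simps)[1],
    (simp add: verts_IIf4_def vector_simps upt_conv_Cons eval_nat_numeral),
    (simp add: verts_IIf4_def vector_simps),
    (simp add: poly_IIf4_def verts_IIf4_def vector_simps),
    (auto simp: poly_IIf4_def vector_simps)[1],
    (clarsimp simp: poly_IIf4_def verts_IIf4_def vector_simps, (elim disjE; simp)),
    (simp add: verts_IIf4_def)))

lemma pulling_check_IIf4:
  "pulling_check [[0, 3, 4, 5, 6], [0, 1, 2, 5, 6], [0, 1, 2, 3, 4], [0, 1, 3, 5], [0, 2, 4, 6],
       [1, 2, 3, 4, 5, 6]] (length verts_IIf4) [2, 3]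
    [[0, 1, 2, 3, 5], [0, 2, 3, 5, 6], [0, 2, 3, 4, 6]]
    [[1, 4], [1, 6], [4, 5]]"
  unfolding verts_IIf4_def by code_simp

lemma pulling_model_IIId4:
  "pulling_model poly_IIId4 verts_IIId4
    (map set [[0, 1, 5, 6, 7], [0, 1, 2, 3, 4], [0, 1, 2, 5], [0, 2, 3, 5, 6],
       [0, 1, 3, 4, 6, 7], [2, 3, 4, 5, 6, 7], [1, 2, 4, 5, 7]])
    (set ` set [[0, 1, 2, 3, 5], [0, 3, 5, 6, 7], [0, 1, 3, 5, 7], [1, 2, 3, 4, 5],
     [1, 3, 4, 5, 7]])"
  (is "pulling_model _ _ _ (_ ` set ?Cs)")
proof (rule pulling_modelI[where hs = "[(vector [-1, 0, 0, 0], 0),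
      (vector [0, -1, 0, 0], 0),
      (vector [0, 0, -1, 0], 0),
      (vector [0, 0, 0, -1], 0),
      (vector [-1, -1, 1, 0], 0),
      (vector [1, 1, 0, 0], 1),
      (vector [1, 1, -1, 1], 1)]"])
  show "poly_IIId4 \<subseteq> (\<Union>js\<in>set ?Cs. cell verts_IIId4 (set js))"
  proof
    fix x assume "x \<in> poly_IIId4"
    then have x: "0 \<le> x$1" "0 \<le> x$2" "0 \<le> x$3" "0 \<le> x$4"
      "0 \<le> x$1 + x$2 - x$3" "0 \<le> 1 - x$1 - x$2" "0 \<le> 1 - x$1 - x$2 + x$3 - x$4"
      by (simp_all add: poly_IIId4_def)
    consider (1) "0 \<le> 1 - x$1 - x$2 - x$4" "0 \<le> x$1 - x$3"
      | (2) "0 \<le> - x$1 + x$3 - x$4"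
      | (3) "0 \<le> 1 - 2 * x$1 - x$2 + x$3 - x$4" "0 \<le> x$1 - x$3 + x$4"
            "0 \<le> - x$1 + x$3"
      | (4) "0 \<le> x$1 - x$3" "0 \<le> - 1 + x$1 + x$2 + x$4"
      | (5) "0 \<le> - 1 + 2 * x$1 + x$2 - x$3 + x$4" "0 \<le> - x$1 + x$3"
      using x by linarith
    then show "x \<in> (\<Union>js\<in>set ?Cs. cell verts_IIId4 (set js))"
    proof cases
      case 1
      then show ?thesis
        using x by (intro in_cellI[where ws = "[1 - x$1 - x$2 - x$4, x$4, x$1 - x$3, x$3, x$2]"
          and js = "[0, 1, 2, 3, 5]"])
          (simp_all add: verts_IIId4_def vector_simps)
    next
      case 2
      then show ?thesis
        using x by (intro in_cellI[where ws = "[1 - x$1 - x$2, x$1, x$1 + x$2 - x$3, - x$1 + x$3 - x$4,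
            x$4]"
          and js = "[0, 3, 5, 6, 7]"])
          (simp_all add: verts_IIId4_def vector_simps)
    next
      case 3
      then show ?thesis
        using x by (intro in_cellI[where ws = "[1 - 2 * x$1 - x$2 + x$3 - x$4, x$1 - x$3 + x$4, x$1,
            x$1 + x$2 - x$3, - x$1 + x$3]"
          and js = "[0, 1, 3, 5, 7]"])
          (simp_all add: verts_IIId4_def vector_simps)
    next
      case 4
      then show ?thesis
        using x by (intro in_cellI[where ws = "[1 - x$1 - x$2, x$1 - x$3, 1 - x$1 - x$2 + x$3 - x$4,
            - 1 + x$1 + x$2 + x$4, x$2]"
          and js = "[1, 2, 3, 4, 5]"])
          (simp_all add: verts_IIId4_def vector_simps)
    next
      case 5
      then show ?thesis
        using x by (intro in_cellI[where ws = "[1 - x$1 - x$2, 1 - x$1 - x$2 + x$3 - x$4,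
            - 1 + 2 * x$1 + x$2 - x$3 + x$4, x$1 + x$2 - x$3, - x$1 + x$3]"
          and js = "[1, 3, 4, 5, 7]"])
          (simp_all add: verts_IIId4_def vector_simps)
    qed
  qed
qed (((auto simp: poly_IIId4_def vector_simps)[1],
    (simp add: verts_IIId4_def vector_simps upt_conv_Cons eval_nat_numeral),
    (simp add: verts_IIId4_def vector_simps),
    (simp add: poly_IIId4_def verts_IIId4_def vector_simps),
    (auto simp: poly_IIId4_def vector_simps)[1],
    (clarsimp simp: poly_IIId4_def verts_IIId4_def vector_simps, (elim disjE; simp)),
    (simp add: verts_IIId4_def)))

lemma pulling_check_IIId4:
  "pulling_check [[0, 1, 5, 6, 7], [0, 1, 2, 3, 4], [0, 1, 2, 5], [0, 2, 3, 5, 6],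
       [0, 1, 3, 4, 6, 7], [2, 3, 4, 5, 6, 7], [1, 2, 4, 5, 7]] (length verts_IIId4) [3, 0, 4]
    [[0, 1, 2, 3, 5], [0, 3, 5, 6, 7], [0, 1, 3, 5, 7], [1, 2, 3, 4, 5],
     [1, 3, 4, 5, 7]]
    [[0, 4], [1, 6], [2, 6], [2, 7], [4, 6]]"
  unfolding verts_IIId4_def by code_simp

lemma pulling_model_Ia4:
  "pulling_model poly_Ia4 verts_Ia4
    (map set [[0, 5, 6, 7, 8], [0, 1, 2, 3, 4], [0, 1, 3, 5, 7], [0, 1, 2, 5, 6],
       [1, 2, 3, 4, 5, 6, 7, 8], [0, 2, 4, 6, 8], [0, 3, 4, 7, 8]])
    (set ` set [[0, 4, 5, 6, 7], [0, 4, 6, 7, 8], [0, 1, 2, 4, 6], [0, 1, 4, 5, 6],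
     [0, 1, 3, 4, 5], [0, 3, 4, 5, 7]])"
  (is "pulling_model _ _ _ (_ ` set ?Cs)")
proof (rule pulling_modelI[where hs = "[(vector [-1, 0, 0, 0], 0),
      (vector [0, -1, 0, 0], 0),
      (vector [0, 0, -1, 0], 0),
      (vector [0, 0, 0, -1], 0),
      (vector [1, 1, 0, 0], 1),
      (vector [-1, -1, 1, 0], 0),
      (vector [-1, -1, 0, 1], 0)]"])
  show "poly_Ia4 \<subseteq> (\<Union>js\<in>set ?Cs. cell verts_Ia4 (set js))"
  proof
    fix x assume "x \<in> poly_Ia4"
    then have x: "0 \<le> x$1" "0 \<le> x$2" "0 \<le> x$3" "0 \<le> x$4" "0 \<le> 1 - x$1 - x$2"
      "0 \<le> x$1 + x$2 - x$3" "0 \<le> x$1 + x$2 - x$4"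
      by (simp_all add: poly_Ia4_def)
    consider (1) "0 \<le> 2 * x$1 + x$2 - x$3 - x$4" "0 \<le> - x$1 + x$3" "0 \<le> - x$1 + x$4"
      | (2) "0 \<le> - 2 * x$1 - x$2 + x$3 + x$4"
      | (3) "0 \<le> - x$2 + x$3 - x$4"
      | (4) "0 \<le> x$1 - x$4" "0 \<le> x$2 - x$3 + x$4" "0 \<le> x$3 - x$4"
      | (5) "0 \<le> x$1 - x$4" "0 \<le> - x$3 + x$4"
      | (6) "0 \<le> x$1 - x$3" "0 \<le> - x$1 + x$4"
      using x by linarith
    then show "x \<in> (\<Union>js\<in>set ?Cs. cell verts_Ia4 (set js))"
    proof cases
      case 1
      then show ?thesis
        using x by (intro in_cellI[where ws = "[1 - x$1 - x$2, x$1, 2 * x$1 + x$2 - x$3 - x$4,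
            - x$1 + x$3, - x$1 + x$4]"
          and js = "[0, 4, 5, 6, 7]"])
          (simp_all add: verts_Ia4_def vector_simps)
    next
      case 2
      then show ?thesis
        using x by (intro in_cellI[where ws = "[1 - x$1 - x$2, x$1, x$1 + x$2 - x$4, x$1 + x$2 - x$3,
            - 2 * x$1 - x$2 + x$3 + x$4]"
          and js = "[0, 4, 6, 7, 8]"])
          (simp_all add: verts_Ia4_def vector_simps)
    next
      case 3
      then show ?thesis
        using x by (intro in_cellI[where ws = "[1 - x$1 - x$2, x$1 + x$2 - x$3, - x$2 + x$3 - x$4, x$4,
            x$2]"
          and js = "[0, 1, 2, 4, 6]"])
          (simp_all add: verts_Ia4_def vector_simps)
    next
      case 4
      then show ?thesis
        using x by (intro in_cellI[where ws = "[1 - x$1 - x$2, x$1 - x$4, x$4, x$2 - x$3 + x$4,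
            x$3 - x$4]"
          and js = "[0, 1, 4, 5, 6]"])
          (simp_all add: verts_Ia4_def vector_simps)
    next
      case 5
      then show ?thesis
        using x by (intro in_cellI[where ws = "[1 - x$1 - x$2, x$1 - x$4, - x$3 + x$4, x$3, x$2]"
          and js = "[0, 1, 3, 4, 5]"])
          (simp_all add: verts_Ia4_def vector_simps)
    next
      case 6
      then show ?thesis
        using x by (intro in_cellI[where ws = "[1 - x$1 - x$2, x$1 - x$3, x$3, x$1 + x$2 - x$4,
            - x$1 + x$4]"
          and js = "[0, 3, 4, 5, 7]"])
          (simp_all add: verts_Ia4_def vector_simps)
    qed
  qed
qed (((auto simp: poly_Ia4_def vector_simps)[1],
    (simp add: verts_Ia4_def vector_simps upt_conv_Cons eval_nat_numeral),
    (simp add: verts_Ia4_def vector_simps),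
    (simp add: poly_Ia4_def verts_Ia4_def vector_simps),
    (auto simp: poly_Ia4_def vector_simps)[1],
    (clarsimp simp: poly_Ia4_def verts_Ia4_def vector_simps, (elim disjE; simp)),
    (simp add: verts_Ia4_def)))

lemma pulling_check_Ia4:
  "pulling_check [[0, 5, 6, 7, 8], [0, 1, 2, 3, 4], [0, 1, 3, 5, 7], [0, 1, 2, 5, 6],
       [1, 2, 3, 4, 5, 6, 7, 8], [0, 2, 4, 6, 8], [0, 3, 4, 7, 8]] (length verts_Ia4) [4, 6, 5]
    [[0, 4, 5, 6, 7], [0, 4, 6, 7, 8], [0, 1, 2, 4, 6], [0, 1, 4, 5, 6],
     [0, 1, 3, 4, 5], [0, 3, 4, 5, 7]]
    [[1, 7], [1, 8], [2, 3], [2, 5], [2, 7], [2, 8], [3, 6], [3, 8], [5, 8]]"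
  unfolding verts_Ia4_def by code_simp

lemma pulling_model_Vb4:
  "pulling_model poly_Vb4 verts_Vb4
    (map set [[0, 1, 4, 5], [0, 1, 2, 3], [0, 1, 2, 4], [0, 3, 4, 5], [0, 2, 3, 4],
       [1, 2, 3, 5], [0, 1, 3, 5], [2, 3, 4, 5], [1, 2, 4, 5]])
    (set ` set [[0, 2, 3, 4, 5], [0, 1, 2, 3, 5], [0, 1, 2, 4, 5]])"
  (is "pulling_model _ _ _ (_ ` set ?Cs)")
proof (rule pulling_modelI[where hs = "[(vector [-1, 0, 0, 0], 0),
      (vector [0, -1, 0, 0], 0),
      (vector [0, 0, -1, 0], 0),
      (vector [0, 0, 0, -1], 0),
      (vector [1, 0, -1, -1], 0),
      (vector [0, 0, 1, 1], 1),
      (vector [-1, -1, 1, 0], 0),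
      (vector [1, 1, 0, 0], 1),
      (vector [0, 1, 0, 1], 1)]"])
  show "poly_Vb4 \<subseteq> (\<Union>js\<in>set ?Cs. cell verts_Vb4 (set js))"
  proof
    fix x assume "x \<in> poly_Vb4"
    then have x: "0 \<le> x$1" "0 \<le> x$2" "0 \<le> x$3" "0 \<le> x$4"
      "0 \<le> - x$1 + x$3 + x$4" "0 \<le> 1 - x$3 - x$4" "0 \<le> x$1 + x$2 - x$3"
      "0 \<le> 1 - x$1 - x$2" "0 \<le> 1 - x$2 - x$4"
      by (simp_all add: poly_Vb4_def)
    consider (1) "0 \<le> x$1 - x$4" "0 \<le> x$1 + x$2 - x$3 - x$4"
      | (2) "0 \<le> - x$1 - x$2 + x$3 + x$4" "0 \<le> - x$2 + x$3"
      | (3) "0 \<le> - x$1 + x$4" "0 \<le> x$2 - x$3"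
      using x by linarith
    then show "x \<in> (\<Union>js\<in>set ?Cs. cell verts_Vb4 (set js))"
    proof cases
      case 1
      then show ?thesis
        using x by (intro in_cellI[where ws = "[1 - x$1 - x$2, x$4, x$1 - x$4, x$1 + x$2 - x$3 - x$4,
            - x$1 + x$3 + x$4]"
          and js = "[0, 2, 3, 4, 5]"])
          (simp_all add: verts_Vb4_def vector_simps)
    next
      case 2
      then show ?thesis
        using x by (intro in_cellI[where ws = "[1 - x$3 - x$4, - x$1 - x$2 + x$3 + x$4, x$1 + x$2 - x$3,
            - x$2 + x$3, x$2]"
          and js = "[0, 1, 2, 3, 5]"])
          (simp_all add: verts_Vb4_def vector_simps)
    next
      case 3
      then show ?thesis
        using x by (intro in_cellI[where ws = "[1 - x$2 - x$4, - x$1 + x$4, x$1, x$2 - x$3, x$3]"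
          and js = "[0, 1, 2, 4, 5]"])
          (simp_all add: verts_Vb4_def vector_simps)
    qed
  qed
qed (((auto simp: poly_Vb4_def vector_simps)[1],
    (simp add: verts_Vb4_def vector_simps upt_conv_Cons eval_nat_numeral),
    (simp add: verts_Vb4_def vector_simps),
    (simp add: poly_Vb4_def verts_Vb4_def vector_simps),
    (auto simp: poly_Vb4_def vector_simps)[1],
    (clarsimp simp: poly_Vb4_def verts_Vb4_def vector_simps, (elim disjE; simp)),
    (simp add: verts_Vb4_def)))

lemma pulling_check_Vb4:
  "pulling_check [[0, 1, 4, 5], [0, 1, 2, 3], [0, 1, 2, 4], [0, 3, 4, 5], [0, 2, 3, 4],
       [1, 2, 3, 5], [0, 1, 3, 5], [2, 3, 4, 5], [1, 2, 4, 5]] (length verts_Vb4) [0]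
    [[0, 2, 3, 4, 5], [0, 1, 2, 3, 5], [0, 1, 2, 4, 5]]
    [[1, 3, 4]]"
  unfolding verts_Vb4_def by code_simp

definition prism3 :: "(real^3) set" where
  "prism3 = {p. 0 \<le> p$1 \<and> p$1 \<le> 1 \<and> 0 \<le> p$2 \<and> 0 \<le> p$3 \<and> p$2 + p$3 \<le> 1}"

definition verts_prism3 :: "(real^3) list" where
  "verts_prism3 = [vector [0, 0, 0], vector [0, 1, 0], vector [0, 0, 1], vector [1, 0, 0],
     vector [1, 1, 0], vector [1, 0, 1]]"

lemma pulling_model_prism:
  "pulling_model prism3 verts_prism3
    (map set [[0, 1, 2], [0, 2, 3, 5], [0, 1, 3, 4], [1, 2, 4, 5], [3, 4, 5]])
    (set ` set [[0, 1, 2, 4], [0, 2, 4, 5], [0, 3, 4, 5]])"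
  (is "pulling_model _ _ _ (_ ` set ?Cs)")
proof (rule pulling_modelI[where hs = "[(vector [-1, 0, 0], 0),
      (vector [0, -1, 0], 0),
      (vector [0, 0, -1], 0),
      (vector [0, 1, 1], 1),
      (vector [1, 0, 0], 1)]"])
  show "prism3 \<subseteq> (\<Union>js\<in>set ?Cs. cell verts_prism3 (set js))"
  proof
    fix x assume "x \<in> prism3"
    then have x: "0 \<le> x$1" "0 \<le> x$2" "0 \<le> x$3" "0 \<le> 1 - x$2 - x$3"
      "0 \<le> 1 - x$1"
      by (simp_all add: prism3_def)
    consider (1) "0 \<le> - x$1 + x$2"
      | (2) "0 \<le> - x$1 + x$2 + x$3" "0 \<le> x$1 - x$2"
      | (3) "0 \<le> x$1 - x$2 - x$3"
      using x by linarith
    then show "x \<in> (\<Union>js\<in>set ?Cs. cell verts_prism3 (set js))"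
    proof cases
      case 1
      then show ?thesis
        using x by (intro in_cellI[where ws = "[1 - x$2 - x$3, - x$1 + x$2, x$3, x$1]"
          and js = "[0, 1, 2, 4]"])
          (simp_all add: verts_prism3_def vector_simps)
    next
      case 2
      then show ?thesis
        using x by (intro in_cellI[where ws = "[1 - x$2 - x$3, - x$1 + x$2 + x$3, x$2, x$1 - x$2]"
          and js = "[0, 2, 4, 5]"])
          (simp_all add: verts_prism3_def vector_simps)
    next
      case 3
      then show ?thesis
        using x by (intro in_cellI[where ws = "[1 - x$1, x$1 - x$2 - x$3, x$2, x$3]"
          and js = "[0, 3, 4, 5]"])
          (simp_all add: verts_prism3_def vector_simps)
    qed
  qed
qed (((auto simp: prism3_def vector_simps)[1],
    (simp add: verts_prism3_def vector_simps upt_conv_Cons eval_nat_numeral),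
    (simp add: verts_prism3_def vector_simps),
    (simp add: prism3_def verts_prism3_def vector_simps),
    (auto simp: prism3_def vector_simps)[1],
    (clarsimp simp: prism3_def verts_prism3_def vector_simps, (elim disjE; simp)),
    (simp add: verts_prism3_def)))

lemma pulling_check_prism:
  "pulling_check [[0, 1, 2], [0, 2, 3, 5], [0, 1, 3, 4], [1, 2, 4, 5], [3, 4, 5]] (length verts_prism3) [0, 4]
    [[0, 1, 2, 4], [0, 2, 4, 5], [0, 3, 4, 5]]
    [[1, 3], [1, 5], [2, 3]]"
  unfolding verts_prism3_def by code_simp

definition cube3 :: "(real^3) set" where
  "cube3 = {p. 0 \<le> p$1 \<and> p$1 \<le> 1 \<and> 0 \<le> p$2 \<and> p$2 \<le> 1 \<and> 0 \<le> p$3 \<and> p$3 \<le> 1}"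

definition verts_cube3 :: "(real^3) list" where
  "verts_cube3 = [vector [0, 0, 0], vector [1, 0, 0], vector [0, 1, 0], vector [0, 0, 1],
     vector [1, 1, 0], vector [1, 0, 1], vector [0, 1, 1], vector [1, 1, 1]]"

lemma pulling_model_cube:
  "pulling_model cube3 verts_cube3
    (map set [[0, 2, 3, 6], [0, 1, 3, 5], [0, 1, 2, 4], [1, 4, 5, 7], [2, 4, 6, 7],
       [3, 5, 6, 7]])
    (set ` set [[0, 1, 4, 7], [0, 1, 5, 7], [0, 2, 4, 7], [0, 2, 6, 7], [0, 3, 5, 7],
     [0, 3, 6, 7]])"
  (is "pulling_model _ _ _ (_ ` set ?Cs)")
proof (rule pulling_modelI[where hs = "[(vector [-1, 0, 0], 0),
      (vector [0, -1, 0], 0),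
      (vector [0, 0, -1], 0),
      (vector [1, 0, 0], 1),
      (vector [0, 1, 0], 1),
      (vector [0, 0, 1], 1)]"])
  show "cube3 \<subseteq> (\<Union>js\<in>set ?Cs. cell verts_cube3 (set js))"
  proof
    fix x assume "x \<in> cube3"
    then have x: "0 \<le> x$1" "0 \<le> x$2" "0 \<le> x$3" "0 \<le> 1 - x$1" "0 \<le> 1 - x$2"
      "0 \<le> 1 - x$3"
      by (simp_all add: cube3_def)
    consider (1) "0 \<le> x$1 - x$2" "0 \<le> x$2 - x$3"
      | (2) "0 \<le> x$1 - x$3" "0 \<le> - x$2 + x$3"
      | (3) "0 \<le> - x$1 + x$2" "0 \<le> x$1 - x$3"
      | (4) "0 \<le> x$2 - x$3" "0 \<le> - x$1 + x$3"
      | (5) "0 \<le> - x$1 + x$3" "0 \<le> x$1 - x$2"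
      | (6) "0 \<le> - x$2 + x$3" "0 \<le> - x$1 + x$2"
      using x by linarith
    then show "x \<in> (\<Union>js\<in>set ?Cs. cell verts_cube3 (set js))"
    proof cases
      case 1
      then show ?thesis
        using x by (intro in_cellI[where ws = "[1 - x$1, x$1 - x$2, x$2 - x$3, x$3]"
          and js = "[0, 1, 4, 7]"])
          (simp_all add: verts_cube3_def vector_simps)
    next
      case 2
      then show ?thesis
        using x by (intro in_cellI[where ws = "[1 - x$1, x$1 - x$3, - x$2 + x$3, x$2]"
          and js = "[0, 1, 5, 7]"])
          (simp_all add: verts_cube3_def vector_simps)
    next
      case 3
      then show ?thesis
        using x by (intro in_cellI[where ws = "[1 - x$2, - x$1 + x$2, x$1 - x$3, x$3]"
          and js = "[0, 2, 4, 7]"])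
          (simp_all add: verts_cube3_def vector_simps)
    next
      case 4
      then show ?thesis
        using x by (intro in_cellI[where ws = "[1 - x$2, x$2 - x$3, - x$1 + x$3, x$1]"
          and js = "[0, 2, 6, 7]"])
          (simp_all add: verts_cube3_def vector_simps)
    next
      case 5
      then show ?thesis
        using x by (intro in_cellI[where ws = "[1 - x$3, - x$1 + x$3, x$1 - x$2, x$2]"
          and js = "[0, 3, 5, 7]"])
          (simp_all add: verts_cube3_def vector_simps)
    next
      case 6
      then show ?thesis
        using x by (intro in_cellI[where ws = "[1 - x$3, - x$2 + x$3, - x$1 + x$2, x$1]"
          and js = "[0, 3, 6, 7]"])
          (simp_all add: verts_cube3_def vector_simps)
    qed
  qed
qed (((auto simp: cube3_def vector_simps)[1],
    (simp add: verts_cube3_def vector_simps upt_conv_Cons eval_nat_numeral),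
    (simp add: verts_cube3_def vector_simps),
    (simp add: cube3_def verts_cube3_def vector_simps),
    (auto simp: cube3_def vector_simps)[1],
    (clarsimp simp: cube3_def verts_cube3_def vector_simps, (elim disjE; simp)),
    (simp add: verts_cube3_def)))

lemma pulling_check_cube:
  "pulling_check [[0, 2, 3, 6], [0, 1, 3, 5], [0, 1, 2, 4], [1, 4, 5, 7], [2, 4, 6, 7],
       [3, 5, 6, 7]] (length verts_cube3) [0, 7]
    [[0, 1, 4, 7], [0, 1, 5, 7], [0, 2, 4, 7], [0, 2, 6, 7], [0, 3, 5, 7],
     [0, 3, 6, 7]]
    [[1, 2], [1, 3], [1, 6], [2, 3], [2, 5], [3, 4], [4, 5], [4, 6], [5, 6]]"
  unfolding verts_cube3_def by code_simp

section \<open>Affine images\<close>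

definition affine_injection :: "(real^'m \<Rightarrow> real^'n) \<Rightarrow> bool" where
  "affine_injection g \<longleftrightarrow> (\<exists>c h. linear h \<and> inj h \<and> g = (\<lambda>x. c + h x))"

lemma affine_injectionE:
  assumes "affine_injection g"
  obtains c h where "linear h" "inj h" "g = (\<lambda>x. c + h x)" "\<And>S. g ` S = (+) c ` h ` S"
  using assms unfolding affine_injection_def by (auto simp: image_image)

lemma inj_affine_injection: "affine_injection g \<Longrightarrow> inj g"
  by (auto simp: affine_injection_def inj_def)

lemma affine_injection_affine:
  assumes "affine_injection g" "s + t = 1"
  shows "g (s *\<^sub>R x + t *\<^sub>R y) = s *\<^sub>R g x + t *\<^sub>R g y"
proof -
  obtain c h where h: "linear h" "g = (\<lambda>x. c + h x)"
    using assms(1) by (rule affine_injectionE)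
  have "c = (s + t) *\<^sub>R c" using assms(2) by simp
  then show ?thesis
    unfolding h(2) using linear_add[OF h(1)] linear_scale[OF h(1)] by (simp add: algebra_simps)
qed

text \<open>An affine map is a linear map up to translation. Additivity is obtained from the midpoint of two
points, homogeneity from the line through a point and the origin.\<close>

lemma affine_injectionI:
  fixes g :: "real^'m \<Rightarrow> real^'n"
  assumes aff: "\<And>x y s t. s + t = 1 \<Longrightarrow> g (s *\<^sub>R x + t *\<^sub>R y) = s *\<^sub>R g x + t *\<^sub>R g y" and "inj g"
  shows "affine_injection g"
  unfolding affine_injection_def
proof (intro exI conjI)
  define h where "h = (\<lambda>x. g x - g 0)"
  show "g = (\<lambda>x. g 0 + h x)" by (simp add: h_def)
  have scale: "h (r *\<^sub>R x) = r *\<^sub>R h x" for r x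
    using aff[of r "1 - r" x 0] by (simp add: h_def algebra_simps)
  show "linear h"
  proof (rule linearI)
    fix x y
    \<comment> \<open>Affinity applies to the midpoint; homogeneity removes the factor.\<close>
    have "h ((1/2) *\<^sub>R (x + y)) = (1/2) *\<^sub>R (h x + h y)"
      using aff[of "1/2" "1/2" x y] by (simp add: h_def algebra_simps flip: scaleR_2 scaleR_half_double)
    then show "h (x + y) = h x + h y" unfolding scale by simp
  qed (rule scale)
  show "inj h" using assms(2) by (simp add: h_def inj_def)
qed

lemma affine_injection_comp:
  assumes "affine_injection g" "affine_injection f"
  shows "affine_injection (g \<circ> f)"
  using affine_injection_affine[OF assms(1)] affine_injection_affine[OF assms(2)]
    inj_affine_injection[OF assms(1)] inj_affine_injection[OF assms(2)]
  by (intro affine_injectionI inj_compose) auto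

lemma convex_hull_affine_injection:
  assumes "affine_injection g"
  shows "g ` (convex hull S) = convex hull (g ` S)"
proof -
  obtain c h where h: "linear h" "\<And>S. g ` S = (+) c ` h ` S"
    using assms by (rule affine_injectionE) (rule that)
  show ?thesis unfolding h(2) by (simp add: convex_hull_linear_image[OF h(1)] convex_hull_translation)
qed

lemma affine_hull_affine_injection:
  assumes "affine_injection g"
  shows "g ` (affine hull S) = affine hull (g ` S)"
proof -
  obtain c h where h: "linear h" "\<And>S. g ` S = (+) c ` h ` S"
    using assms by (rule affine_injectionE) (rule that)
  show ?thesis
    unfolding h(2) using h(1)
    by (simp add: affine_hull_linear_image linear_conv_bounded_linear affine_hull_translation)
qed

lemma aff_dim_affine_injection:
  assumes "affine_injection g"
  shows "aff_dim (g ` S) = aff_dim S"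
proof -
  obtain c h where h: "linear h" "inj h" "\<And>S. g ` S = (+) c ` h ` S"
    using assms by (rule affine_injectionE) (rule that)
  show ?thesis unfolding h(3) using h(1,2) by (simp add: aff_dim_translation_eq)
qed

lemma faces_affine_injection:
  assumes "affine_injection g"
  shows "{F. F face_of g ` P} = (`) g ` {F. F face_of P}"
proof -
  obtain c h where h: "linear h" "inj h" "\<And>S. g ` S = (+) c ` h ` S"
    using assms by (rule affine_injectionE) (rule that)
  have "{F. F face_of g ` P} = (`) ((+) c) ` (`) h ` {F. F face_of P}"
    unfolding h(3) faces_of_translation faces_of_linear_image[OF h(1,2)] by (rule refl)
  also have "\<dots> = (`) g ` {F. F face_of P}"
    unfolding image_image[of "(`) ((+) c)" "(`) h"] by (intro image_cong refl h(3)[symmetric])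
  finally show ?thesis .
qed

text \<open>An affine injection carries faces to faces and hulls to hulls; only the lattice points have to be
assumed to correspond.\<close>

lemma pulling_model_image:
  assumes M: "pulling_model P v Zs Cs" and g: "affine_injection g"
    and lat: "lattice_points (g ` P) = g ` lattice_points P"
  shows "pulling_model (g ` P) (map g v) Zs Cs"
proof -
  have cell: "cell (map g v) I = g ` cell v I" if "I \<subseteq> {..<length v}" for I
  proof -
    have "(!) (map g v) ` I = g ` (!) v ` I" using that by (auto simp: image_image intro!: image_cong)
    then show ?thesis by (simp add: convex_hull_affine_injection[OF g])
  qed
  note MD = pulling_modelD[OF M]
  have "{F. F face_of g ` P} = (`) g ` cell v ` facial Zs {..<length v}"
    unfolding faces_affine_injection[OF g] MD(4) by (rule refl)
  also have "\<dots> = cell (map g v) ` facial Zs {..<length v}"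
    unfolding image_image using facial_subset_Pow[of Zs "{..<length v}"] cell by (intro image_cong) auto
  finally have faces: "{F. F face_of g ` P} = cell (map g v) ` facial Zs {..<length (map g v)}"
    by (simp only: length_map)
  have "g ` P \<subseteq> g ` (\<Union>I\<in>Cs. cell v I)" using MD(6) by (rule image_mono)
  also have "\<dots> = (\<Union>I\<in>Cs. g ` cell v I)" by (rule image_UN)
  also have "\<dots> = (\<Union>I\<in>Cs. cell (map g v) I)"
  proof (rule SUP_cong[OF refl])
    fix I assume "I \<in> Cs"
    then show "g ` cell v I = cell (map g v) I" using cell[of I] MD(5) by blast
  qed
  finally have cover: "g ` P \<subseteq> (\<Union>I\<in>Cs. cell (map g v) I)" .
  have "distinct (map g v)"
    using MD(2) inj_affine_injection[OF g] by (simp add: distinct_map inj_on_def)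
  moreover have "g ` P = convex hull set (map g v)"
    unfolding set_map convex_hull_affine_injection[OF g, symmetric] using MD(3) by (rule arg_cong)
  moreover have "lattice_points (g ` P) = set (map g v)" "\<Union>Cs \<subseteq> {..<length (map g v)}"
    using MD(1,5) by (simp_all add: lat)
  ultimately show ?thesis unfolding pulling_model_def using faces cover by (intro conjI)
qed

text \<open>A lattice equivalence is given on the affine span of \<open>P\<close> only. Its inverse is defined on the whole
space, because \<open>Q\<close> is full-dimensional, and is therefore an affine injection.\<close>

lemma lattice_equiv_imp_affine_injection:
  fixes P :: "(real^'n) set" and Q :: "(real^'m) set"
  assumes eq: "lattice_equiv P Q" and full: "affine hull Q = UNIV"
  obtains g :: "real^'m \<Rightarrow> real^'n" where "affine_injection g" "P = g ` Q"
    "lattice_points P = g ` lattice_points Q"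
proof -
  obtain f where bij: "bij_betw f (affine hull P) UNIV"
    and aff: "\<And>x y s t. x \<in> affine hull P \<Longrightarrow> y \<in> affine hull P \<Longrightarrow> s + t = 1 \<Longrightarrow>
      f (s *\<^sub>R x + t *\<^sub>R y) = s *\<^sub>R f x + t *\<^sub>R f y"
    and lat: "f ` lattice_points (affine hull P) = int_lattice" and im: "f ` P = Q"
    using eq unfolding lattice_equiv_def full lattice_points_def by auto
  define g where "g = inv_into (affine hull P) f"
  have g_in: "g y \<in> affine hull P" and fg: "f (g y) = y" for y
    using bij unfolding g_def bij_betw_def by (auto intro: inv_into_into f_inv_into_f)
  have gf: "g (f x) = x" if "x \<in> affine hull P" for x
    using bij that unfolding g_def bij_betw_def by auto
  have PA: "P \<subseteq> affine hull P" by (rule hull_subset)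
  have "affine_injection g"
  proof (rule affine_injectionI)
    fix x y :: "real^'m" and s t :: real assume st: "s + t = 1"
    then have mem: "s *\<^sub>R g x + t *\<^sub>R g y \<in> affine hull P"
      using affine_affine_hull[of P] g_in unfolding affine_def by blast
    show "g (s *\<^sub>R x + t *\<^sub>R y) = s *\<^sub>R g x + t *\<^sub>R g y"
      using gf[OF mem] aff[OF g_in g_in st, of x y] fg by simp
  qed (metis fg injI)
  moreover have "P = g ` Q"
    unfolding im[symmetric] image_image using gf PA by force
  moreover have "lattice_points P = g ` lattice_points Q"
  proof (intro equalityI subsetI)
    fix x assume x: "x \<in> lattice_points P"
    then have "x \<in> lattice_points (affine hull P)" "x \<in> P"
      using PA by (auto simp: lattice_points_def)
    then have "f x \<in> lattice_points Q" "g (f x) = x"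
      using lat im gf PA by (auto simp: lattice_points_def)
    then show "x \<in> g ` lattice_points Q" by force
  next
    fix x assume "x \<in> g ` lattice_points Q"
    then obtain y where y: "y \<in> Q" "y \<in> int_lattice" "x = g y" by (auto simp: lattice_points_def)
    then obtain z where "z \<in> lattice_points (affine hull P)" "y = f z" using lat by blast
    then have "x \<in> int_lattice" using gf[of z] y by (auto simp: lattice_points_def)
    moreover have "x \<in> P" using \<open>P = g ` Q\<close> y by blast
    ultimately show "x \<in> lattice_points P" by (simp add: lattice_points_def)
  qed
  ultimately show ?thesis using that by blast
qed

section \<open>Compressed three-dimensional polytopes\<close>

text \<open>The two parallel lattice hyperplanes next to each other become the levels \<open>b\<close> and \<open>b + 1\<close> after
rescaling. Lattice points of \<open>P\<close> lie between them, hence on one of them.\<close>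

lemma compressed_facet_functional:
  fixes P :: "(real^'n) set"
  assumes "compressed P" "F facet_of P"
  obtains a b where "affine hull F = affine hull P \<inter> {x. a \<bullet> x = b}" "F = {x \<in> P. a \<bullet> x = b}"
    "\<And>x. x \<in> lattice_points P \<Longrightarrow> a \<bullet> x = b \<or> a \<bullet> x = b + 1"
proof -
  obtain a b c where aff: "affine hull F = affine hull P \<inter> {x. a \<bullet> x = b}" and "b < c"
    and gap: "\<not> (\<exists>x\<in>lattice_points (affine hull P). b < a \<bullet> x \<and> a \<bullet> x < c)"
    and le: "P \<subseteq> {x. b \<le> a \<bullet> x \<and> a \<bullet> x \<le> c}"
    using assms unfolding compressed_def by blast
  have "convex P" using assms(1) unfolding compressed_def lattice_polytope_def by auto
  have F: "F = {x \<in> P. a \<bullet> x = b}"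
    using face_of_imp_eq_affine_Int[OF \<open>convex P\<close> facet_of_imp_face_of[OF assms(2)]] aff
      hull_subset[of P affine] by blast
  have two: "a \<bullet> x = b \<or> a \<bullet> x = c" if "x \<in> lattice_points P" for x
    using gap le that hull_subset[of P affine] unfolding lattice_points_def by force
  \<comment> \<open>rescaled so that the two levels differ by 1\<close>
  define a' b' where "a' = a /\<^sub>R (c - b)" and "b' = b / (c - b)"
  have iff: "a' \<bullet> x = b' \<longleftrightarrow> a \<bullet> x = b" "a' \<bullet> x = b' + 1 \<longleftrightarrow> a \<bullet> x = c" for x
    using \<open>b < c\<close> by (auto simp: a'_def b'_def field_simps)
  show ?thesis
    by (rule that[of a' b']) (use aff F two iff in auto)
qed

text \<open>A face is spanned by the generating points that it contains.\<close>

lemma face_vertex_outside: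
  fixes S :: "'a::euclidean_space set"
  assumes "finite S" "G face_of convex hull S" "convex K" "\<not> G \<subseteq> K"
  obtains s where "s \<in> S" "s \<in> G" "s \<notin> K"
proof -
  obtain S' where S': "S' \<subseteq> S" "G = convex hull S'"
    using assms(1,2) face_of_convex_hull_subset finite_imp_compact by blast
  then have "\<not> S' \<subseteq> K" using assms(3,4) hull_minimal by blast
  then show ?thesis using that S' hull_subset[of S' convex] by blast
qed

text \<open>A proper face is the intersection of the facets containing it.\<close>

lemma separating_facet:
  fixes P :: "'a::euclidean_space set"
  assumes "polytope P" "G face_of P" "G \<noteq> {}" "X \<subseteq> P" "\<not> X \<subseteq> G"
  obtains F where "F facet_of P" "G \<subseteq> F" "\<not> X \<subseteq> F"
proof -
  have "G = \<Inter>{F. F facet_of P \<and> G \<subseteq> F}"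
    using assms by (intro face_of_polyhedron polytope_imp_polyhedron) auto
  then show ?thesis using that assms(5) by blast
qed

text \<open>Descend from \<open>P\<close> to a facet \<open>F1\<close>, an edge \<open>E\<close> of it and a vertex \<open>v\<close> of that edge, and choose facets
\<open>F2\<close> through \<open>E\<close> and \<open>F3\<close> through \<open>v\<close> that do not contain the next larger face. The points \<open>e\<close>, \<open>f\<close>, \<open>p\<close>
show that \<open>F1\<close>, \<open>F2\<close>, \<open>F3\<close> are independent: in terms of the three facet functionals, the points \<open>v\<close>,
\<open>e\<close>, \<open>f\<close>, \<open>p\<close> form a triangular array.\<close>

lemma facet_flag:
  fixes S :: "'a::euclidean_space set"
  assumes S: "finite S" "P = convex hull S" and dim: "aff_dim P = 3"
  obtains F1 F2 F3 v e f p where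
    "F1 facet_of P" "F2 facet_of P" "F3 facet_of P"
    "{v, e, f, p} \<subseteq> S" "v \<in> F1" "v \<in> F2" "v \<in> F3"
    "e \<in> F1" "e \<in> F2" "e \<notin> F3" "f \<in> F1" "f \<notin> F2" "p \<notin> F1"
proof -
  have P: "polytope P" unfolding S(2) using S(1) by (rule polytope_convex_hull)
  have facet_exists: "\<exists>F. F facet_of Q \<and> polytope Q \<and> F \<noteq> Q" if "Q face_of P" "aff_dim Q > 0" for Q
    using polytope_facet_exists[of Q] face_of_polytope_polytope[OF P that(1)] that(2)
    by (metis facet_of_irrefl)
  obtain F1 where F1: "F1 facet_of P"
    using polytope_facet_exists[OF P] dim by auto
  then have F1': "F1 face_of P" "aff_dim F1 = 2" using dim by (auto simp: facet_of_def)
  then obtain E where E: "E facet_of F1" using facet_exists[of F1] by auto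
  then have E': "E face_of F1" "aff_dim E = 1" "E \<noteq> {}" using F1' by (auto simp: facet_of_def)
  then have EP: "E face_of P" using F1' face_of_trans by blast
  then obtain V where V: "V facet_of E" using facet_exists[of E] E' by auto
  then have V': "V face_of E" "aff_dim V = 0" "V \<noteq> {}" using E' by (auto simp: facet_of_def)
  then have VP: "V face_of P" using EP face_of_trans by blast
  obtain v where v: "V = {v}" using V'(2) aff_dim_eq_0 by blast
  have "\<not> F1 \<subseteq> E" using E'(2) F1'(2) aff_dim_subset[of F1 E] by auto
  then obtain F2 where F2: "F2 facet_of P" "E \<subseteq> F2" "\<not> F1 \<subseteq> F2"
    using separating_facet[OF P EP E'(3), of F1] face_of_imp_subset[OF F1'(1)] by blast
  have "\<not> E \<subseteq> V" using E'(2) V'(2) aff_dim_subset[of E V] by auto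
  then obtain F3 where F3: "F3 facet_of P" "V \<subseteq> F3" "\<not> E \<subseteq> F3"
    using separating_facet[OF P VP V'(3), of E] face_of_imp_subset[OF EP] by blast
  have conv: "convex F" if "F facet_of P" for F
    using that facet_of_imp_face_of face_of_imp_convex by blast
  obtain e where e: "e \<in> S" "e \<in> E" "e \<notin> F3"
    using face_vertex_outside[OF S(1) EP[unfolded S(2)] conv[OF F3(1)] F3(3)] by blast
  obtain f where f: "f \<in> S" "f \<in> F1" "f \<notin> F2"
    using face_vertex_outside[OF S(1) F1'(1)[unfolded S(2)] conv[OF F2(1)] F2(3)] by blast
  have "\<not> P \<subseteq> F1" using F1'(2) dim aff_dim_subset[of P F1] by auto
  then obtain p where p: "p \<in> S" "p \<notin> F1"
    using face_vertex_outside[OF S(1) face_of_refl[OF convex_convex_hull] conv[OF F1]] unfolding S(2) by blast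
  have "v \<in> S" using VP v unfolding S(2) by (simp add: face_of_singleton extreme_point_of_convex_hull)
  show ?thesis
    by (rule that[OF F1 F2(1) F3(1), of v e f p])
      (use e f p \<open>v \<in> S\<close> v F2(2) F3(2) face_of_imp_subset[OF E'(1)] face_of_imp_subset[OF V'(1)] in auto)
qed

text \<open>The functionals of the three facets in \<open>facet_flag\<close> are coordinates on the affine span of \<open>P\<close>, and
\<open>g\<close> is the inverse of the coordinate map. Each facet has dimension two and so contains at
least three lattice points, which gives the lower bound on the number of points in each coordinate plane.\<close>

lemma compressed_coordinates:
  fixes P :: "(real^'n) set"
  assumes P: "compressed P" and dim: "aff_dim P = 3"
  obtains g :: "real^3 \<Rightarrow> real^'n" and S :: "(real^3) set" where
    "affine_injection g" "range g = affine hull P" "lattice_points P = g ` S" "P = g ` (convex hull S)"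
    "\<And>s i. s \<in> S \<Longrightarrow> s $ i = 0 \<or> s $ i = 1" "0 \<in> S" "vector [0, 0, 1] \<in> S"
    "\<And>i. 3 \<le> card {s \<in> S. s $ i = 0}"
proof -
  obtain S0 where S0: "finite S0" "S0 \<subseteq> int_lattice" "P = convex hull S0"
    using P unfolding compressed_def lattice_polytope_def by blast
  then have S0_lat: "S0 \<subseteq> lattice_points P"
    by (auto simp: lattice_points_def hull_inc)
  have PL: "P = convex hull (lattice_points P)"
  proof
    show "P \<subseteq> convex hull (lattice_points P)"
      using S0_lat hull_mono[of S0 "lattice_points P" convex] S0(3) by simp
    show "convex hull (lattice_points P) \<subseteq> P"
      by (rule hull_minimal) (auto simp: lattice_points_def S0(3))
  qed
  obtain F1 F2 F3 v e f p where
    F: "F1 facet_of P" "F2 facet_of P" "F3 facet_of P" and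
    S: "{v, e, f, p} \<subseteq> S0" and "v \<in> F1" "v \<in> F2" "v \<in> F3"
    "e \<in> F1" "e \<in> F2" "e \<notin> F3" "f \<in> F1" "f \<notin> F2" "p \<notin> F1"
    by (rule facet_flag[OF S0(1,3) dim])
  obtain a1 b1 where F1: "F1 = {x \<in> P. a1 \<bullet> x = b1}"
    "\<And>x. x \<in> lattice_points P \<Longrightarrow> a1 \<bullet> x = b1 \<or> a1 \<bullet> x = b1 + 1"
    using compressed_facet_functional[OF P F(1)] by metis
  obtain a2 b2 where F2: "F2 = {x \<in> P. a2 \<bullet> x = b2}"
    "\<And>x. x \<in> lattice_points P \<Longrightarrow> a2 \<bullet> x = b2 \<or> a2 \<bullet> x = b2 + 1"
    using compressed_facet_functional[OF P F(2)] by metis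
  obtain a3 b3 where F3: "F3 = {x \<in> P. a3 \<bullet> x = b3}"
    "\<And>x. x \<in> lattice_points P \<Longrightarrow> a3 \<bullet> x = b3 \<or> a3 \<bullet> x = b3 + 1"
    using compressed_facet_functional[OF P F(3)] by metis
  have L: "v \<in> lattice_points P" "e \<in> lattice_points P" "f \<in> lattice_points P" "p \<in> lattice_points P"
    using S S0_lat by auto
  then have inP: "v \<in> P" "e \<in> P" "f \<in> P" "p \<in> P" by (auto simp: lattice_points_def)
  have val: "a1 \<bullet> v = b1" "a2 \<bullet> v = b2" "a3 \<bullet> v = b3" "a1 \<bullet> e = b1" "a2 \<bullet> e = b2" "a3 \<bullet> e = b3 + 1"
    "a1 \<bullet> f = b1" "a2 \<bullet> f = b2 + 1" "a1 \<bullet> p = b1 + 1"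
    using \<open>v \<in> F1\<close> \<open>v \<in> F2\<close> \<open>v \<in> F3\<close> \<open>e \<in> F1\<close> \<open>e \<in> F2\<close> \<open>e \<notin> F3\<close> \<open>f \<in> F1\<close> \<open>f \<notin> F2\<close> \<open>p \<notin> F1\<close>
      F1(2)[OF L(4)] F2(2)[OF L(3)] F3(2)[OF L(2)] inP unfolding F1(1) F2(1) F3(1) by auto
  \<comment> \<open>Eliminating the triangular array turns the edge vectors into a basis dual to the functionals.\<close>
  define e' f' p' where "e' = e - v" and "f' = (f - v) - (a3 \<bullet> f - b3) *\<^sub>R e'"
    and "p' = (p - v) - (a2 \<bullet> p - b2) *\<^sub>R f' - (a3 \<bullet> p - b3) *\<^sub>R e'"
  have dual: "a1 \<bullet> e' = 0" "a2 \<bullet> e' = 0" "a3 \<bullet> e' = 1" "a1 \<bullet> f' = 0" "a2 \<bullet> f' = 1" "a3 \<bullet> f' = 0"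
    "a1 \<bullet> p' = 1" "a2 \<bullet> p' = 0" "a3 \<bullet> p' = 0"
    unfolding p'_def f'_def e'_def by (simp_all add: inner_diff_right val)
  define h where "h = (\<lambda>y :: real^3. y $ 1 *\<^sub>R p' + y $ 2 *\<^sub>R f' + y $ 3 *\<^sub>R e')"
  define g where "g = (\<lambda>y. v + h y)"
  have h: "a1 \<bullet> h y = y $ 1" "a2 \<bullet> h y = y $ 2" "a3 \<bullet> h y = y $ 3" for y
    unfolding h_def by (simp_all add: inner_add_right dual)
  then have coord: "a1 \<bullet> g y = b1 + y $ 1" "a2 \<bullet> g y = b2 + y $ 2" "a3 \<bullet> g y = b3 + y $ 3" for y
    unfolding g_def by (simp_all add: inner_add_right val)
  have lin: "linear h"
    by (rule linearI) (simp_all add: h_def algebra_simps)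
  have "inj h"
  proof (rule injI)
    fix x y assume eq: "h x = h y"
    show "x = y" unfolding vec_eq_iff forall_3 using h[of x, unfolded eq] h[of y] by simp
  qed
  then have g: "affine_injection g" using lin unfolding affine_injection_def g_def by blast
  have hullP: "v \<in> affine hull P" "e \<in> affine hull P" "f \<in> affine hull P" "p \<in> affine hull P"
    using inP by (auto intro: hull_inc)
  define W where "W = (\<lambda>x. x - v) ` (affine hull P)"
  have W: "subspace W"
    unfolding W_def by (rule affine_diffs_subspace_subtract[OF affine_affine_hull hullP(1)])
  have "e - v \<in> W" "f - v \<in> W" "p - v \<in> W" unfolding W_def using hullP by auto
  then have e'W: "e' \<in> W" and f'W: "f' \<in> W"
    unfolding f'_def e'_def by (auto intro: subspace_diff[OF W] subspace_scale[OF W])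
  then have "p' \<in> W"
    unfolding p'_def using \<open>p - v \<in> W\<close> by (auto intro: subspace_diff[OF W] subspace_scale[OF W])
  then have hW: "h y \<in> W" for y
    unfolding h_def using e'W f'W by (intro subspace_add[OF W] subspace_scale[OF W])
  have "range g \<subseteq> affine hull P"
  proof
    fix x assume "x \<in> range g"
    then obtain y where "x = v + h y" unfolding g_def by blast
    moreover obtain z where "z \<in> affine hull P" "h y = z - v" using hW[of y] unfolding W_def by blast
    ultimately show "x \<in> affine hull P" by simp
  qed
  moreover have "affine (range g)"
    using affine_hull_affine_injection[OF g, of UNIV] by (metis affine_affine_hull hull_UNIV)
  moreover have "aff_dim (range g) = aff_dim (affine hull P)"
    unfolding aff_dim_affine_injection[OF g] aff_dim_affine_hull dim by simp
  ultimately have rng: "range g = affine hull P"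
    by (intro affine_dim_equal) auto
  define S where "S = {s. g s \<in> lattice_points P}"
  have lat: "lattice_points P = g ` S"
  proof
    show "lattice_points P \<subseteq> g ` S"
    proof
      fix x assume x: "x \<in> lattice_points P"
      then have "x \<in> range g" unfolding rng by (auto simp: lattice_points_def intro: hull_inc)
      then show "x \<in> g ` S" using x unfolding S_def by blast
    qed
  qed (auto simp: S_def)
  have PS: "P = g ` (convex hull S)"
    using PL lat convex_hull_affine_injection[OF g, of S] by simp
  have S01: "s $ 1 = 0 \<or> s $ 1 = 1" "s $ 2 = 0 \<or> s $ 2 = 1" "s $ 3 = 0 \<or> s $ 3 = 1" if "s \<in> S" for s
    using F1(2)[of "g s"] F2(2)[of "g s"] F3(2)[of "g s"] that unfolding S_def by (auto simp: coord)
  then have S01': "\<forall>i. s $ i = 0 \<or> s $ i = 1" if "s \<in> S" for s using that by (simp add: forall_3)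
  have gv: "g 0 = v" "g (vector [0, 0, 1]) = e"
    unfolding g_def h_def e'_def by simp_all
  have "S \<subseteq> (\<lambda>(a, b, c). vector [a, b, c]) ` ({0, 1} \<times> {0, 1} \<times> {0, 1})"
  proof
    fix s assume "s \<in> S"
    then have "(s $ 1, s $ 2, s $ 3) \<in> {0, 1} \<times> {0, 1} \<times> {0, 1}" using S01[of s] by auto
    moreover have "s = vector [s $ 1, s $ 2, s $ 3]" by (simp add: vec_eq_iff forall_3)
    ultimately show "s \<in> (\<lambda>(a, b, c). vector [a, b, c]) ` ({0, 1} \<times> {0, 1} \<times> {0, 1})"
      by (intro image_eqI[of _ _ "(s $ 1, s $ 2, s $ 3)"]) simp_all
  qed
  then have finS: "finite S" by (rule finite_subset) simp
  have facet_card: "3 \<le> card {s \<in> S. s $ i = 0}"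
    if Fi: "Fi facet_of P" "Fi = {x \<in> P. a \<bullet> x = b}" and c: "\<And>y. a \<bullet> g y = b + y $ i" for Fi a b i
  proof -
    have "Fi face_of convex hull (lattice_points P)"
      using facet_of_imp_face_of[OF Fi(1)] PL by simp
    moreover have "compact (lattice_points P)" unfolding lat using finS by (simp add: finite_imp_compact)
    ultimately obtain S' where S': "S' \<subseteq> lattice_points P" "Fi = convex hull S'"
      using face_of_convex_hull_subset by blast
    then have "S' \<subseteq> Fi" by (simp add: hull_subset)
    have sub: "S' \<subseteq> g ` {s \<in> S. s $ i = 0}"
    proof
      fix x assume x: "x \<in> S'"
      then obtain s where s: "s \<in> S" "x = g s" using S'(1) lat by blast
      moreover have "a \<bullet> x = b" using x \<open>S' \<subseteq> Fi\<close> Fi(2) by blast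
      ultimately show "x \<in> g ` {s \<in> S. s $ i = 0}" using c[of s] by simp
    qed
    then have "finite S'" by (rule finite_subset) (use finS in auto)
    have "aff_dim Fi = 2" using Fi(1) dim by (simp add: facet_of_def)
    then have "aff_dim S' = 2" using S'(2) aff_dim_convex_hull[of S'] by simp
    then have "3 \<le> card S'" using aff_dim_le_card[OF \<open>finite S'\<close>] by simp
    also have "card S' \<le> card (g ` {s \<in> S. s $ i = 0})" by (rule card_mono) (use finS sub in auto)
    also have "\<dots> \<le> card {s \<in> S. s $ i = 0}" by (rule card_image_le) (use finS in auto)
    finally show ?thesis .
  qed
  have "\<forall>i. 3 \<le> card {s \<in> S. s $ i = 0}"
    unfolding forall_3
    using facet_card[OF F(1) F1(1) coord(1)] facet_card[OF F(2) F2(1) coord(2)]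
      facet_card[OF F(3) F3(1) coord(3)] by blast
  moreover have "0 \<in> S" "vector [0, 0, 1] \<in> S" unfolding S_def using gv L by simp_all
  ultimately show ?thesis
    using that[OF g rng lat PS] S01' by blast
qed

text \<open>On a line through three distinct points one of them lies strictly between the other two, which is
impossible for vertices of a cube. In coordinates: if \<open>q2 - q1\<close> and \<open>q3 - q1\<close> are proportional, then
\<open>q2\<close> and \<open>q3\<close> differ from \<open>q1\<close> in the same coordinates and so coincide.\<close>

lemma distinct_01_not_collinear:
  fixes q1 :: "real^'m"
  assumes "\<And>q i. q \<in> {q1, q2, q3} \<Longrightarrow> q $ i = 0 \<or> q $ i = 1" and "q1 \<noteq> q2" "q1 \<noteq> q3" "q2 \<noteq> q3"
  shows "2 \<le> aff_dim {q1, q2, q3}"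
proof -
  have "\<not> collinear {q1, q2, q3}"
  proof
    assume "collinear {q1, q2, q3}"
    then obtain u c d where c: "q2 - q1 = c *\<^sub>R u" and d: "q3 - q1 = d *\<^sub>R u"
      unfolding collinear_def by blast
    have cd: "c \<noteq> 0" "d \<noteq> 0" using c d assms(2,3) by auto
    obtain i where i: "q2 $ i \<noteq> q3 $ i" using assms(4) by (auto simp: vec_eq_iff)
    obtain j where j: "q1 $ j \<noteq> q2 $ j" using assms(2) by (auto simp: vec_eq_iff)
    have eq: "d * (q2 $ k - q1 $ k) = c * (q3 $ k - q1 $ k)" for k
      using arg_cong[OF c, of "\<lambda>x. x $ k"] arg_cong[OF d, of "\<lambda>x. x $ k"] by simp
    have "q3 $ k = q1 $ k \<longleftrightarrow> q2 $ k = q1 $ k" for k using eq[of k] cd by auto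
    then show False using i assms(1)[of _ i] by (metis insertCI)
  qed
  then show ?thesis unfolding collinear_aff_dim by simp
qed

text \<open>The points \<open>q1\<close>, \<open>q2\<close>, \<open>q3\<close> span a plane, so \<open>l\<close> defines a facet of \<open>P\<close>. If \<open>s1\<close> and \<open>s2\<close> were at
different levels below it, then the line through them would meet the plane of the facet. But the
normalised functional of this facet is constant on that line, since it has the same value at \<open>s1\<close>
and \<open>s2\<close>, and this value differs from the one on the facet.\<close>

lemma compressed_two_level:
  fixes P :: "(real^'n) set" and S :: "(real^3) set"
  assumes P: "compressed P" "aff_dim P = 3"
    and g: "affine_injection g" "range g = affine hull P" "lattice_points P = g ` S" "P = g ` (convex hull S)"
    and S01: "\<And>s i. s \<in> S \<Longrightarrow> s $ i = 0 \<or> s $ i = 1"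
    and le: "\<And>s. s \<in> S \<Longrightarrow> l \<bullet> s \<le> b"
    and q: "{q1, q2, q3} \<subseteq> S" "l \<bullet> q1 = b" "l \<bullet> q2 = b" "l \<bullet> q3 = b" "q1 \<noteq> q2" "q1 \<noteq> q3" "q2 \<noteq> q3"
    and s: "s1 \<in> S" "l \<bullet> s1 \<noteq> b" "s2 \<in> S" "l \<bullet> s2 \<noteq> b"
  shows "l \<bullet> s1 = l \<bullet> s2"
proof (rule ccontr)
  assume ne: "l \<bullet> s1 \<noteq> l \<bullet> s2"
  define G where "G = convex hull S \<inter> {x. l \<bullet> x = b}"
  have "convex hull S \<subseteq> {x. l \<bullet> x \<le> b}"
    by (rule hull_minimal) (use le convex_halfspace_le in auto)
  then have face: "G face_of convex hull S"
    unfolding G_def by (intro face_of_Int_supporting_hyperplane_le) auto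
  have "{q1, q2, q3} \<subseteq> G" unfolding G_def using q by (auto intro: hull_inc)
  then have "2 \<le> aff_dim G"
    using distinct_01_not_collinear[of q1 q2 q3] S01 q aff_dim_subset[of "{q1, q2, q3}" G]
    by (smt (verit) subset_iff)
  moreover have "aff_dim (convex hull S) = 3"
    using P(2) unfolding g(4) by (simp only: aff_dim_affine_injection[OF g(1)])
  moreover have "s1 \<in> convex hull S" "s1 \<notin> G" using s unfolding G_def by (auto intro: hull_inc)
  then have "aff_dim G < aff_dim (convex hull S)"
    using face_of_aff_dim_lt[OF convex_convex_hull face] by blast
  ultimately have dimG: "aff_dim G = 2" by simp
  have "G \<noteq> {}" using dimG by auto
  moreover have "l \<noteq> 0" using ne by auto
  moreover have "affine hull G \<subseteq> {x. l \<bullet> x = b}"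
    by (rule hull_minimal) (auto simp: G_def affine_hyperplane)
  ultimately have "affine hull G = {x. l \<bullet> x = b}"
    using dimG by (intro affine_dim_equal) (auto simp: affine_hyperplane)
  then have affG: "affine hull (g ` G) = g ` {x. l \<bullet> x = b}"
    using affine_hull_affine_injection[OF g(1), of G] by simp
  have "g ` G \<in> (`) g ` {F. F face_of convex hull S}" using face by blast
  then have "g ` G face_of P"
    unfolding faces_affine_injection[OF g(1), symmetric] g(4)[symmetric] by (rule CollectD)
  then have "g ` G facet_of P"
    using \<open>G \<noteq> {}\<close> by (simp add: facet_of_def aff_dim_affine_injection[OF g(1)] P(2) dimG)
  then obtain a c where ac: "affine hull (g ` G) = affine hull P \<inter> {x. a \<bullet> x = c}"
    "g ` G = {x \<in> P. a \<bullet> x = c}"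
    "\<And>x. x \<in> lattice_points P \<Longrightarrow> a \<bullet> x = c \<or> a \<bullet> x = c + 1"
    by (rule compressed_facet_functional[OF P(1)]) (rule that; assumption)
  have on: "a \<bullet> g x = c \<longleftrightarrow> l \<bullet> x = b" for x
  proof -
    have "g x \<in> affine hull P" unfolding g(2)[symmetric] by simp
    then have "a \<bullet> g x = c \<longleftrightarrow> g x \<in> g ` {x. l \<bullet> x = b}" using ac(1) affG by blast
    also have "\<dots> \<longleftrightarrow> l \<bullet> x = b" using inj_affine_injection[OF g(1)] by (auto simp: inj_def)
    finally show ?thesis .
  qed
  have "g s1 \<in> lattice_points P" "g s2 \<in> lattice_points P" using s g(3) by auto
  then have val: "a \<bullet> g s1 = c + 1" "a \<bullet> g s2 = c + 1" using ac(3) on s by blast+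
  \<comment> \<open>the parameter at which the line through \<open>s1\<close> and \<open>s2\<close> meets the plane of the facet\<close>
  define t where "t = (b - l \<bullet> s1) / (l \<bullet> s2 - l \<bullet> s1)"
  have t: "t * (l \<bullet> s2 - l \<bullet> s1) = b - l \<bullet> s1" using ne unfolding t_def by simp
  have "l \<bullet> ((1 - t) *\<^sub>R s1 + t *\<^sub>R s2) = b"
    using t by (simp add: inner_add_right algebra_simps)
  then have "a \<bullet> g ((1 - t) *\<^sub>R s1 + t *\<^sub>R s2) = c" using on by blast
  moreover have "a \<bullet> g ((1 - t) *\<^sub>R s1 + t *\<^sub>R s2) = c + 1"
    unfolding affine_injection_affine[OF g(1), of "1 - t" t, simplified]
    by (simp add: inner_add_right val algebra_simps)
  ultimately show False by simp
qed

text \<open>A form of \<open>has_pulling_triangulation_mnf\<close> that keeps the combinatorial certificate, which does not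
change under affine injections.\<close>

definition pullable :: "nat \<Rightarrow> (real^'n) set \<Rightarrow> bool" where
  "pullable k P \<longleftrightarrow> (\<exists>v Zs js Cs Ns. pulling_model P v (map set Zs) (set ` set Cs) \<and>
     pulling_check Zs (length v) js Cs Ns \<and> (\<forall>N\<in>set Ns. set N \<subseteq> {..<length v} \<and> card (set N) = k))"

lemma pullableI:
  assumes "pulling_model P v (map set Zs) (set ` set Cs)" "pulling_check Zs (length v) js Cs Ns"
    and "\<forall>N\<in>set Ns. set N \<subseteq> {..<length v} \<and> card (set N) = k"
  shows "pullable k P"
  using assms unfolding pullable_def by (intro exI conjI)

lemma pullable_image:
  assumes "pullable k P" "affine_injection g" "lattice_points (g ` P) = g ` lattice_points P"
  shows "pullable k (g ` P)"
proof -
  obtain v Zs js Cs Ns where "pulling_model P v (map set Zs) (set ` set Cs)"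
    and check: "pulling_check Zs (length v) js Cs Ns"
    "\<forall>N\<in>set Ns. set N \<subseteq> {..<length v} \<and> card (set N) = k"
    using assms(1) unfolding pullable_def by (elim exE conjE) (rule that)
  then have "pulling_model (g ` P) (map g v) (map set Zs) (set ` set Cs)"
    using pulling_model_image assms(2,3) by blast
  then show ?thesis
    by (rule pullableI[where js = js and Ns = Ns]) (use check in simp_all)
qed

lemma has_pulling_triangulation_mnf_if_pullable:
  assumes "pullable k P"
  shows "has_pulling_triangulation_mnf k P"
proof -
  obtain v Zs js Cs Ns where M: "pulling_model P v (map set Zs) (set ` set Cs)"
    and check: "pulling_check Zs (length v) js Cs Ns"
    and Ns: "\<forall>N\<in>set Ns. set N \<subseteq> {..<length v} \<and> card (set N) = k"
    using assms unfolding pullable_def by (elim exE conjE) (rule that)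
  show ?thesis
    using Ns by (intro has_pulling_triangulation_mnf_if_pulling_yields[OF pulling_yields_if_check[OF M check]
        pulling_modelD(2)[OF M]]) auto
qed

lemma pullable_polytopes:
  "pullable 2 poly_Ia3" "pullable 2 poly_IIc3" "pullable 2 poly_Ib3" "pullable 2 prism3" "pullable 2 cube3"
  "pullable 2 poly_IIc4" "pullable 2 poly_Id4" "pullable 2 poly_IIf4" "pullable 2 poly_IIId4"
  "pullable 2 poly_Ia4" "pullable 3 poly_Vb4"
  by (rule pullableI[OF pulling_model_Ia3 pulling_check_Ia3], simp)
    (rule pullableI[OF pulling_model_IIc3 pulling_check_IIc3], simp add: verts_IIc3_def,
    rule pullableI[OF pulling_model_Ib3 pulling_check_Ib3], simp add: verts_Ib3_def,
    rule pullableI[OF pulling_model_prism pulling_check_prism], simp add: verts_prism3_def,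
    rule pullableI[OF pulling_model_cube pulling_check_cube], simp add: verts_cube3_def,
    rule pullableI[OF pulling_model_IIc4 pulling_check_IIc4], simp,
    rule pullableI[OF pulling_model_Id4 pulling_check_Id4], simp add: verts_Id4_def,
    rule pullableI[OF pulling_model_IIf4 pulling_check_IIf4], simp add: verts_IIf4_def,
    rule pullableI[OF pulling_model_IIId4 pulling_check_IIId4], simp add: verts_IIId4_def,
    rule pullableI[OF pulling_model_Ia4 pulling_check_Ia4], simp add: verts_Ia4_def,
    rule pullableI[OF pulling_model_Vb4 pulling_check_Vb4], simp add: verts_Vb4_def)

lemma affine_injection_coordinates:
  "affine_injection (\<lambda>x :: real^3. x)"
  "affine_injection (\<lambda>x :: real^3. vector [x $ 3, x $ 2, x $ 1] :: real^3)"
  "affine_injection (\<lambda>x :: real^3. vector [x $ 2, x $ 3, x $ 1] :: real^3)"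
  "affine_injection (\<lambda>x :: real^3. vector [x $ 3, x $ 1, x $ 2] :: real^3)"
  "affine_injection (\<lambda>x :: real^3. vector [x $ 1, x $ 3, x $ 2] :: real^3)"
  "affine_injection (\<lambda>x :: real^3. vector [x $ 3, x $ 1, 1 - x $ 1 - x $ 2] :: real^3)"
  "affine_injection (\<lambda>x :: real^3. vector [x $ 3, x $ 1, 1 - x $ 2 - x $ 3] :: real^3)"
  by (rule affine_injectionI;
      (rule injI)?, simp add: vec_eq_iff forall_3 vector_3 algebra_simps flip: distrib_right)+

abbreviation pt :: "real \<Rightarrow> real \<Rightarrow> real \<Rightarrow> real^3" where
  "pt a b c \<equiv> vector [a, b, c]"

text \<open>The hypotheses are those provided by \<open>compressed_coordinates\<close> and \<open>compressed_two_level\<close>. Besides the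
origin and \<open>pt 0 0 1\<close>, the set \<open>S\<close> may contain six further vertices of the cube. By \<open>facets\<close>, enough of
them lie in each coordinate plane. Each of the facts \<open>f1\<close> to \<open>f6\<close> below excludes a set of points for
which some facet would have points on two different further levels. Twelve sets remain, and
a permutation of coordinates or, for two of the pyramids, an affine map that moves the apex to the
origin identifies each of them with one of the five models.\<close>

lemma two_level_01_classification:
  fixes S :: "(real^3) set"
  assumes S01: "\<And>s i. s \<in> S \<Longrightarrow> s $ i = 0 \<or> s $ i = 1"
    and S0: "0 \<in> S" "pt 0 0 1 \<in> S" and facets: "\<And>i. 3 \<le> card {s \<in> S. s $ i = 0}"
    and two: "\<And>l b q1 q2 q3 s1 s2. (\<And>s. s \<in> S \<Longrightarrow> l \<bullet> s \<le> b) \<Longrightarrow> {q1, q2, q3} \<subseteq> S \<Longrightarrow>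
      l \<bullet> q1 = b \<Longrightarrow> l \<bullet> q2 = b \<Longrightarrow> l \<bullet> q3 = b \<Longrightarrow> q1 \<noteq> q2 \<Longrightarrow> q1 \<noteq> q3 \<Longrightarrow> q2 \<noteq> q3 \<Longrightarrow>
      s1 \<in> S \<Longrightarrow> l \<bullet> s1 \<noteq> b \<Longrightarrow> s2 \<in> S \<Longrightarrow> l \<bullet> s2 \<noteq> b \<Longrightarrow> l \<bullet> s1 = l \<bullet> s2"
  obtains A :: "real^3 \<Rightarrow> real^3" and v where "affine_injection A" "S = A ` set v"
    "v \<in> {verts_Ia3, verts_IIc3, verts_Ib3, verts_prism3, verts_cube3}"
proof -
  have zero: "pt 0 0 0 = 0" by (simp add: vec_eq_iff forall_3)
  have S0': "pt 0 0 0 \<in> S" using S0(1) by (simp add: zero)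
  have S8: "s \<in> {pt 0 0 0, pt 0 0 1, pt 1 0 0, pt 0 1 0, pt 1 1 0, pt 1 0 1, pt 0 1 1, pt 1 1 1}"
    if "s \<in> S" for s
    using S01[OF that, of 1] S01[OF that, of 2] S01[OF that, of 3]
    by (elim disjE) (simp_all add: vec_eq_iff forall_3)
  have pair: "a \<in> S \<or> b \<in> S"
    if "{s \<in> S. s $ i = 0} \<subseteq> {c, d, a, b}" for a b c d i
  proof (rule ccontr)
    assume "\<not> (a \<in> S \<or> b \<in> S)"
    then have "{s \<in> S. s $ i = 0} \<subseteq> {c, d}" using that by blast
    then have "card {s \<in> S. s $ i = 0} \<le> card {c, d}" by (intro card_mono) auto
    also have "\<dots> \<le> 2" by (simp add: card_insert_if)
    finally show False using facets[of i] by simp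
  qed
  \<comment> \<open>The last three lines list the same plane, each time with another pair of points at the end.\<close>
  have planes: "{s \<in> S. s $ 1 = 0} \<subseteq> {pt 0 0 0, pt 0 0 1, pt 0 1 0, pt 0 1 1}"
    "{s \<in> S. s $ 2 = 0} \<subseteq> {pt 0 0 0, pt 0 0 1, pt 1 0 0, pt 1 0 1}"
    "{s \<in> S. s $ 3 = 0} \<subseteq> {pt 0 0 0, pt 1 0 0, pt 0 1 0, pt 1 1 0}"
    "{s \<in> S. s $ 3 = 0} \<subseteq> {pt 0 0 0, pt 0 1 0, pt 1 0 0, pt 1 1 0}"
    "{s \<in> S. s $ 3 = 0} \<subseteq> {pt 0 0 0, pt 1 1 0, pt 1 0 0, pt 0 1 0}"
    by (auto dest!: S8 simp: vector_3)
  note p = pair[OF planes(1)] pair[OF planes(2)] pair[OF planes(3)] pair[OF planes(4)] pair[OF planes(5)]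
  note ip = inner_vec_def sum_3 vector_3 vec_eq_iff forall_3
  have f1: "pt 1 1 1 \<in> S" if "pt 1 1 0 \<in> S" "pt 1 0 1 \<in> S" "pt 0 1 1 \<in> S"
  proof (rule ccontr)
    assume "pt 1 1 1 \<notin> S"
    then have "pt 1 1 1 \<bullet> s \<le> 2" if "s \<in> S" for s
      using that S8[OF that] by (auto simp: inner_vec_def sum_3 vector_3)
    from two[OF this, of "pt 1 1 0" "pt 1 0 1" "pt 0 1 1" "pt 0 0 0" "pt 0 0 1"]
    show False using that S0' S0(2) by (simp add: ip)
  qed
  have f2: "pt 1 0 1 \<in> S" if "pt 1 0 0 \<in> S" "pt 0 1 0 \<in> S" "pt 1 1 1 \<in> S"
  proof (rule ccontr)
    assume "pt 1 0 1 \<notin> S"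
    then have "pt 1 (-1) 1 \<bullet> s \<le> 1" if "s \<in> S" for s
      using that S8[OF that] by (auto simp: inner_vec_def sum_3 vector_3)
    from two[OF this, of "pt 1 0 0" "pt 0 0 1" "pt 1 1 1" "pt 0 0 0" "pt 0 1 0"]
    show False using that S0' S0(2) by (simp add: ip)
  qed
  have f3: "pt 0 1 1 \<in> S" if "pt 1 0 0 \<in> S" "pt 0 1 0 \<in> S" "pt 1 1 1 \<in> S"
  proof (rule ccontr)
    assume "pt 0 1 1 \<notin> S"
    then have "pt (-1) 1 1 \<bullet> s \<le> 1" if "s \<in> S" for s
      using that S8[OF that] by (auto simp: inner_vec_def sum_3 vector_3)
    from two[OF this, of "pt 0 1 0" "pt 0 0 1" "pt 1 1 1" "pt 0 0 0" "pt 1 0 0"]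
    show False using that S0' S0(2) by (simp add: ip)
  qed
  have f4: "pt 1 1 0 \<in> S" if "pt 1 0 0 \<in> S" "pt 0 1 0 \<in> S" "pt 1 1 1 \<in> S"
  proof (rule ccontr)
    assume "pt 1 1 0 \<notin> S"
    then have "pt 1 1 (-1) \<bullet> s \<le> 1" if "s \<in> S" for s
      using that S8[OF that] by (auto simp: inner_vec_def sum_3 vector_3)
    from two[OF this, of "pt 1 0 0" "pt 0 1 0" "pt 1 1 1" "pt 0 0 0" "pt 0 0 1"]
    show False using that S0' S0(2) by (simp add: ip)
  qed
  have f5: "pt 1 0 0 \<in> S" if "pt 1 1 0 \<in> S" "pt 1 0 1 \<in> S" "pt 0 1 1 \<in> S"
  proof (rule ccontr)
    assume "pt 1 0 0 \<notin> S"
    then have "pt 1 (-1) (-1) \<bullet> s \<le> 0" if "s \<in> S" for s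
      using that S8[OF that] by (auto simp: inner_vec_def sum_3 vector_3)
    from two[OF this, of "pt 0 0 0" "pt 1 1 0" "pt 1 0 1" "pt 0 0 1" "pt 0 1 1"]
    show False using that S0' S0(2) by (simp add: ip)
  qed
  have f6: "pt 0 1 0 \<in> S" if "pt 1 1 0 \<in> S" "pt 1 0 1 \<in> S" "pt 0 1 1 \<in> S"
  proof (rule ccontr)
    assume "pt 0 1 0 \<notin> S"
    then have "pt (-1) 1 (-1) \<bullet> s \<le> 0" if "s \<in> S" for s
      using that S8[OF that] by (auto simp: inner_vec_def sum_3 vector_3)
    from two[OF this, of "pt 0 0 0" "pt 1 1 0" "pt 0 1 1" "pt 0 0 1" "pt 1 0 1"]
    show False using that S0' S0(2) by (simp add: ip)
  qed
  have S_eq: "S = set (filter (\<lambda>s. s \<in> S) [pt 0 0 0, pt 0 0 1, pt 1 0 0, pt 0 1 0, pt 1 1 0, pt 1 0 1, pt 0 1 1, pt 1 1 1])"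
    using S8 by auto
  consider (1) "pt 1 0 0 \<notin> S" "pt 0 1 0 \<in> S" "pt 1 1 0 \<in> S" "pt 1 0 1 \<in> S" "pt 0 1 1 \<notin> S" "pt 1 1 1 \<notin> S"
    | (2) "pt 1 0 0 \<notin> S" "pt 0 1 0 \<in> S" "pt 1 1 0 \<in> S" "pt 1 0 1 \<in> S" "pt 0 1 1 \<notin> S" "pt 1 1 1 \<in> S"
    | (3) "pt 1 0 0 \<in> S" "pt 0 1 0 \<notin> S" "pt 1 1 0 \<in> S" "pt 1 0 1 \<notin> S" "pt 0 1 1 \<in> S" "pt 1 1 1 \<notin> S"
    | (4) "pt 1 0 0 \<in> S" "pt 0 1 0 \<notin> S" "pt 1 1 0 \<in> S" "pt 1 0 1 \<notin> S" "pt 0 1 1 \<in> S" "pt 1 1 1 \<in> S"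
    | (5) "pt 1 0 0 \<in> S" "pt 0 1 0 \<in> S" "pt 1 1 0 \<notin> S" "pt 1 0 1 \<notin> S" "pt 0 1 1 \<notin> S" "pt 1 1 1 \<notin> S"
    | (6) "pt 1 0 0 \<in> S" "pt 0 1 0 \<in> S" "pt 1 1 0 \<notin> S" "pt 1 0 1 \<notin> S" "pt 0 1 1 \<in> S" "pt 1 1 1 \<notin> S"
    | (7) "pt 1 0 0 \<in> S" "pt 0 1 0 \<in> S" "pt 1 1 0 \<notin> S" "pt 1 0 1 \<in> S" "pt 0 1 1 \<notin> S" "pt 1 1 1 \<notin> S"
    | (8) "pt 1 0 0 \<in> S" "pt 0 1 0 \<in> S" "pt 1 1 0 \<notin> S" "pt 1 0 1 \<in> S" "pt 0 1 1 \<in> S" "pt 1 1 1 \<notin> S"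
    | (9) "pt 1 0 0 \<in> S" "pt 0 1 0 \<in> S" "pt 1 1 0 \<in> S" "pt 1 0 1 \<notin> S" "pt 0 1 1 \<notin> S" "pt 1 1 1 \<notin> S"
    | (10) "pt 1 0 0 \<in> S" "pt 0 1 0 \<in> S" "pt 1 1 0 \<in> S" "pt 1 0 1 \<notin> S" "pt 0 1 1 \<in> S" "pt 1 1 1 \<notin> S"
    | (11) "pt 1 0 0 \<in> S" "pt 0 1 0 \<in> S" "pt 1 1 0 \<in> S" "pt 1 0 1 \<in> S" "pt 0 1 1 \<notin> S" "pt 1 1 1 \<notin> S"
    | (12) "pt 1 0 0 \<in> S" "pt 0 1 0 \<in> S" "pt 1 1 0 \<in> S" "pt 1 0 1 \<in> S" "pt 0 1 1 \<in> S" "pt 1 1 1 \<in> S"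
    using p f1 f2 f3 f4 f5 f6 by argo
  then show ?thesis
  proof cases
    case 1
    then have "S = {pt 0 0 0, pt 0 0 1, pt 0 1 0, pt 1 1 0, pt 1 0 1}"
      by (intro trans[OF S_eq]) (simp add: S0' S0(2))
    then show ?thesis
      by (intro that[OF affine_injection_coordinates(6), of verts_IIc3])
        (auto simp: verts_IIc3_def vector_3)
  next
    case 2
    then have "S = {pt 0 0 0, pt 0 0 1, pt 0 1 0, pt 1 1 0, pt 1 0 1, pt 1 1 1}"
      by (intro trans[OF S_eq]) (simp add: S0' S0(2))
    then show ?thesis
      by (intro that[OF affine_injection_coordinates(2), of verts_Ib3])
        (auto simp: verts_Ib3_def vector_3)
  next
    case 3
    then have "S = {pt 0 0 0, pt 0 0 1, pt 1 0 0, pt 1 1 0, pt 0 1 1}"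
      by (intro trans[OF S_eq]) (simp add: S0' S0(2))
    then show ?thesis
      by (intro that[OF affine_injection_coordinates(7), of verts_IIc3])
        (auto simp: verts_IIc3_def vector_3)
  next
    case 4
    then have "S = {pt 0 0 0, pt 0 0 1, pt 1 0 0, pt 1 1 0, pt 0 1 1, pt 1 1 1}"
      by (intro trans[OF S_eq]) (simp add: S0' S0(2))
    then show ?thesis
      by (intro that[OF affine_injection_coordinates(3), of verts_Ib3])
        (auto simp: verts_Ib3_def vector_3)
  next
    case 5
    then have "S = {pt 0 0 0, pt 0 0 1, pt 1 0 0, pt 0 1 0}"
      by (intro trans[OF S_eq]) (simp add: S0' S0(2))
    then show ?thesis
      by (intro that[OF affine_injection_coordinates(1), of verts_Ia3])
        (auto simp: verts_Ia3_def vector_3)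
  next
    case 6
    then have "S = {pt 0 0 0, pt 0 0 1, pt 1 0 0, pt 0 1 0, pt 0 1 1}"
      by (intro trans[OF S_eq]) (simp add: S0' S0(2))
    then show ?thesis
      by (intro that[OF affine_injection_coordinates(3), of verts_IIc3])
        (auto simp: verts_IIc3_def vector_3)
  next
    case 7
    then have "S = {pt 0 0 0, pt 0 0 1, pt 1 0 0, pt 0 1 0, pt 1 0 1}"
      by (intro trans[OF S_eq]) (simp add: S0' S0(2))
    then show ?thesis
      by (intro that[OF affine_injection_coordinates(2), of verts_IIc3])
        (auto simp: verts_IIc3_def vector_3)
  next
    case 8
    then have "S = {pt 0 0 0, pt 0 0 1, pt 1 0 0, pt 0 1 0, pt 1 0 1, pt 0 1 1}"
      by (intro trans[OF S_eq]) (simp add: S0' S0(2))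
    then show ?thesis
      by (intro that[OF affine_injection_coordinates(2), of verts_prism3])
        (auto simp: verts_prism3_def vector_3)
  next
    case 9
    then have "S = {pt 0 0 0, pt 0 0 1, pt 1 0 0, pt 0 1 0, pt 1 1 0}"
      by (intro trans[OF S_eq]) (simp add: S0' S0(2))
    then show ?thesis
      by (intro that[OF affine_injection_coordinates(4), of verts_IIc3])
        (auto simp: verts_IIc3_def vector_3)
  next
    case 10
    then have "S = {pt 0 0 0, pt 0 0 1, pt 1 0 0, pt 0 1 0, pt 1 1 0, pt 0 1 1}"
      by (intro trans[OF S_eq]) (simp add: S0' S0(2))
    then show ?thesis
      by (intro that[OF affine_injection_coordinates(4), of verts_prism3])
        (auto simp: verts_prism3_def vector_3)
  next
    case 11
    then have "S = {pt 0 0 0, pt 0 0 1, pt 1 0 0, pt 0 1 0, pt 1 1 0, pt 1 0 1}"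
      by (intro trans[OF S_eq]) (simp add: S0' S0(2))
    then show ?thesis
      by (intro that[OF affine_injection_coordinates(5), of verts_prism3])
        (auto simp: verts_prism3_def vector_3)
  next
    case 12
    then have "S = {pt 0 0 0, pt 0 0 1, pt 1 0 0, pt 0 1 0, pt 1 1 0, pt 1 0 1, pt 0 1 1, pt 1 1 1}"
      by (intro trans[OF S_eq]) (simp add: S0' S0(2))
    then show ?thesis
      by (intro that[OF affine_injection_coordinates(1), of verts_cube3])
        (auto simp: verts_cube3_def vector_3)
  qed
qed

text \<open>In the coordinates of \<open>compressed_coordinates\<close> the polytope is the image of one of the five models,
with corresponding lattice points.\<close>

theorem compressed_dim_3_pullable:
  fixes P :: "(real^'n) set"
  assumes P: "compressed P" "aff_dim P = 3"
  shows "pullable 2 P"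
proof -
  obtain g :: "real^3 \<Rightarrow> real^'n" and S where g: "affine_injection g" "range g = affine hull P"
    "lattice_points P = g ` S" "P = g ` (convex hull S)"
    and S: "\<And>s i. s \<in> S \<Longrightarrow> s $ i = 0 \<or> s $ i = 1" "0 \<in> S" "pt 0 0 1 \<in> S"
      "\<And>i. 3 \<le> card {s \<in> S. s $ i = 0}"
    using compressed_coordinates[OF P] by blast
  obtain A v where A: "affine_injection A" "S = A ` set v"
    "v \<in> {verts_Ia3, verts_IIc3, verts_Ib3, verts_prism3, verts_cube3}"
    by (rule two_level_01_classification[OF S compressed_two_level[OF P g S(1)]])
  obtain Q where Q: "Q = convex hull set v" "lattice_points Q = set v" "pullable 2 Q"
    using A(3) pulling_modelD(1,3)[OF pulling_model_Ia3] pulling_modelD(1,3)[OF pulling_model_IIc3]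
      pulling_modelD(1,3)[OF pulling_model_Ib3] pulling_modelD(1,3)[OF pulling_model_prism]
      pulling_modelD(1,3)[OF pulling_model_cube] pullable_polytopes(1-5)
    by blast
  have inj: "affine_injection (g \<circ> A)" by (rule affine_injection_comp[OF g(1) A(1)])
  have im: "P = (g \<circ> A) ` Q"
    unfolding g(4) A(2) Q(1) image_comp[symmetric] convex_hull_affine_injection[OF A(1)] by (rule refl)
  have "lattice_points P = (g \<circ> A) ` lattice_points Q"
    unfolding g(3) A(2) Q(2) by (rule image_comp)
  then show ?thesis using pullable_image[OF Q(3) inj] im by simp
qed

text \<open>An affine span through the origin is a linear span.\<close>

lemma affine_hull_UNIV:
  fixes Q :: "(real^3) set"
  assumes "{0, a, b, c} \<subseteq> Q" and "\<And>x. \<exists>r s t. x = r *\<^sub>R a + s *\<^sub>R b + t *\<^sub>R c"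
  shows "affine hull Q = UNIV"
proof -
  have "affine hull Q = span Q" using assms(1) by (intro affine_hull_span_0 hull_inc) auto
  moreover have "x \<in> span Q" for x
  proof -
    obtain r s t where "x = r *\<^sub>R a + s *\<^sub>R b + t *\<^sub>R c" using assms(2) by blast
    then show ?thesis using assms(1) by (simp add: span_add span_scale span_base)
  qed
  ultimately show ?thesis by blast
qed

lemma lattice_equiv_pullable:
  fixes P :: "(real^'n) set" and Q :: "(real^3) set"
  assumes "lattice_equiv P Q" "affine hull Q = UNIV" "pullable k Q"
  shows "pullable k P"
proof -
  obtain g :: "real^3 \<Rightarrow> real^'n" where "affine_injection g" "P = g ` Q"
    "lattice_points P = g ` lattice_points Q"
    by (rule lattice_equiv_imp_affine_injection[OF assms(1,2)])
  then show ?thesis using pullable_image[OF assms(3)] by simp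
qed

lemma affine_hull_polytopes:
  "affine hull poly_Ia3 = UNIV" "affine hull poly_IIc3 = UNIV" "affine hull poly_Ib3 = UNIV"
proof -
  have "\<exists>r s t. x = r *\<^sub>R pt 1 0 0 + s *\<^sub>R pt 0 1 0 + t *\<^sub>R pt 0 0 1" for x
    by (intro exI[of _ "x $ 1"] exI[of _ "x $ 2"] exI[of _ "x $ 3"]) (simp add: vec_eq_iff forall_3)
  then show "affine hull poly_Ia3 = UNIV" "affine hull poly_IIc3 = UNIV"
    by (intro affine_hull_UNIV[of "pt 1 0 0" "pt 0 1 0" "pt 0 0 1"];
        simp add: poly_Ia3_def poly_IIc3_def)+
  have "\<exists>r s t. x = r *\<^sub>R pt 1 0 0 + s *\<^sub>R pt 0 1 0 + t *\<^sub>R pt 1 0 1" for x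
    by (intro exI[of _ "x $ 1 - x $ 3"] exI[of _ "x $ 2"] exI[of _ "x $ 3"]) (simp add: vec_eq_iff forall_3)
  then show "affine hull poly_Ib3 = UNIV"
    by (intro affine_hull_UNIV[of "pt 1 0 0" "pt 0 1 0" "pt 1 0 1"]; simp add: poly_Ib3_def)
qed

section \<open>Unimodular simplices\<close>

text \<open>The standard simplex is spanned by the origin and the standard basis. A lattice point \<open>x\<close> is the
affine combination whose coefficients at the basis vectors are the coordinates of \<open>x\<close>; the
coefficient at the origin makes the sum 1.\<close>

lemma unimodular_standard_simplex:
  "unimodular_simplex CARD('n) {p :: real^'n. (\<forall>i. 0 \<le> p $ i) \<and> (\<Sum>i\<in>UNIV. p $ i) \<le> 1}"
proof -
  let ?B = "Basis :: (real^'n) set"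
  let ?V = "insert 0 ?B"
  have B: "?B = range (\<lambda>i. axis i 1)" by (auto simp: Basis_vec_def)
  have sumB: "(\<Sum>b\<in>?B. f b) = (\<Sum>i\<in>UNIV. f (axis i 1))" for f :: "real^'n \<Rightarrow> 'b::comm_monoid_add"
    unfolding B by (subst sum.reindex) (auto simp: inj_on_def axis_eq_axis)
  have "?V \<subseteq> int_lattice" unfolding B by (auto simp: int_lattice_def axis_def)
  moreover have "\<not> affine_dependent ?V"
    using affine_dependent_iff_dependent[of 0 ?B] independent_Basis by simp
  moreover have "card ?V = CARD('n) + 1" by simp
  moreover have "{p :: real^'n. (\<forall>i. 0 \<le> p $ i) \<and> (\<Sum>i\<in>UNIV. p $ i) \<le> 1} = convex hull ?V"
    unfolding std_simplex sumB by (auto simp: B inner_axis)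
  moreover have "\<exists>k :: real^'n \<Rightarrow> int. sum k ?V = 1 \<and> x = (\<Sum>v\<in>?V. of_int (k v) *\<^sub>R v)"
    if "x \<in> int_lattice" for x
  proof -
    define k where "k = (\<lambda>v. if v = 0 then 1 - (\<Sum>b\<in>?B. \<lfloor>x \<bullet> b\<rfloor>) else \<lfloor>x \<bullet> v\<rfloor>)"
    have kB: "k b = \<lfloor>x \<bullet> b\<rfloor>" if "b \<in> ?B" for b using that by (auto simp: k_def)
    have "sum k ?V = k 0 + sum k ?B" by (subst sum.insert) auto
    also have "sum k ?B = (\<Sum>b\<in>?B. \<lfloor>x \<bullet> b\<rfloor>)" using kB by (rule sum.cong[OF refl])
    finally have "sum k ?V = 1" by (simp add: k_def)
    have "of_int \<lfloor>x \<bullet> b\<rfloor> = x \<bullet> b" if "b \<in> ?B" for b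
    proof -
      have "x \<bullet> b \<in> \<int>"
        using that \<open>x \<in> int_lattice\<close> unfolding B by (auto simp: int_lattice_def inner_axis)
      then show ?thesis by (elim Ints_cases) simp
    qed
    then have "(\<Sum>b\<in>?B. of_int (k b) *\<^sub>R b) = (\<Sum>b\<in>?B. (x \<bullet> b) *\<^sub>R b)"
      using kB by (intro sum.cong refl) simp
    then have "x = (\<Sum>v\<in>?V. of_int (k v) *\<^sub>R v)"
      by (subst sum.insert) (auto simp: euclidean_representation)
    then show ?thesis using \<open>sum k ?V = 1\<close> by blast
  qed
  ultimately show ?thesis
    unfolding unimodular_simplex_def by (intro exI[of _ ?V]) (auto simp: lattice_points_def)
qed

section \<open>The triangulations\<close>

theorem proposition6p1:
  fixes P :: "(real^'n) set"
  shows
    "has_pulling_triangulation_mnf 2 poly_IIc4 \<and>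
     has_pulling_triangulation_mnf 2 poly_Id4 \<and>
     has_pulling_triangulation_mnf 2 poly_IIf4 \<and>
     has_pulling_triangulation_mnf 2 poly_IIId4 \<and>
     has_pulling_triangulation_mnf 2 poly_Ia4 \<and>
     (flow_polytope TYPE('a::finite) TYPE('v::finite) P \<and> prime_polytope P \<and> compressed P \<and>
        aff_dim P = 3 \<longrightarrow> has_pulling_triangulation_mnf 2 P) \<and>
     (lattice_equiv P poly_Ia3 \<or> lattice_equiv P poly_IIc3 \<or> lattice_equiv P poly_Ib3 \<longrightarrow>
        has_pulling_triangulation_mnf 2 P) \<and>
     has_pulling_triangulation_mnf 2 poly_Ia3 \<and>
     has_pulling_triangulation_mnf 2 poly_IIc3 \<and>
     has_pulling_triangulation_mnf 2 poly_Ib3 \<and>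
     has_pulling_triangulation_mnf 3 poly_Vb4 \<and>
     unimodular_simplex 3 poly_Ia3 \<and>
     unimodular_simplex 4 poly_IIc4 \<and>
     pulling_yields poly_IIc3 verts_IIc3 [0]
       {{0,2,3,4}, {0,1,3,4}}
       {{1,2}} \<and>
     pulling_yields poly_Ib3 verts_Ib3 [0]
       {{0,1,2,5}, {0,3,4,5}, {0,1,3,5}, {0,2,4,5}}
       {{1,4}, {2,3}} \<and>
     pulling_yields poly_Id4 verts_Id4 [2]
       {{0,1,2,3,5}, {0,1,2,4,5}}
       {{3,4}} \<and>
     pulling_yields poly_IIf4 verts_IIf4 [2,3]
       {{0,1,2,3,5}, {0,2,3,5,6}, {0,2,3,4,6}}
       {{1,4}, {1,6}, {4,5}} \<and>
     pulling_yields poly_IIId4 verts_IIId4 [3,0,4]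
       {{0,1,2,3,5}, {0,3,5,6,7}, {0,1,3,5,7}, {1,2,3,4,5}, {1,3,4,5,7}}
       {{0,4}, {1,6}, {2,6}, {2,7}, {4,6}} \<and>
     pulling_yields poly_Ia4 verts_Ia4 [4,6,5]
       {{0,4,5,6,7}, {0,4,6,7,8}, {0,1,2,4,6}, {0,1,4,5,6}, {0,1,3,4,5}, {0,3,4,5,7}}
       {{1,7}, {1,8}, {2,3}, {2,5}, {2,7}, {2,8}, {3,6}, {3,8}, {5,8}} \<and>
     pulling_yields poly_Vb4 verts_Vb4 [0]
       {{0,2,3,4,5}, {0,1,2,3,5}, {0,1,2,4,5}}
       {{1,3,4}}"
proof (intro conjI impI)
  show "unimodular_simplex 3 poly_Ia3" "unimodular_simplex 4 poly_IIc4"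
    using unimodular_standard_simplex[where 'n = 3] unimodular_standard_simplex[where 'n = 4]
    by (simp_all add: poly_Ia3_def poly_IIc4_def forall_3 forall_4 sum_3 sum_4)
next
  assume "flow_polytope TYPE('a) TYPE('v) P \<and> prime_polytope P \<and> compressed P \<and> aff_dim P = 3"
  then show "has_pulling_triangulation_mnf 2 P"
    by (intro has_pulling_triangulation_mnf_if_pullable compressed_dim_3_pullable) auto
next
  assume "lattice_equiv P poly_Ia3 \<or> lattice_equiv P poly_IIc3 \<or> lattice_equiv P poly_Ib3"
  then show "has_pulling_triangulation_mnf 2 P"
    using lattice_equiv_pullable affine_hull_polytopes pullable_polytopes(1-3)
      has_pulling_triangulation_mnf_if_pullable by metis
qed (insert pullable_polytopes[THEN has_pulling_triangulation_mnf_if_pullable]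
    pulling_yields_if_check[OF pulling_model_IIc3 pulling_check_IIc3]
    pulling_yields_if_check[OF pulling_model_Ib3 pulling_check_Ib3]
    pulling_yields_if_check[OF pulling_model_Id4 pulling_check_Id4]
    pulling_yields_if_check[OF pulling_model_IIf4 pulling_check_IIf4]
    pulling_yields_if_check[OF pulling_model_IIId4 pulling_check_IIId4]
    pulling_yields_if_check[OF pulling_model_Ia4 pulling_check_Ia4]
    pulling_yields_if_check[OF pulling_model_Vb4 pulling_check_Vb4], simp_all)

end
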